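(* In the algorithm setup, assume Property (P2). Fix a variable $i$, a factor $a\in\partial i$ and $1\le\ell\le L$. Then there exists (on a suitable extension of the probability space) a random variable $U\sim\mathcal N(0,\nu_\ell)$ independent of $\mathcal G_i^{\ell-1}$ such that for every $p>0$, $$\mathrm{plim}_{d\to\infty}\ \mathbb E\big[|u^\ell_{i\to a}-U|^p\,\big|\,\mathcal G_i^{\ell-1}\big]=0.$$
   Context: Algorithm setup. Fix $r\ge2$ and a predicate $f:\{\pm1\}^r\to\{0,1\}$, identified with its multilinear extension $f(x)=\sum_{S\subseteq[r]}\hat f(S)\prod_{\iota\in S}x_\iota$ on $\mathbb R^r$, and assume $\hat f(S)=0$ whenever $|S|=1$. Let $\xi(s)=\sum_{j=1}^r\big(\sum_{|S|=j}\hat f(S)^2\big)s^j$. Fix $\delta>0$, let $L=\lfloor1/\delta\rfloor$, and for $\ell\ge1$ let $\nu_\ell=\big(\xi'(\ell\delta)-\xi'((\ell-1)\delta)\big)/r$. Let $G=(V,E)$ be a hypergraph whose hyperedges (factors) $a$ are ordered $r$-tuples $\partial a=(v_{a,1},\dots,v_{a,r})$ of distinct vertices (variables), which is $d$-index-regular: every variable lies in exactly $d$ factors, and for each $\iota\in[r]$ it is the $\iota$-th entry of exactly $d/r$ factors. Write $\partial i$ for the set of factors containing $i$. Assume the bipartite variable–factor incidence graph (factor graph) of $G$ has no cycle of length less than $4L+4$. For a factor $a$ and $j\in\partial a$, $\mathsf D_{j;a}f$ is the partial derivative of (multilinear) $f$ in the coordinate $\iota$ with $v_{a,\iota}=j$.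 Fix $K>0$ and functions $F_{\to,\ell},F_\ell:\mathbb R^\ell\to[-K,K]$ for $0\le\ell\le L-1$ (constants when $\ell=0$). Randomness: $z_i^0$, $i\in V$, i.i.d. $\mathcal N(0,\delta)$; set $z^0_{i\to a}=z_i^0$, $w_i^0=w^0_{i\to a}=0$. For $\ell=0,\dots,L-1$: $A^\ell_{i\to a}=F_{\to,\ell}(u^1_{i\to a},\dots,u^\ell_{i\to a})$, $A^\ell_i=F_\ell(u^1_i,\dots,u^\ell_i)$; with $\mathbf z^\ell_{\partial b\to b}=(z^\ell_{v_{b,1}\to b},\dots,z^\ell_{v_{b,r}\to b})$, $w^{\ell+1}_{i\to a}=(d-1)^{-1/2}\sum_{b\in\partial i\setminus a}\mathsf D_{i;b}f(\mathbf z^\ell_{\partial b\to b})$, $u^{\ell+1}_{i\to a}=w^{\ell+1}_{i\to a}-w^\ell_{i\to a}$, $z^{\ell+1}_{i\to a}=z_i^0+\sum_{s=1}^{\ell+1}A^{s-1}_{i\to a}u^s_{i\to a}$; $w^{\ell+1}_i=d^{-1/2}\sum_{b\in\partial i}\mathsf D_{i;b}f(\mathbf z^\ell_{\partial b\to b})$, $u^{\ell+1}_i=w^{\ell+1}_i-w^\ell_i$, $z^{\ell+1}_i=z_i^0+\sum_{s=1}^{\ell+1}A^{s-1}_iu^s_i$. Sigma-algebras: the distance between variables $i,j$ is the least $k$ such that there are variables $i=v_0,\dots,v_k=j$ with consecutive ones sharing a factor. $\mathsf B_i(\ell)$ is the set of variables at distance $\le\ell$ from $i$; $\mathcal G_i^\ell=\sigma(z_j^0:j\in\mathsf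 B_i(\ell))$. Asymptotics: $r,f,\delta,L,K$ are fixed and $d\to\infty$ along such hypergraphs (nonlinearities may depend on $d$); $\mathrm{plim}$ is limit in probability. Property (P2): for all $0\le\ell\le L-1$, variables $i$, factors $a\in\partial i$: $\mathbb E[(A^\ell_i)^2]=\mathbb E[(A^\ell_{i\to a})^2]=\delta/\nu_{\ell+1}$. *)

theory Defs
  imports "HOL-Probability.Probability"
begin

definition pm1 :: "nat \<Rightarrow> (nat \<Rightarrow> real) set" where
  "pm1 r = {..<r} \<rightarrow>\<^sub>E {-1, 1}"

definition fourier :: "nat \<Rightarrow> ((nat \<Rightarrow> real) \<Rightarrow> real) \<Rightarrow> nat set \<Rightarrow> real" where
  "fourier r f S = (\<Sum>x\<in>pm1 r. f x * (\<Prod>\<iota>\<in>S. x \<iota>)) / 2 ^ r"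

definition mlext :: "nat \<Rightarrow> ((nat \<Rightarrow> real) \<Rightarrow> real) \<Rightarrow> (nat \<Rightarrow> real) \<Rightarrow> real" where
  "mlext r f y = (\<Sum>S\<in>Pow {..<r}. fourier r f S * (\<Prod>\<iota>\<in>S. y \<iota>))"

definition pderiv_ml :: "nat \<Rightarrow> ((nat \<Rightarrow> real) \<Rightarrow> real) \<Rightarrow> nat \<Rightarrow> (nat \<Rightarrow> real) \<Rightarrow> real" where
  "pderiv_ml r f \<iota> y = deriv (\<lambda>t. mlext r f (y(\<iota> := t))) (y \<iota>)"

definition xi :: "nat \<Rightarrow> ((nat \<Rightarrow> real) \<Rightarrow> real) \<Rightarrow> real \<Rightarrow> real" where
  "xi r f s = (\<Sum>j=1..r. (\<Sum>S\<in>{S\<in>Pow {..<r}. card S = j}. (fourier r f S)^2) * s ^ j)"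

definition nu :: "nat \<Rightarrow> ((nat \<Rightarrow> real) \<Rightarrow> real) \<Rightarrow> real \<Rightarrow> nat \<Rightarrow> real" where
  "nu r f \<delta> l = (deriv (xi r f) (real l * \<delta>) - deriv (xi r f) ((real l - 1) * \<delta>)) / real r"

definition Lof :: "real \<Rightarrow> nat" where
  "Lof \<delta> = nat \<lfloor>1 / \<delta>\<rfloor>"

text \<open>A hypergraph: variable set V, factor set Fs, and vf b iota = v_{b,iota} (iota < r).\<close>

definition fvars :: "('f \<Rightarrow> nat \<Rightarrow> 'v) \<Rightarrow> nat \<Rightarrow> 'f \<Rightarrow> 'v set" where
  "fvars vf r b = vf b ` {..<r}"

definition nbhd :: "'f set \<Rightarrow> ('f \<Rightarrow> nat \<Rightarrow> 'v) \<Rightarrow> nat \<Rightarrow> 'v \<Rightarrow> 'f set" where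
  "nbhd Fs vf r i = {b\<in>Fs. i \<in> fvars vf r b}"

definition idx :: "('f \<Rightarrow> nat \<Rightarrow> 'v) \<Rightarrow> nat \<Rightarrow> 'f \<Rightarrow> 'v \<Rightarrow> nat" where
  "idx vf r b i = (THE \<iota>. \<iota> < r \<and> vf b \<iota> = i)"

definition index_regular :: "'v set \<Rightarrow> 'f set \<Rightarrow> ('f \<Rightarrow> nat \<Rightarrow> 'v) \<Rightarrow> nat \<Rightarrow> nat \<Rightarrow> bool" where
  "index_regular V Fs vf r d \<longleftrightarrow>
     finite V \<and> finite Fs \<and>
     (\<forall>b\<in>Fs. (\<forall>\<iota><r. vf b \<iota> \<in> V) \<and> inj_on (vf b) {..<r}) \<and>
     (\<forall>i\<in>V. card (nbhd Fs vf r i) = d) \<and>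
     (\<forall>i\<in>V. \<forall>\<iota><r. real (card {b\<in>Fs. vf b \<iota> = i}) = real d / real r)"

text \<open>A cycle of length 2k (k >= 2) in the bipartite variable-factor incidence graph.\<close>
definition fg_cycle :: "'f set \<Rightarrow> ('f \<Rightarrow> nat \<Rightarrow> 'v) \<Rightarrow> nat \<Rightarrow> nat \<Rightarrow> bool" where
  "fg_cycle Fs vf r k \<longleftrightarrow> 2 \<le> k \<and> (\<exists>vs as. inj_on vs {..<k} \<and> inj_on as {..<k} \<and>
     (\<forall>j<k. as j \<in> Fs \<and> vs j \<in> fvars vf r (as j) \<and> vs (Suc j mod k) \<in> fvars vf r (as j)))"

definition no_short_cycle :: "'f set \<Rightarrow> ('f \<Rightarrow> nat \<Rightarrow> 'v) \<Rightarrow> nat \<Rightarrow> nat \<Rightarrow> bool" where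
  "no_short_cycle Fs vf r g \<longleftrightarrow> (\<forall>k. 2 * k < g \<longrightarrow> \<not> fg_cycle Fs vf r k)"

definition var_ball :: "'f set \<Rightarrow> ('f \<Rightarrow> nat \<Rightarrow> 'v) \<Rightarrow> nat \<Rightarrow> 'v \<Rightarrow> nat \<Rightarrow> 'v set" where
  "var_ball Fs vf r i l = {j. \<exists>k\<le>l. \<exists>p. p 0 = i \<and> p k = j \<and>
     (\<forall>m<k. \<exists>b\<in>Fs. p m \<in> fvars vf r b \<and> p (Suc m) \<in> fvars vf r b)}"

text \<open>D_{i;b} f evaluated at z_{\<partial>b\<rightarrow>b}, where zl v b is the message from v to b.\<close>
definition Dmsg :: "nat \<Rightarrow> ((nat \<Rightarrow> real) \<Rightarrow> real) \<Rightarrow> ('f \<Rightarrow> nat \<Rightarrow> 'v) \<Rightarrow> 'f \<Rightarrow> 'v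
    \<Rightarrow> ('v \<Rightarrow> 'f \<Rightarrow> real) \<Rightarrow> real" where
  "Dmsg r f vf b i zl = pderiv_ml r f (idx vf r b i) (\<lambda>\<kappa>. zl (vf b \<kappa>) b)"

text \<open>Given a history h s = w^s (message quantities), A^s = Fm s (u^1,...,u^s),
  with u^{k+1} = w^{k+1} - w^k; vectors in R^s are extensional functions on 0..<s.\<close>
definition Amsg :: "(nat \<Rightarrow> (nat \<Rightarrow> real) \<Rightarrow> real) \<Rightarrow> (nat \<Rightarrow> 'v \<Rightarrow> 'f \<Rightarrow> real) \<Rightarrow> nat \<Rightarrow> 'v \<Rightarrow> 'f \<Rightarrow> real" where
  "Amsg Fm h s i a = Fm s (\<lambda>k\<in>{..<s}. h (Suc k) i a - h k i a)"

definition zmsg :: "(nat \<Rightarrow> (nat \<Rightarrow> real) \<Rightarrow> real) \<Rightarrow> ('v \<Rightarrow> real) \<Rightarrow> (nat \<Rightarrow> 'v \<Rightarrow> 'f \<Rightarrow> real)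
    \<Rightarrow> nat \<Rightarrow> 'v \<Rightarrow> 'f \<Rightarrow> real" where
  "zmsg Fm z0 h l i a = z0 i + (\<Sum>s\<in>{1..l}. Amsg Fm h (s - 1) i a * (h s i a - h (s - 1) i a))"

text \<open>whist ... l is the history (w^0, ..., w^l) of message quantities w^s_{i\<rightarrow>a}.\<close>
primrec whist :: "nat \<Rightarrow> ((nat \<Rightarrow> real) \<Rightarrow> real) \<Rightarrow> nat \<Rightarrow> 'f set \<Rightarrow> ('f \<Rightarrow> nat \<Rightarrow> 'v)
    \<Rightarrow> (nat \<Rightarrow> (nat \<Rightarrow> real) \<Rightarrow> real) \<Rightarrow> ('v \<Rightarrow> real) \<Rightarrow> nat \<Rightarrow> nat \<Rightarrow> 'v \<Rightarrow> 'f \<Rightarrow> real" where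
  "whist r f d Fs vf Fm z0 0 = (\<lambda>s i a. 0)"
| "whist r f d Fs vf Fm z0 (Suc l) =
     (let h = whist r f d Fs vf Fm z0 l
      in h(Suc l := (\<lambda>i a. (\<Sum>b\<in>nbhd Fs vf r i - {a}. Dmsg r f vf b i (zmsg Fm z0 h l))
                              / sqrt (real d - 1))))"

definition umsg where
  "umsg r f d Fs vf Fm z0 l i a =
     whist r f d Fs vf Fm z0 l l i a - whist r f d Fs vf Fm z0 l (l - 1) i a"

definition Amsgl where
  "Amsgl r f d Fs vf Fm z0 l i a = Amsg Fm (whist r f d Fs vf Fm z0 l) l i a"

definition wfull where
  "wfull r f d Fs vf Fm z0 l i =
     (if l = 0 then 0
      else (\<Sum>b\<in>nbhd Fs vf r i.
              Dmsg r f vf b i (zmsg Fm z0 (whist r f d Fs vf Fm z0 (l - 1)) (l - 1))) / sqrt (real d))"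

definition ufull where
  "ufull r f d Fs vf Fm z0 l i = wfull r f d Fs vf Fm z0 l i - wfull r f d Fs vf Fm z0 (l - 1) i"

definition Afull where
  "Afull r f d Fs vf Fm Ff z0 l i = Ff l (\<lambda>k\<in>{..<l}. ufull r f d Fs vf Fm z0 (Suc k) i)"

text \<open>The law of (z^0_j)_{j \<in> V}: i.i.d. N(0, delta) (delta is the variance).\<close>
definition gspace :: "'v set \<Rightarrow> real \<Rightarrow> ('v \<Rightarrow> real) measure" where
  "gspace V \<delta> = PiM V (\<lambda>_. density lborel (normal_density 0 (sqrt \<delta>)))"

definition gauss_var :: "real \<Rightarrow> real measure" where
  "gauss_var v = (if v = 0 then return borel 0 else density lborel (normal_density 0 (sqrt v)))"

definition gen_sigma :: "'a measure \<Rightarrow> ('j \<Rightarrow> 'a \<Rightarrow> real) \<Rightarrow> 'j set \<Rightarrow> 'a measure" where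
  "gen_sigma M X J = sigma (space M) {X j -` A \<inter> space M | j A. j \<in> J \<and> A \<in> sets borel}"

end

(* Proof idea. Given the z_j^0 outside the leaves at depth l of the non-backtracking tree rooted at
   i, the increment u^l is a normalised sum of d - 1 independent centred terms, one per factor:
   by the girth assumption the branches involve disjoint sets of variables, and since f has no
   degree-one coefficient each z^l is a martingale in l with respect to the depth. The conditional
   variance is an average of independent branch contributions and concentrates at nu_l, by
   induction on l; property (P2) makes the second moments of z^l grow linearly in l. Hence the
   conditional characteristic function of u^l converges in L^1 to that of N(0, nu_l). The coupling
   is the conditional quantile transform of u^l, and uniform moment bounds upgrade convergence in
   probability of u^l - U to convergence of all moments; Markov's inequality then gives the
   statement for the conditional expectation. *)

theory Submission
  imports Defs
begin

subsection \<open>Non-backtracking walks\<close>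

text \<open>The conditional law of the increment varies with the configuration outside the leaves,
  so a continuity theorem for sequences does not apply to it directly. All deviations of its
  characteristic function are therefore collected in one scalar \<open>Qerr\<close> times a fixed
  polynomial in t: a uniform transport estimate serves the configurations with small
  \<open>Qerr\<close>, and Markov's inequality disposes of the rest. Conditioning is resampling of
  coordinates of the product measure, which gives versions defined at every point. U is made
  independent of everything outside the leaves, and the ball of radius l - 1 misses the leaves. The
  quantile transform needs an atomless law, which is not guaranteed for the increment (a
  nonlinearity may vanish on part of its domain), so an independent Gaussian of vanishing size is
  added first; it is the only extension of the probability space. Vertices are not exchangeable,
  hence every moment estimate is uniform over vertices, factors and members of the sequence with d
  at least 2. If all Fourier coefficients of non-empty sets vanish, then \<nu> = 0 and both
  variables are zero; this case is split off.\<close>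

definition nbw :: "'f set \<Rightarrow> ('f \<Rightarrow> nat \<Rightarrow> 'v) \<Rightarrow> nat \<Rightarrow> nat \<Rightarrow> (nat \<Rightarrow> 'v) \<Rightarrow> (nat \<Rightarrow> 'f) \<Rightarrow> bool" where
  "nbw Fs vf r m vs cs \<longleftrightarrow>
     (\<forall>t<m. cs t \<in> Fs \<and> vs t \<in> fvars vf r (cs t) \<and> vs (Suc t) \<in> fvars vf r (cs t) \<and> vs t \<noteq> vs (Suc t)) \<and>
     (\<forall>t. Suc t < m \<longrightarrow> cs t \<noteq> cs (Suc t))"

lemma nbw_segment:
  assumes "nbw Fs vf r m vs cs" "p + k \<le> m"
  shows "nbw Fs vf r k (\<lambda>t. vs (p + t)) (\<lambda>t. cs (p + t))"
  using assms unfolding nbw_def by auto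

text \<open>A shortest closed non-backtracking walk is a cycle: a repeated variable would cut out a
  shorter closed walk, and so would a repeated factor. The result is an \<open>fg_cycle\<close> of
  length 2k, which the girth forbids.\<close>

lemma no_closed_nbw:
  assumes girth: "no_short_cycle Fs vf r g"
  shows "nbw Fs vf r k vs cs \<Longrightarrow> 1 \<le> k \<Longrightarrow> 2 * k < g \<Longrightarrow> vs 0 \<noteq> vs k"
proof (induction k arbitrary: vs cs rule: less_induct)
  case (less k)
  show ?case
  proof
    assume closed: "vs 0 = vs k"
    have k2: "2 \<le> k"
    proof (rule ccontr)
      assume "\<not> 2 \<le> k"
      then have "k = 1" using less.prems by simp
      then show False using less.prems closed by (auto simp: nbw_def)
    qed
    have injv: "inj_on vs {..<k}"
    proof (rule linorder_inj_onI)
      fix p q assume pq: "p < q" "p \<in> {..<k}" "q \<in> {..<k}"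
      show "vs p \<noteq> vs q"
        using less.IH[of "q - p" "\<lambda>t. vs (p + t)" "\<lambda>t. cs (p + t)"]
          nbw_segment[OF less.prems(1), of p "q - p"] pq less.prems by auto
    qed auto
    have injc: "inj_on cs {..<k}"
    proof (rule linorder_inj_onI)
      fix p q assume pq: "p < q" "p \<in> {..<k}" "q \<in> {..<k}"
      show "cs p \<noteq> cs q"
      proof
        assume eq: "cs p = cs q"
        have q1: "q \<noteq> Suc p" using eq less.prems(1) pq by (auto simp: nbw_def)
        \<comment> \<open>If the factors at times p and q coincide, the walk from
          \<open>vs (Suc p)\<close> to \<open>vs q\<close> takes one more step through that common
          factor, back to \<open>vs (Suc p)\<close>.\<close>
        define vs' where "vs' = (\<lambda>t. if t = q - p then vs (Suc p) else vs (Suc p + t))"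
        have ne: "vs q \<noteq> vs (Suc p)" using injv pq q1 by (auto dest!: inj_onD)
        have "nbw Fs vf r (q - p) vs' (\<lambda>t. cs (Suc p + t))"
          unfolding nbw_def
        proof (intro conjI allI impI)
          fix t assume t: "t < q - p"
          have t': "Suc p + t < k" using t pq by auto
          note base = less.prems(1)[unfolded nbw_def, THEN conjunct1, rule_format, OF t']
          show "cs (Suc p + t) \<in> Fs" using base by simp
          show "vs' t \<in> fvars vf r (cs (Suc p + t))" using base t by (simp add: vs'_def)
          have p': "p < k" using pq by simp
          have q: "Suc t = q - p \<Longrightarrow> Suc (p + t) = q" using pq by auto
          show "vs' (Suc t) \<in> fvars vf r (cs (Suc p + t))"
            using base t q eq less.prems(1)[unfolded nbw_def, THEN conjunct1, rule_format, OF p'] pq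
            by (auto simp: vs'_def)
          show "vs' t \<noteq> vs' (Suc t)"
            using base t q ne by (auto simp: vs'_def)
        next
          fix t assume "Suc t < q - p"
          then show "cs (Suc p + t) \<noteq> cs (Suc p + Suc t)"
            using less.prems(1) pq by (auto simp: nbw_def)
        qed
        then have "vs' 0 \<noteq> vs' (q - p)" using less.IH[of "q - p"] pq less.prems by auto
        then show False using pq by (simp add: vs'_def)
      qed
    qed auto
    have "fg_cycle Fs vf r k"
      unfolding fg_cycle_def
    proof (intro conjI exI[of _ vs] exI[of _ cs] k2 injv injc allI impI)
      fix j assume j: "j < k"
      note base = less.prems(1)[unfolded nbw_def, THEN conjunct1, rule_format, OF j]
      show "cs j \<in> Fs" "vs j \<in> fvars vf r (cs j)" using base by auto
      show "vs (Suc j mod k) \<in> fvars vf r (cs j)"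
        using base closed j by (cases "Suc j = k") auto
    qed
    then show False using girth less.prems by (auto simp: no_short_cycle_def)
  qed
qed

text \<open>Traverses the first walk forwards and the second one backwards. Only the junction can
  backtrack, so a single inequality of factors has to be assumed there.\<close>

lemma nbw_join:
  assumes w: "nbw Fs vf r m vs cs" and w': "nbw Fs vf r m' vs' cs'"
    and e: "vs m = vs' m'" and c: "m > 0 \<Longrightarrow> m' > 0 \<Longrightarrow> cs (m - 1) \<noteq> cs' (m' - 1)"
  shows "nbw Fs vf r (m + m') (\<lambda>t. if t \<le> m then vs t else vs' (m + m' - t))
           (\<lambda>t. if t < m then cs t else cs' (m + m' - Suc t))"
  unfolding nbw_def
proof (intro conjI allI impI)
  fix t assume t: "t < m + m'"
  let ?v = "\<lambda>t. if t \<le> m then vs t else vs' (m + m' - t)"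
  let ?c = "\<lambda>t. if t < m then cs t else cs' (m + m' - Suc t)"
  have *: "?c t \<in> Fs \<and> ?v t \<in> fvars vf r (?c t) \<and> ?v (Suc t) \<in> fvars vf r (?c t) \<and> ?v t \<noteq> ?v (Suc t)"
  proof (cases "t < m")
    case True
    then show ?thesis using w by (auto simp: nbw_def)
  next
    case False
    define s where "s = m + m' - Suc t"
    have s: "s < m'" "m + m' - t = Suc s" using t False by (auto simp: s_def)
    have v1: "?v t = vs' (Suc s)" using False s e by (cases "t = m") auto
    have v2: "?v (Suc t) = vs' s" using False by (simp add: s_def)
    have c1: "?c t = cs' s" using False by (simp add: s_def)
    have "cs' s \<in> Fs \<and> vs' (Suc s) \<in> fvars vf r (cs' s) \<and> vs' s \<in> fvars vf r (cs' s) \<and> vs' (Suc s) \<noteq> vs' s"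
      using w' s(1) unfolding nbw_def by metis
    then show ?thesis unfolding v1 v2 c1 .
  qed
  show "?c t \<in> Fs" "?v t \<in> fvars vf r (?c t)" "?v (Suc t) \<in> fvars vf r (?c t)" "?v t \<noteq> ?v (Suc t)"
    using * by blast+
next
  fix t assume t: "Suc t < m + m'"
  let ?c = "\<lambda>t. if t < m then cs t else cs' (m + m' - Suc t)"
  consider "Suc t < m" | "Suc t = m" | "m \<le> t" by linarith
  then show "?c t \<noteq> ?c (Suc t)"
  proof cases
    case 1 then show ?thesis using w by (auto simp: nbw_def)
  next
    case 2
    then have m': "m' > 0" using t by simp
    have "?c t = cs (m - 1)" using 2 by auto
    moreover have "?c (Suc t) = cs' (m' - 1)" using 2 m' by auto
    ultimately show ?thesis using c 2 m' by auto
  next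
    case 3
    define s where "s = m + m' - Suc (Suc t)"
    have s: "Suc s < m'" "m + m' - Suc t = Suc s" using t 3 by (auto simp: s_def)
    have "?c t = cs' (Suc s)" "?c (Suc t) = cs' s" using 3 s by (auto simp: s_def)
    then show ?thesis using w' s(1) unfolding nbw_def by metis
  qed
qed

text \<open>The walks are compared from the end: different last factors, or equal last factors
  preceded by different variables, would let the two walks be joined into a closed non-backtracking
  walk no longer than both together.\<close>

lemma nbw_unique:
  assumes girth: "no_short_cycle Fs vf r g"
  shows "nbw Fs vf r m vs cs \<Longrightarrow> nbw Fs vf r m' vs' cs' \<Longrightarrow> vs 0 = vs' 0 \<Longrightarrow> vs m = vs' m' \<Longrightarrow>
     2 * (m + m') < g \<Longrightarrow> m = m' \<and> (\<forall>t\<le>m. vs t = vs' t) \<and> (\<forall>t<m. cs t = cs' t)"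
proof (induction m arbitrary: m' vs')
  case 0
  show ?case
  proof (cases m')
    case (Suc n)
    then show ?thesis using no_closed_nbw[OF girth 0(2)] 0 by auto
  qed (use 0 in auto)
next
  case (Suc m)
  show ?case
  proof (cases m')
    case 0
    then show ?thesis using no_closed_nbw[OF girth Suc.prems(1)] Suc.prems by auto
  next
    case (Suc n)
    have w: "nbw Fs vf r m vs cs" using nbw_segment[OF Suc.prems(1), of 0 m] by simp
    have w': "nbw Fs vf r n vs' cs'" using nbw_segment[OF Suc.prems(2), of 0 n] \<open>m' = Suc n\<close> by simp
    have ceq: "cs m = cs' n"
    proof (rule ccontr)
      assume ne: "cs m \<noteq> cs' n"
      show False
        using no_closed_nbw[OF girth nbw_join[OF Suc.prems(1,2,4)]] ne \<open>m' = Suc n\<close> Suc.prems by auto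
    qed
    have veq: "vs m = vs' n"
    proof (rule ccontr)
      assume ne: "vs m \<noteq> vs' n"
      \<comment> \<open>Both penultimate variables lie in the common last factor, so the first walk
        can be made to end at \<open>vs' n\<close>; the second walk without its last step then
        closes it up.\<close>
      define vs2 where "vs2 = vs(Suc m := vs' n)"
      have w2: "nbw Fs vf r (Suc m) vs2 cs"
        unfolding nbw_def
      proof (intro conjI allI impI)
        fix t assume t: "t < Suc m"
        have b: "cs t \<in> Fs" "vs t \<in> fvars vf r (cs t)" "vs (Suc t) \<in> fvars vf r (cs t)" "vs t \<noteq> vs (Suc t)"
          using Suc.prems(1) t by (auto simp: nbw_def)
        have n: "vs' n \<in> fvars vf r (cs' n)" using Suc.prems(2) \<open>m' = Suc n\<close> by (auto simp: nbw_def)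
        show "cs t \<in> Fs" by (rule b)
        show "vs2 t \<in> fvars vf r (cs t)" using b t by (simp add: vs2_def)
        show "vs2 (Suc t) \<in> fvars vf r (cs t)" using b n ceq t by (auto simp: vs2_def)
        show "vs2 t \<noteq> vs2 (Suc t)" using b ne t by (auto simp: vs2_def)
      qed (use Suc.prems(1) in \<open>auto simp: nbw_def\<close>)
      have "n > 0 \<Longrightarrow> cs m \<noteq> cs' (n - 1)"
        using Suc.prems(2) ceq \<open>m' = Suc n\<close> unfolding nbw_def
        by (metis Suc_pred' lessI)
      then have j: "nbw Fs vf r (Suc m + n) (\<lambda>t. if t \<le> Suc m then vs2 t else vs' (Suc m + n - t))
           (\<lambda>t. if t < Suc m then cs t else cs' (Suc m + n - Suc t))"
        by (intro nbw_join[OF w2 w']) (auto simp: vs2_def)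
      show False
        using no_closed_nbw[OF girth j] Suc.prems \<open>m' = Suc n\<close> by (auto simp: vs2_def split: if_splits)
    qed
    have "m = n \<and> (\<forall>t\<le>m. vs t = vs' t) \<and> (\<forall>t<m. cs t = cs' t)"
      using Suc.IH[OF w w' Suc.prems(3) veq] Suc.prems \<open>m' = Suc n\<close> by auto
    then show ?thesis using ceq Suc.prems \<open>m' = Suc n\<close> by (auto simp: less_Suc_eq le_Suc_eq)
  qed
qed

text \<open>A path is reduced step by step: if the next step uses the same factor as the last one,
  the last step is dropped and replaced by a direct step through that factor, or by none if the
  target is already reached.\<close>

lemma var_ball_nbw:
  assumes "j \<in> var_ball Fs vf r i l"
  shows "\<exists>k\<le>l. \<exists>vs cs. nbw Fs vf r k vs cs \<and> vs 0 = i \<and> vs k = j"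
proof -
  obtain k p where k: "k \<le> l" and p: "p 0 = i" "p k = j"
    and st: "\<And>m. m < k \<Longrightarrow> \<exists>b\<in>Fs. p m \<in> fvars vf r b \<and> p (Suc m) \<in> fvars vf r b"
    using assms by (auto simp: var_ball_def)
  have "n \<le> k \<Longrightarrow> \<exists>k'\<le>n. \<exists>vs cs. nbw Fs vf r k' vs cs \<and> vs 0 = i \<and> vs k' = p n" for n
  proof (induction n)
    case 0
    show ?case by (rule exI[of _ 0]) (auto simp: nbw_def p intro!: exI[of _ "\<lambda>_. i"])
  next
    case (Suc n)
    then obtain k' vs cs where w: "k' \<le> n" "nbw Fs vf r k' vs cs" "vs 0 = i" "vs k' = p n" by auto
    obtain b where b: "b \<in> Fs" "p n \<in> fvars vf r b" "p (Suc n) \<in> fvars vf r b"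
      using st[of n] Suc by auto
    have ext: "\<exists>k''\<le>Suc m. \<exists>vs cs. nbw Fs vf r k'' vs cs \<and> vs 0 = i \<and> vs k'' = p (Suc n)"
      if m: "nbw Fs vf r m vs cs" "vs m \<in> fvars vf r b" "m > 0 \<Longrightarrow> cs (m - 1) \<noteq> b" for m
    proof (cases "vs m = p (Suc n)")
      case True
      then show ?thesis using m w by (intro exI[of _ m]) auto
    next
      case False
      have m3: "Suc t = m \<Longrightarrow> cs t \<noteq> b" for t using m(3) by auto
      have "nbw Fs vf r (Suc m) (vs(Suc m := p (Suc n))) (cs(m := b))"
        using m b False m3 by (auto simp: nbw_def less_Suc_eq)
      then show ?thesis using w by (intro exI[of _ "Suc m"]) (auto intro!: exI)
    qed
    show ?case
    proof (cases "k' > 0 \<and> cs (k' - 1) = b")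
      case True
      then have m: "nbw Fs vf r (k' - 1) vs cs"
        using nbw_segment[OF w(2), of 0 "k' - 1"] by simp
      have "vs (k' - 1) \<in> fvars vf r b" using w(2) True by (auto simp: nbw_def)
      moreover have "k' - 1 > 0 \<Longrightarrow> cs (k' - 1 - 1) \<noteq> b"
        using w(2) True unfolding nbw_def by (metis Suc_pred' lessI diff_less zero_less_one)
      ultimately obtain k'' vs' cs' where "k'' \<le> Suc (k' - 1)"
        "nbw Fs vf r k'' vs' cs' \<and> vs' 0 = i \<and> vs' k'' = p (Suc n)" using ext[OF m] by auto
      then show ?thesis using w(1) True by (intro exI[of _ k'']) auto
    next
      case False
      then obtain k'' vs' cs' where "k'' \<le> Suc k'"
        "nbw Fs vf r k'' vs' cs' \<and> vs' 0 = i \<and> vs' k'' = p (Suc n)" using ext[OF w(2)] b w by auto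
      then show ?thesis using w(1) by (intro exI[of _ k'']) auto
    qed
  qed
  from this[of k] show ?thesis using k p by (meson le_refl order_trans)
qed

text \<open>\<open>leaf m i b\<close> is the set of variables reached from \<open>i\<close> by a non-backtracking walk of
  length \<open>m\<close> whose first factor is not \<open>b\<close>.\<close>

primrec leaf :: "'f set \<Rightarrow> ('f \<Rightarrow> nat \<Rightarrow> 'v) \<Rightarrow> nat \<Rightarrow> nat \<Rightarrow> 'v \<Rightarrow> 'f \<Rightarrow> 'v set" where
  "leaf Fs vf r 0 i b = {i}"
| "leaf Fs vf r (Suc m) i b = (\<Union>c\<in>nbhd Fs vf r i - {b}. \<Union>j\<in>fvars vf r c - {i}. leaf Fs vf r m j c)"

text \<open>Contains all variables on which the message from \<open>i\<close> to \<open>b\<close> at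
  level m can depend (\<open>dep_w\<close>).\<close>

definition cone :: "'f set \<Rightarrow> ('f \<Rightarrow> nat \<Rightarrow> 'v) \<Rightarrow> nat \<Rightarrow> nat \<Rightarrow> 'v \<Rightarrow> 'f \<Rightarrow> 'v set" where
  "cone Fs vf r m i b = (\<Union>k\<le>m. leaf Fs vf r k i b)"

section \<open>Leaves and cones as ends of non-backtracking walks\<close>

lemma nbw_Cons:
  assumes w: "nbw Fs vf r m vs cs" and c: "c \<in> nbhd Fs vf r i" "vs 0 \<in> fvars vf r c" "vs 0 \<noteq> i"
    and h: "m > 0 \<Longrightarrow> cs 0 \<noteq> c"
  shows "nbw Fs vf r (Suc m) (case_nat i vs) (case_nat c cs)"
  using assms unfolding nbw_def nbhd_def by (auto split: nat.splits)

lemma leaf_nbw: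
  "x \<in> leaf Fs vf r m i b \<Longrightarrow>
     \<exists>vs cs. nbw Fs vf r m vs cs \<and> vs 0 = i \<and> vs m = x \<and> (m > 0 \<longrightarrow> cs 0 \<noteq> b)"
proof (induction m arbitrary: i b)
  case 0
  then show ?case by (auto simp: nbw_def intro!: exI[of _ "\<lambda>_. i"])
next
  case (Suc m)
  then obtain c j where c: "c \<in> nbhd Fs vf r i" "c \<noteq> b" "j \<in> fvars vf r c" "j \<noteq> i" "x \<in> leaf Fs vf r m j c"
    by auto
  from Suc.IH[OF c(5)] obtain vs cs where w: "nbw Fs vf r m vs cs" "vs 0 = j" "vs m = x" "m > 0 \<longrightarrow> cs 0 \<noteq> c"
    by auto
  have "nbw Fs vf r (Suc m) (case_nat i vs) (case_nat c cs)"
    using w c by (intro nbw_Cons) auto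
  then show ?case using w c by (intro exI[of _ "case_nat i vs"] exI[of _ "case_nat c cs"]) auto
qed

lemma branch_nbw:
  assumes "c \<in> nbhd Fs vf r i" "j \<in> fvars vf r c" "j \<noteq> i" "x \<in> leaf Fs vf r m j c"
  shows "\<exists>vs cs. nbw Fs vf r (Suc m) vs cs \<and> vs 0 = i \<and> vs (Suc m) = x \<and> cs 0 = c \<and> vs 1 = j"
proof -
  from leaf_nbw[OF assms(4)] obtain vs cs where
    w: "nbw Fs vf r m vs cs" "vs 0 = j" "vs m = x" "m > 0 \<longrightarrow> cs 0 \<noteq> c" by auto
  have "nbw Fs vf r (Suc m) (case_nat i vs) (case_nat c cs)"
    using w assms by (intro nbw_Cons) auto
  then show ?thesis using w by (intro exI[of _ "case_nat i vs"] exI[of _ "case_nat c cs"]) auto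
qed

text \<open>Prefixing each branch walk by its first step gives two walks from \<open>i\<close> to
  \<open>x\<close>; their uniqueness forces equal length, equal first factor and equal first
  variable.\<close>

lemma leaf_branch_unique:
  assumes g: "no_short_cycle Fs vf r g" "2 * (Suc m + Suc m') < g"
    and 1: "c \<in> nbhd Fs vf r i" "j \<in> fvars vf r c" "j \<noteq> i" "x \<in> leaf Fs vf r m j c"
    and 2: "c' \<in> nbhd Fs vf r i" "j' \<in> fvars vf r c'" "j' \<noteq> i" "x \<in> leaf Fs vf r m' j' c'"
  shows "m = m' \<and> c = c' \<and> j = j'"
proof -
  from branch_nbw[OF 1] obtain vs cs where w:
    "nbw Fs vf r (Suc m) vs cs" "vs 0 = i" "vs (Suc m) = x" "cs 0 = c" "vs 1 = j" by auto
  from branch_nbw[OF 2] obtain vs' cs' where w':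
    "nbw Fs vf r (Suc m') vs' cs'" "vs' 0 = i" "vs' (Suc m') = x" "cs' 0 = c'" "vs' 1 = j'" by auto
  have "Suc m = Suc m' \<and> (\<forall>t\<le>Suc m. vs t = vs' t) \<and> (\<forall>t<Suc m. cs t = cs' t)"
    using nbw_unique[OF g(1) w(1) w'(1)] w w' g(2) by simp
  then have "m = m'" "vs 1 = vs' 1" "cs 0 = cs' 0" by auto
  then show ?thesis using w w' by auto
qed

text \<open>The source of all independence, across factors and across the slots of one factor. Two
  walks of length at most m + 1 would meet, whence the girth bound \<open>4 * Suc m\<close>.\<close>

lemma cone_branch_disjoint:
  assumes g: "no_short_cycle Fs vf r g" "4 * Suc m < g"
    and 1: "c \<in> nbhd Fs vf r i" "j \<in> fvars vf r c" "j \<noteq> i"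
    and 2: "c' \<in> nbhd Fs vf r i" "j' \<in> fvars vf r c'" "j' \<noteq> i" and ne: "(c, j) \<noteq> (c', j')"
  shows "cone Fs vf r m j c \<inter> cone Fs vf r m j' c' = {}"
proof (rule ccontr)
  assume "\<not> ?thesis"
  then obtain x p q where x: "p \<le> m" "q \<le> m" "x \<in> leaf Fs vf r p j c" "x \<in> leaf Fs vf r q j' c'"
    by (auto simp: cone_def)
  show False using leaf_branch_unique[OF g(1) _ 1 x(3) 2 x(4)] x g ne by auto
qed

lemma leaf_disjoint:
  assumes g: "no_short_cycle Fs vf r g" "2 * (m + m') < g" and "m \<noteq> m'"
  shows "leaf Fs vf r m i b \<inter> leaf Fs vf r m' i b = {}"
proof (rule ccontr)
  assume "\<not> ?thesis"
  then obtain x where x: "x \<in> leaf Fs vf r m i b" "x \<in> leaf Fs vf r m' i b" by auto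
  obtain vs cs where w: "nbw Fs vf r m vs cs" "vs 0 = i" "vs m = x" using leaf_nbw[OF x(1)] by auto
  obtain vs' cs' where w': "nbw Fs vf r m' vs' cs'" "vs' 0 = i" "vs' m' = x" using leaf_nbw[OF x(2)] by auto
  show False using nbw_unique[OF g(1) w(1) w'(1)] w w' g(2) assms(3) by simp
qed

text \<open>This hides the resampled leaves from the sigma-algebra of the ball: a leaf is the end of
  a walk of length l, a member of the ball the end of one of length at most l - 1, and two such
  walks cannot share both ends.\<close>

lemma leaf_var_ball_disjoint:
  assumes g: "no_short_cycle Fs vf r g" "4 * l < g" and "1 \<le> l"
  shows "leaf Fs vf r l i b \<inter> var_ball Fs vf r i (l - 1) = {}"
proof (rule ccontr)
  assume "\<not> ?thesis"
  then obtain x where x: "x \<in> leaf Fs vf r l i b" "x \<in> var_ball Fs vf r i (l - 1)" by auto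
  obtain vs cs where w: "nbw Fs vf r l vs cs" "vs 0 = i" "vs l = x" using leaf_nbw[OF x(1)] by auto
  obtain k vs' cs' where w': "k \<le> l - 1" "nbw Fs vf r k vs' cs'" "vs' 0 = i" "vs' k = x"
    using var_ball_nbw[OF x(2)] by blast
  have "2 * (l + k) < g" "l \<noteq> k" using w'(1) g(2) assms(3) by auto
  then show False using nbw_unique[OF g(1) w(1) w'(2)] w w' by simp
qed

text \<open>Resampling the depth m + 1 leaves of \<open>i\<close> thus acts on one branch as
  resampling of the depth m leaves of that branch, which is what an induction over levels
  needs.\<close>

lemma leaf_cone_branch:
  assumes g: "no_short_cycle Fs vf r g" "4 * Suc m < g"
    and c: "c \<in> nbhd Fs vf r i" "c \<noteq> b" "j \<in> fvars vf r c" "j \<noteq> i"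
  shows "leaf Fs vf r (Suc m) i b \<inter> cone Fs vf r m j c = leaf Fs vf r m j c"
proof
  show "leaf Fs vf r m j c \<subseteq> leaf Fs vf r (Suc m) i b \<inter> cone Fs vf r m j c"
    using c by (auto simp: cone_def)
  show "leaf Fs vf r (Suc m) i b \<inter> cone Fs vf r m j c \<subseteq> leaf Fs vf r m j c"
  proof
    fix x assume "x \<in> leaf Fs vf r (Suc m) i b \<inter> cone Fs vf r m j c"
    then obtain c' j' p where x: "c' \<in> nbhd Fs vf r i" "j' \<in> fvars vf r c'" "j' \<noteq> i"
      "x \<in> leaf Fs vf r m j' c'" "p \<le> m" "x \<in> leaf Fs vf r p j c" by (auto simp: cone_def)
    have "m = p" using leaf_branch_unique[OF g(1) _ x(1-4) c(1,3,4) x(6)] x(5) g(2) by simp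
    then show "x \<in> leaf Fs vf r m j c" using x by simp
  qed
qed

lemma leaf_Suc_cone_disjoint:
  assumes g: "no_short_cycle Fs vf r g" "4 * Suc m < g"
  shows "leaf Fs vf r (Suc m) i b \<inter> cone Fs vf r m i b = {}"
proof -
  have "leaf Fs vf r (Suc m) i b \<inter> leaf Fs vf r k i b = {}" if "k \<le> m" for k
    using leaf_disjoint[OF g(1), of "Suc m" k i b] g(2) that by simp
  then show ?thesis unfolding cone_def by blast
qed

lemma leaf_subset_cone: "leaf Fs vf r m i b \<subseteq> cone Fs vf r m i b"
  by (auto simp: cone_def)

lemma cone_mono: "m \<le> m' \<Longrightarrow> cone Fs vf r m i b \<subseteq> cone Fs vf r m' i b"
  by (force simp: cone_def)

lemma cone_branch_subset:
  assumes "c \<in> nbhd Fs vf r i" "c \<noteq> b" "j \<in> fvars vf r c" "j \<noteq> i"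
  shows "cone Fs vf r m j c \<subseteq> cone Fs vf r (Suc m) i b"
proof
  fix x assume "x \<in> cone Fs vf r m j c"
  then obtain k where "k \<le> m" "x \<in> leaf Fs vf r k j c" by (auto simp: cone_def)
  then have "Suc k \<le> Suc m" "x \<in> leaf Fs vf r (Suc k) i b" using assms by auto
  then show "x \<in> cone Fs vf r (Suc m) i b" unfolding cone_def by blast
qed

lemma leaf_subset_V:
  assumes "\<forall>b\<in>Fs. \<forall>\<iota><r. vf b \<iota> \<in> V"
  shows "i \<in> V \<Longrightarrow> leaf Fs vf r m i b \<subseteq> V"
proof (induction m arbitrary: i b)
  case (Suc m)
  have "leaf Fs vf r m j c \<subseteq> V" if "c \<in> nbhd Fs vf r i" "j \<in> fvars vf r c" for c j
    using that assms by (intro Suc.IH) (auto simp: nbhd_def fvars_def)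
  then show ?case by auto
qed auto

lemma var_ball_subset_V:
  assumes "\<forall>b\<in>Fs. \<forall>\<iota><r. vf b \<iota> \<in> V" "i \<in> V"
  shows "var_ball Fs vf r i l \<subseteq> V"
proof
  fix j assume "j \<in> var_ball Fs vf r i l"
  then obtain k p where p: "p 0 = i" "p k = j"
    "\<forall>m<k. \<exists>b\<in>Fs. p m \<in> fvars vf r b \<and> p (Suc m) \<in> fvars vf r b" by (auto simp: var_ball_def)
  show "j \<in> V"
  proof (cases k)
    case (Suc n)
    then obtain b where "b \<in> Fs" "p (Suc n) \<in> fvars vf r b" using p by blast
    then show ?thesis using assms p Suc by (auto simp: fvars_def)
  qed (use p assms in auto)
qed

subsection \<open>Quantile transforms\<close>

definition gv :: "real \<Rightarrow> real measure" where
  "gv \<nu> = density lborel (normal_density 0 (sqrt \<nu>))"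

text \<open>The generalised inverse of the Gaussian distribution function; the value 0 outside the
  open unit interval makes it a total Borel function.\<close>

definition quant :: "real \<Rightarrow> real \<Rightarrow> real" where
  "quant \<nu> \<omega> = (if 0 < \<omega> \<and> \<omega> < 1 then Inf {x. \<omega> \<le> cdf (gv \<nu>) x} else 0)"

abbreviation unif :: "real measure" where "unif \<equiv> restrict_space lborel {0<..<1::real}"

lemma real_distribution_gv: "0 < \<nu> \<Longrightarrow> real_distribution (gv \<nu>)"
  using prob_space_normal_density[of "sqrt \<nu>" 0]
  by (auto simp: real_distribution_def real_distribution_axioms_def gv_def)

lemma cdf_distribution_gv: "0 < \<nu> \<Longrightarrow> cdf_distribution (gv \<nu>)"
  by (simp add: cdf_distribution_def real_distribution_gv)

lemma prob_unif: "prob_space unif"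
  by (auto simp add: emeasure_restrict_space space_restrict_space intro!: prob_spaceI)

lemma measurable_quant: assumes "0 < \<nu>" shows "quant \<nu> \<in> borel_measurable borel"
proof -
  interpret cdf_distribution "gv \<nu>" using assms by (rule cdf_distribution_gv)
  have "(\<lambda>\<omega>. if \<omega> \<in> {0<..<1} then I \<omega> else 0) \<in> borel_measurable borel"
  proof (subst measurable_If_restrict_space_iff)
    have s: "{x. x \<in> {0<..<1::real}} = {0<..<1}" by auto
    show "(I \<in> borel_measurable (restrict_space borel {x. x \<in> {0<..<1}})) \<and>
        ((\<lambda>\<omega>. 0) \<in> borel_measurable (restrict_space borel {x. x \<notin> {0<..<1::real}}))"
      unfolding s using measurable_CI by simp
  qed simp
  then show ?thesis unfolding quant_def[abs_def] by simp
qed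

lemma measurable_unif:
  assumes "g \<in> borel_measurable (restrict_space borel {0<..<1::real})"
  shows "g \<in> borel_measurable unif"
proof -
  have "sets unif = sets (restrict_space borel {0<..<1})" by (rule sets_restrict_space_cong) simp
  from measurable_cong_sets[OF this refl] show ?thesis using assms by blast
qed

text \<open>Without atoms the distribution function is continuous and cannot jump over \<omega>: an
  excess at the quantile would persist slightly to its left, against minimality.\<close>

lemma cdf_quantile:
  assumes M: "cdf_distribution M" and c: "\<And>x. measure M {x} = 0" and w: "0 < \<omega>" "\<omega> < 1"
  shows "cdf M (Inf {x. \<omega> \<le> cdf M x}) = \<omega>"
proof -
  interpret cdf_distribution M by (rule M)
  let ?i = "I \<omega>"
  have ge: "\<omega> \<le> cdf M ?i" using pseudoinverse[OF w, of ?i] by simp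
  moreover have "cdf M ?i \<le> \<omega>"
  proof (rule ccontr)
    assume "\<not> cdf M ?i \<le> \<omega>"
    then have "\<omega> < cdf M ?i" by simp
    moreover have "isCont (cdf M) ?i" using c by (simp add: isCont_cdf)
    then have "((\<lambda>x. cdf M x) \<longlongrightarrow> cdf M ?i) (at_left ?i)"
      by (simp add: isCont_def filterlim_at_split)
    ultimately have "\<forall>\<^sub>F x in at_left ?i. \<omega> < cdf M x" by (rule order_tendstoD(1)[rotated])
    then have "\<forall>\<^sub>F x in at_left ?i. \<omega> < cdf M x \<and> x < ?i"
      by (simp add: eventually_conj eventually_at_filter)
    then obtain x where "\<omega> < cdf M x" "x < ?i"
      using eventually_happens'[OF trivial_limit_at_left_real] by blast
    then show False using pseudoinverse[OF w, of x] by simp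
  qed
  ultimately show ?thesis by simp
qed

text \<open>\<open>M\<close> is realised as its quantile function of a uniform variable; its
  distribution function undoes this and leaves the Gaussian quantile of the same uniform
  variable.\<close>

lemma quant_transform:
  assumes \<nu>: "0 < \<nu>" and M: "real_distribution M" and c: "\<And>x. measure M {x} = 0"
  shows "distr M borel (\<lambda>t. quant \<nu> (cdf M t)) = gv \<nu>"
proof -
  interpret M: cdf_distribution M using M by (simp add: cdf_distribution_def)
  interpret G: cdf_distribution "gv \<nu>" using \<nu> by (rule cdf_distribution_gv)
  note [measurable] = measurable_quant[OF \<nu>]
  have mI: "M.I \<in> measurable unif borel" by (rule measurable_unif[OF M.measurable_CI])
  have "distr M borel (\<lambda>t. quant \<nu> (cdf M t)) = distr (distr unif borel M.I) borel (\<lambda>t. quant \<nu> (cdf M t))"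
    by (simp add: M.distr_I_eq_M)
  also have "\<dots> = distr unif borel ((\<lambda>t. quant \<nu> (cdf M t)) \<circ> M.I)"
    by (rule distr_distr[OF _ mI]) measurable
  also have "\<dots> = distr unif borel G.I"
  proof (rule distr_cong[OF refl refl])
    fix \<omega> assume "\<omega> \<in> space unif"
    then have w: "0 < \<omega>" "\<omega> < 1" by (auto simp: space_restrict_space)
    show "((\<lambda>t. quant \<nu> (cdf M t)) \<circ> M.I) \<omega> = G.I \<omega>"
      using cdf_quantile[OF M.cdf_distribution_axioms c w] w by (simp add: quant_def)
  qed
  also have "\<dots> = gv \<nu>" by (rule G.distr_I_eq_M)
  finally show ?thesis .
qed

lemma emeasure_gv_singleton: "emeasure (gv \<nu>) {x} = 0"
proof -
  have "emeasure (gv \<nu>) {x} = (\<integral>\<^sup>+y. ennreal (normal_density 0 (sqrt \<nu>) y) * indicator {x} y \<partial>lborel)"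
    unfolding gv_def by (subst emeasure_density) auto
  also have "\<dots> = ennreal (normal_density 0 (sqrt \<nu>) x) * emeasure lborel {x}"
    by (rule nn_integral_indicator_singleton) simp
  finally show ?thesis by simp
qed

lemma gv_null: "measure (gv \<nu>) {x} = 0"
  by (simp add: measure_def emeasure_gv_singleton)

lemma char_gv: assumes "0 < \<nu>" shows "char (gv \<nu>) t = of_real (exp (- (\<nu> * t\<^sup>2) / 2))"
proof -
  interpret S: real_distribution std_normal_distribution by (rule real_dist_normal_dist)
  have "distributed std_normal_distribution lborel (\<lambda>x. x) (normal_density 0 1)"
    by (auto simp: distributed_def distr_id2)
  from S.normal_density_affine[OF this, of "sqrt \<nu>" 0]
  have "distributed std_normal_distribution lborel (\<lambda>x. sqrt \<nu> * x) (normal_density 0 (sqrt \<nu>))"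
    using assms by simp
  then have "distr std_normal_distribution lborel (\<lambda>x. sqrt \<nu> * x) = gv \<nu>"
    by (simp add: distributed_def gv_def)
  then have e: "gv \<nu> = distr std_normal_distribution borel (\<lambda>x. sqrt \<nu> * x)"
    by (metis distr_cong sets_lborel)
  have "char (gv \<nu>) t = char std_normal_distribution (sqrt \<nu> * t)"
    unfolding e char_def by (subst integral_distr) (auto simp: mult_ac)
  also have "\<dots> = of_real (exp (- ((sqrt \<nu> * t)\<^sup>2) / 2))" by (simp add: char_std_normal_distribution)
  also have "(sqrt \<nu> * t)\<^sup>2 = \<nu> * t\<^sup>2" using assms by (simp add: power_mult_distrib)
  finally show ?thesis .
qed

text \<open>The Gaussian distribution function is continuous and strictly increasing, so convergence
  of the distribution functions just below and just above the Gaussian quantile squeezes the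
  quantiles.\<close>

lemma quantile_tendsto:
  assumes \<nu>: "0 < \<nu>" and M: "\<And>n. real_distribution (M n)" and conv: "weak_conv_m M (gv \<nu>)"
    and w: "0 < \<omega>" "\<omega> < 1"
  shows "(\<lambda>n. Inf {x. \<omega> \<le> cdf (M n) x}) \<longlonglongrightarrow> quant \<nu> \<omega>"
proof -
  interpret M: cdf_distribution "M n" for n using M by (simp add: cdf_distribution_def)
  interpret G: cdf_distribution "gv \<nu>" using \<nu> by (rule cdf_distribution_gv)
  have cdf: "(\<lambda>n. cdf (M n) x) \<longlonglongrightarrow> cdf (gv \<nu>) x" for x
    using conv gv_null by (simp add: weak_conv_m_def weak_conv_def G.isCont_cdf)
  have eq: "cdf (gv \<nu>) (quant \<nu> \<omega>) = \<omega>"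
    using cdf_quantile[OF G.cdf_distribution_axioms gv_null w] w by (simp add: quant_def)
  have strict: "cdf (gv \<nu>) x < cdf (gv \<nu>) y" if "x < y" for x y
  proof -
    have "emeasure (gv \<nu>) {x<..y} \<noteq> 0"
    proof
      assume "emeasure (gv \<nu>) {x<..y} = 0"
      then have "(\<integral>\<^sup>+t. ennreal (normal_density 0 (sqrt \<nu>) t) * indicator {x<..y} t \<partial>lborel) = 0"
        unfolding gv_def by (subst (asm) emeasure_density) auto
      then have "AE t in lborel. ennreal (normal_density 0 (sqrt \<nu>) t) * indicator {x<..y} t = 0"
        by (subst (asm) nn_integral_0_iff_AE) auto
      then have "AE t in lborel. t \<notin> {x<..y}"
      proof eventually_elim
        case (elim t)
        have "normal_density 0 (sqrt \<nu>) t > 0" using \<nu> by (intro normal_density_pos) simp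
        then show ?case using elim by (auto simp: indicator_def split: if_splits)
      qed
      then have "emeasure lborel {x<..y} = 0"
        by (subst (asm) AE_iff_measurable[where N = "{x<..y}"]) auto
      then show False using that by simp
    qed
    then have "0 < measure (gv \<nu>) {x<..y}"
      by (metis G.emeasure_eq_measure ennreal_0 less_le measure_nonneg)
    then show ?thesis using G.cdf_diff_eq[OF that] by simp
  qed
  show ?thesis
  proof (rule order_tendstoI)
    fix a assume a: "a < quant \<nu> \<omega>"
    have "cdf (gv \<nu>) a < \<omega>" using strict[OF a] eq by simp
    from order_tendstoD(2)[OF cdf this] show "\<forall>\<^sub>F n in sequentially. a < Inf {x. \<omega> \<le> cdf (M n) x}"
    proof eventually_elim
      case (elim n)
      then show ?case using M.pseudoinverse[OF w, of n a] by (simp add: not_le[symmetric])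
    qed
  next
    fix a assume a: "quant \<nu> \<omega> < a"
    \<comment> \<open>The characterisation of the infimum yields only a weak inequality, so an
      intermediate point is inserted.\<close>
    obtain b where b: "quant \<nu> \<omega> < b" "b < a" using dense[OF a] by blast
    have "\<omega> < cdf (gv \<nu>) b" using strict[OF b(1)] eq by simp
    from order_tendstoD(1)[OF cdf this] show "\<forall>\<^sub>F n in sequentially. Inf {x. \<omega> \<le> cdf (M n) x} < a"
    proof eventually_elim
      case (elim n)
      then have "Inf {x. \<omega> \<le> cdf (M n) x} \<le> b" using M.pseudoinverse[OF w, of n b] by simp
      then show ?case using b by simp
    qed
  qed
qed

text \<open>A quantitative form of Levy's continuity theorem: closeness of characteristic functions
  makes the monotone transport map to the Gaussian close to the identity. The rate is not needed,
  so a sequence of counterexamples is refuted by the qualitative theorem.\<close>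

lemma transport_close:
  assumes \<nu>: "0 < \<nu>" and \<epsilon>: "0 < \<epsilon>"
  shows "\<exists>\<eta>>0. \<forall>M. real_distribution M \<longrightarrow> (\<forall>x. measure M {x} = 0) \<longrightarrow>
      (\<forall>t. cmod (char M t - of_real (exp (- (\<nu> * t\<^sup>2) / 2))) \<le> (t\<^sup>2 + \<bar>t\<bar> ^ 3 + t ^ 4) * \<eta>) \<longrightarrow>
      measure M {t. \<epsilon> < \<bar>quant \<nu> (cdf M t) - t\<bar>} \<le> \<epsilon>"
proof (rule ccontr)
  define good where "good M \<eta> \<longleftrightarrow> real_distribution M \<and> (\<forall>x. measure M {x} = 0) \<and>
      (\<forall>t. cmod (char M t - of_real (exp (- (\<nu> * t\<^sup>2) / 2))) \<le> (t\<^sup>2 + \<bar>t\<bar> ^ 3 + t ^ 4) * \<eta>)" for M \<eta>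
  define dev where "dev M = measure M {t. \<epsilon> < \<bar>quant \<nu> (cdf M t) - t\<bar>}" for M
  assume "\<not> ?thesis"
  then have neg: "\<not> (\<exists>\<eta>>0. \<forall>M. good M \<eta> \<longrightarrow> dev M \<le> \<epsilon>)" unfolding good_def dev_def by blast
  have "\<exists>M. good M (1 / real (Suc n)) \<and> \<epsilon> < dev M" for n
  proof (rule ccontr)
    assume "\<not> ?thesis"
    then have "\<forall>M. good M (1 / real (Suc n)) \<longrightarrow> dev M \<le> \<epsilon>" by (simp add: not_less)
    moreover have "0 < 1 / real (Suc n)" by simp
    ultimately show False using neg by blast
  qed
  then have "\<exists>M. \<forall>n. good (M n) (1 / real (Suc n)) \<and> \<epsilon> < dev (M n)" by (intro choice) blast
  then obtain M where gd: "\<And>n. good (M n) (1 / real (Suc n))" "\<And>n. \<epsilon> < dev (M n)" by blast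
  have M: "\<And>n. real_distribution (M n)" "\<And>n x. measure (M n) {x} = 0"
    and ch: "\<And>n t. cmod (char (M n) t - of_real (exp (- (\<nu> * t\<^sup>2) / 2))) \<le> (t\<^sup>2 + \<bar>t\<bar> ^ 3 + t ^ 4) * (1 / real (Suc n))"
    using gd(1) unfolding good_def by blast+
  have far: "\<epsilon> < measure (M n) {t. \<epsilon> < \<bar>quant \<nu> (cdf (M n) t) - t\<bar>}" for n
    using gd(2)[of n] unfolding dev_def .
  have chl: "(\<lambda>n. char (M n) t) \<longlonglongrightarrow> char (gv \<nu>) t" for t
  proof (rule Lim_transform2)
    show "(\<lambda>n. char (gv \<nu>) t) \<longlonglongrightarrow> char (gv \<nu>) t" by simp
    have "(\<lambda>n. (t\<^sup>2 + \<bar>t\<bar> ^ 3 + t ^ 4) * (1 / real (Suc n))) \<longlonglongrightarrow> (t\<^sup>2 + \<bar>t\<bar> ^ 3 + t ^ 4) * 0"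
      by (intro tendsto_mult tendsto_const) (simp only: inverse_eq_divide[symmetric] LIMSEQ_inverse_real_of_nat)
    then have l: "(\<lambda>n. (t\<^sup>2 + \<bar>t\<bar> ^ 3 + t ^ 4) * (1 / real (Suc n))) \<longlonglongrightarrow> 0" by simp
    show "(\<lambda>n. char (gv \<nu>) t - char (M n) t) \<longlonglongrightarrow> 0"
      by (rule Lim_null_comparison[OF _ l]) (use ch[of _ t] in \<open>simp add: char_gv[OF \<nu>] norm_minus_commute\<close>)
  qed
  have wc: "weak_conv_m M (gv \<nu>)"
    by (rule levy_continuity[OF M(1) real_distribution_gv[OF \<nu>] chl])
  interpret M: cdf_distribution "M n" for n using M by (simp add: cdf_distribution_def)
  interpret U: prob_space unif by (rule prob_unif)
  note [measurable] = measurable_quant[OF \<nu>]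
  have mI: "M.I n \<in> measurable unif borel" for n
    by (rule measurable_unif[OF M.measurable_CI])
  have mq: "quant \<nu> \<in> measurable unif borel" by (rule measurable_restrict_space1) simp
  \<comment> \<open>With \<open>M n\<close> realised by its quantile function,
    \<open>quant \<nu> (cdf (M n) t)\<close> becomes the Gaussian quantile at the same \<omega>. The
    bad events then live on one space, where their indicators tend to 0 pointwise.\<close>
  define S where "S n = {\<omega> \<in> space unif. \<epsilon> < \<bar>quant \<nu> \<omega> - M.I n \<omega>\<bar>}" for n
  have Sm: "S n \<in> sets unif" for n
    unfolding S_def by (intro borel_measurable_less borel_measurable_const borel_measurable_abs borel_measurable_diff mI mq)
  have eq: "measure (M n) {t. \<epsilon> < \<bar>quant \<nu> (cdf (M n) t) - t\<bar>} = U.prob (S n)" for n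
  proof -
    have s: "{t. \<epsilon> < \<bar>quant \<nu> (cdf (M n) t) - t\<bar>} \<in> sets borel" by measurable
    have "measure (M n) {t. \<epsilon> < \<bar>quant \<nu> (cdf (M n) t) - t\<bar>} = measure (distr unif borel (M.I n)) {t. \<epsilon> < \<bar>quant \<nu> (cdf (M n) t) - t\<bar>}"
      by (simp add: M.distr_I_eq_M)
    also have "\<dots> = U.prob (M.I n -` {t. \<epsilon> < \<bar>quant \<nu> (cdf (M n) t) - t\<bar>} \<inter> space unif)"
      by (rule measure_distr[OF mI s])
    also have "M.I n -` {t. \<epsilon> < \<bar>quant \<nu> (cdf (M n) t) - t\<bar>} \<inter> space unif = S n"
      unfolding S_def using cdf_quantile[OF M.cdf_distribution_axioms M(2)]
      by (auto simp: space_restrict_space)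
    finally show ?thesis .
  qed
  have "(\<lambda>n. \<integral>\<omega>. indicat_real (S n) \<omega> \<partial>unif) \<longlonglongrightarrow> (\<integral>\<omega>. 0 \<partial>unif)"
  proof (rule integral_dominated_convergence[where w = "\<lambda>_. 1"])
    show "AE \<omega> in unif. (\<lambda>n. indicat_real (S n) \<omega>) \<longlonglongrightarrow> 0"
    proof (rule AE_I2)
      fix \<omega> assume w: "\<omega> \<in> space unif"
      then have "(\<lambda>n. M.I n \<omega>) \<longlonglongrightarrow> quant \<nu> \<omega>"
        by (intro quantile_tendsto[OF \<nu> M(1) wc]) (auto simp: space_restrict_space)
      from tendstoD[OF this \<epsilon>] have "\<forall>\<^sub>F n in sequentially. indicat_real (S n) \<omega> = 0"
        by eventually_elim (auto simp: S_def dist_real_def abs_minus_commute)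
      then show "(\<lambda>n. indicat_real (S n) \<omega>) \<longlonglongrightarrow> 0" by (rule tendsto_eventually)
    qed
  qed (use Sm in auto)
  moreover have "S n \<inter> {0<..<1} = S n" for n by (auto simp: S_def space_restrict_space)
  ultimately have "(\<lambda>n. U.prob (S n)) \<longlonglongrightarrow> 0" using Sm by simp
  from order_tendstoD(2)[OF this \<epsilon>] obtain n where "U.prob (S n) < \<epsilon>"
    using eventually_happens'[OF sequentially_bot] by blast
  then show False using far[of n] eq[of n] by simp
qed

subsection \<open>Gaussian product space and resampling of coordinates\<close>

definition rs :: "'v set \<Rightarrow> ('v \<Rightarrow> real) \<Rightarrow> ('v \<Rightarrow> real) \<Rightarrow> 'v \<Rightarrow> real" where
  "rs \<Lambda> z y = (\<lambda>j. if j \<in> \<Lambda> then y j else z j)"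

text \<open>Quantifies over all functions and not only over points of the product space, so that
  locality of the messages is an algebraic fact, free of measurability.\<close>

definition dep :: "'v set \<Rightarrow> (('v \<Rightarrow> real) \<Rightarrow> 'b) \<Rightarrow> bool" where
  "dep D h \<longleftrightarrow> (\<forall>z z'. (\<forall>j\<in>D. z j = z' j) \<longrightarrow> h z = h z')"

lemma depD: "dep D h \<Longrightarrow> (\<And>j. j \<in> D \<Longrightarrow> z j = z' j) \<Longrightarrow> h z = h z'"
  by (auto simp: dep_def)

lemma dep_mono: "dep D h \<Longrightarrow> D \<subseteq> D' \<Longrightarrow> dep D' h"
  unfolding dep_def by blast

lemma dep_compose: "dep D h \<Longrightarrow> dep D (\<lambda>z. F (h z))"
  by (subst dep_def, intro allI impI arg_cong[where f = F], rule depD[of D h]) auto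

lemma dep_compose2: "dep D h \<Longrightarrow> dep D g \<Longrightarrow> dep D (\<lambda>z. F (h z) (g z))"
  by (subst dep_def, intro allI impI arg_cong2[where f = F]; rule depD[of D]) auto

lemma dep_cong: "dep D h \<Longrightarrow> (\<And>z. g z = h z) \<Longrightarrow> dep D g"
  unfolding dep_def by presburger

lemma dep_const: "dep D (\<lambda>_. c)"
  by (simp add: dep_def)

lemma dep_sum: "(\<And>b. b \<in> I \<Longrightarrow> dep D (h b)) \<Longrightarrow> dep D (\<lambda>z. \<Sum>b\<in>I. h b z)"
  unfolding dep_def by (intro allI impI sum.cong) auto

lemma dep_prod: "(\<And>b. b \<in> I \<Longrightarrow> dep D (h b)) \<Longrightarrow> dep D (\<lambda>z. \<Prod>b\<in>I. h b z)"
  unfolding dep_def by (intro allI impI prod.cong) auto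

lemma dep_rs_eq: "dep D h \<Longrightarrow> D \<inter> \<Lambda> = {} \<Longrightarrow> h (rs \<Lambda> z y) = h z"
  by (rule depD[of D h]) (auto simp: rs_def)

lemma dep_rs: "dep D h \<Longrightarrow> dep D (\<lambda>y. h (rs \<Lambda> z y))"
  by (subst dep_def, intro allI impI, rule depD[of D h]) (auto simp: rs_def)

lemma rs_rs: "rs \<Lambda> (rs \<Lambda> z y) y' = rs \<Lambda> z y'"
  by (auto simp: rs_def)

locale gauss =
  fixes V :: "'v set" and \<delta> :: real
  assumes finV: "finite V" and dpos: "\<delta> > 0"
begin

abbreviation "N \<equiv> density lborel (normal_density 0 (sqrt \<delta>))"
abbreviation "P \<equiv> gspace V \<delta>"

lemma prob_N: "prob_space N"
  using dpos by (intro prob_space_normal_density) simp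

sublocale PP: product_prob_space "\<lambda>_. N" V
  using prob_N by (simp add: product_prob_space_def product_prob_space_axioms_def
      product_sigma_finite_def prob_space_imp_sigma_finite)

lemma prob_P: "prob_space P"
  unfolding gspace_def by (rule prob_space_PiM) (rule prob_N)

sublocale P: prob_space P by (rule prob_P)

sublocale PP2: pair_prob_space P P
  by (simp add: pair_prob_space_def pair_sigma_finite_def prob_P prob_space_imp_sigma_finite)

lemma space_P: "space P = PiE V (\<lambda>_. UNIV)"
  by (simp add: gspace_def space_PiM)

lemma measurable_coord: "j \<in> V \<Longrightarrow> (\<lambda>z. z j) \<in> borel_measurable P"
proof -
  assume "j \<in> V"
  then have "(\<lambda>z. z j) \<in> measurable (PiM V (\<lambda>_. N)) N" by (rule measurable_component_singleton)
  then show ?thesis unfolding gspace_def by (simp cong: measurable_cong_sets)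
qed

lemma distr_coord: "j \<in> V \<Longrightarrow> distr P N (\<lambda>z. z j) = N"
  unfolding gspace_def
  by (rule distr_PiM_component) (auto intro: prob_N finV)

lemma rs_in_space: "z \<in> space P \<Longrightarrow> y \<in> space P \<Longrightarrow> rs \<Lambda> z y \<in> space P"
  by (auto simp: space_P rs_def PiE_iff extensional_def)

lemma measurable_rs: "(\<lambda>(z, y). rs \<Lambda> z y) \<in> measurable (P \<Otimes>\<^sub>M P) P"
proof -
  have "(\<lambda>x. rs \<Lambda> (fst x) (snd x)) \<in> measurable (P \<Otimes>\<^sub>M P) (PiM V (\<lambda>_. N))"
  proof (rule measurable_PiM_single')
    fix j assume j: "j \<in> V"
    have "(\<lambda>x. if j \<in> \<Lambda> then snd x j else fst x j) \<in> borel_measurable (P \<Otimes>\<^sub>M P)"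
      by (cases "j \<in> \<Lambda>") (simp_all add: measurable_compose[OF measurable_fst measurable_coord[OF j]]
          measurable_compose[OF measurable_snd measurable_coord[OF j]])
    then show "(\<lambda>x. rs \<Lambda> (fst x) (snd x) j) \<in> measurable (P \<Otimes>\<^sub>M P) N"
      by (simp add: rs_def cong: measurable_cong_sets)
  next
    show "(\<lambda>x. rs \<Lambda> (fst x) (snd x)) \<in> space (P \<Otimes>\<^sub>M P) \<rightarrow> (\<Pi>\<^sub>E i\<in>V. space N)"
      by (auto simp: space_pair_measure rs_def space_P PiE_iff extensional_def)
  qed
  then show ?thesis by (simp add: gspace_def split_beta')
qed

lemma measurable_rs2 [measurable (raw)]:
  assumes [measurable]: "f \<in> measurable M P" "g \<in> measurable M P"
  shows "(\<lambda>x. rs \<Lambda> (f x) (g x)) \<in> measurable M P"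
  using measurable_compose[OF measurable_Pair[OF assms] measurable_rs] by simp

text \<open>Replacing some coordinates by independent copies preserves the product law: the preimage
  of a box is a box for the kept coordinates times a box for the fresh ones.\<close>

lemma rs_push: "distr (P \<Otimes>\<^sub>M P) P (\<lambda>(z, y). rs \<Lambda> z y) = P"
proof -
  have "PiM V (\<lambda>_. N) = distr (P \<Otimes>\<^sub>M P) P (\<lambda>(z, y). rs \<Lambda> z y)"
  proof (rule PP.PiM_eqI[symmetric])
    show "sets (distr (P \<Otimes>\<^sub>M P) P (\<lambda>(z, y). rs \<Lambda> z y)) = sets (PiM V (\<lambda>_. N))"
      by (simp add: gspace_def)
    fix A assume A: "\<And>i. i \<in> V \<Longrightarrow> A i \<in> sets N"
    define B where "B = PiE V (\<lambda>i. if i \<in> \<Lambda> then UNIV else A i)"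
    define C where "C = PiE V (\<lambda>i. if i \<in> \<Lambda> then A i else UNIV)"
    have B: "B \<in> sets P" "C \<in> sets P" unfolding B_def C_def gspace_def using A
      by (auto intro!: sets_PiM_I_finite finV)
    have pre: "(\<lambda>(z, y). rs \<Lambda> z y) -` PiE V A \<inter> space (P \<Otimes>\<^sub>M P) = B \<times> C"
    proof (intro set_eqI iffI)
      fix x assume x: "x \<in> (\<lambda>(z, y). rs \<Lambda> z y) -` PiE V A \<inter> space (P \<Otimes>\<^sub>M P)"
      obtain z y where zy: "x = (z, y)" by (cases x)
      have e: "z \<in> extensional V" "y \<in> extensional V" and m: "\<And>i. i \<in> V \<Longrightarrow> (if i \<in> \<Lambda> then y i else z i) \<in> A i"
        using x by (auto simp: zy space_pair_measure space_P rs_def PiE_iff)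
      have "z \<in> B" unfolding B_def PiE_iff using e m by (metis UNIV_I)
      moreover have "y \<in> C" unfolding C_def PiE_iff using e m by (metis UNIV_I)
      ultimately show "x \<in> B \<times> C" by (simp add: zy)
    next
      fix x assume x: "x \<in> B \<times> C"
      obtain z y where zy: "x = (z, y)" by (cases x)
      have e: "z \<in> space P" "y \<in> space P"
        and m: "\<And>i. i \<in> V \<Longrightarrow> z i \<in> (if i \<in> \<Lambda> then UNIV else A i)" "\<And>i. i \<in> V \<Longrightarrow> y i \<in> (if i \<in> \<Lambda> then A i else UNIV)"
        using x by (auto simp: zy B_def C_def space_P PiE_iff)
      have "rs \<Lambda> z y i \<in> A i" if "i \<in> V" for i using m[OF that] by (auto simp: rs_def split: if_splits)
      then have "rs \<Lambda> z y \<in> PiE V A" using rs_in_space[OF e, of \<Lambda>] by (auto simp: space_P PiE_iff)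
      then show "x \<in> (\<lambda>(z, y). rs \<Lambda> z y) -` PiE V A \<inter> space (P \<Otimes>\<^sub>M P)"
        using e by (simp add: zy space_pair_measure)
    qed
    have "emeasure (distr (P \<Otimes>\<^sub>M P) P (\<lambda>(z, y). rs \<Lambda> z y)) (PiE V A) = emeasure (P \<Otimes>\<^sub>M P) (B \<times> C)"
    proof (subst emeasure_distr[OF measurable_rs])
      show "PiE V A \<in> sets P" unfolding gspace_def using A by (intro sets_PiM_I_finite finV) auto
    qed (simp add: pre)
    also have "\<dots> = emeasure P B * emeasure P C"
      using B by (simp add: P.emeasure_pair_measure_Times)
    also have "\<dots> = (\<Prod>i\<in>V. emeasure N (if i \<in> \<Lambda> then UNIV else A i)) * (\<Prod>i\<in>V. emeasure N (if i \<in> \<Lambda> then A i else UNIV))"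
      unfolding B_def C_def gspace_def using A
      by (subst (1 2) PP.emeasure_PiM) (auto simp: finV)
    also have "\<dots> = (\<Prod>i\<in>V. emeasure N (A i))"
      unfolding prod.distrib[symmetric]
      using prob_space.emeasure_space_1[OF prob_N] by (intro prod.cong) auto
    finally show "emeasure (distr (P \<Otimes>\<^sub>M P) P (\<lambda>(z, y). rs \<Lambda> z y)) (PiE V A) = (\<Prod>i\<in>V. emeasure N (A i))" .
  qed (rule finV)
  then show ?thesis by (simp add: gspace_def)
qed

lemma indep_coord: "P.indep_vars (\<lambda>_. N) (\<lambda>i z. z i) V"
proof (cases "V = {}")
  case True
  then show ?thesis unfolding P.indep_vars_def P.indep_sets_def by blast
next
  case False
  have m: "\<And>i. i \<in> V \<Longrightarrow> (\<lambda>z. z i) \<in> measurable P N"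
    using measurable_coord by (simp cong: measurable_cong_sets)
  have "distr P (PiM V (\<lambda>_. N)) (\<lambda>x. \<lambda>i\<in>V. x i) = distr P (PiM V (\<lambda>_. N)) (\<lambda>x. x)"
    by (intro distr_cong refl) (auto simp: space_P intro!: restrict_ext PiE_restrict)
  also have "\<dots> = P" unfolding gspace_def by (rule distr_id)
  also have "P = PiM V (\<lambda>i. distr P N (\<lambda>z. z i))"
    
  proof -
    have "PiM V (\<lambda>_. N) = PiM V (\<lambda>i. distr P N (\<lambda>z. z i))" by (rule PiM_cong) (auto simp: distr_coord)
    then show ?thesis by (simp add: gspace_def)
  qed
  finally show ?thesis
    using P.indep_vars_iff_distr_eq_PiM'[OF False, of "\<lambda>i z. z i" "\<lambda>_. N"] m by simp
qed

text \<open>A function depending on \<open>D b\<close> only is a measurable function of the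
  restriction to \<open>D b\<close>, and restrictions to disjoint index sets are
  independent.\<close>

lemma indep_dep:
  assumes h: "\<And>b. b \<in> I \<Longrightarrow> h b \<in> borel_measurable P" "\<And>b. b \<in> I \<Longrightarrow> dep (D b) (h b)"
    and D: "\<And>b. b \<in> I \<Longrightarrow> D b \<subseteq> V" "disjoint_family_on D I"
  shows "P.indep_vars (\<lambda>_. borel) h I"
proof -
  define Y where "Y b x = h b (\<lambda>j. if j \<in> D b then x j else if j \<in> V then 0 else undefined)" for b x
  have 1: "P.indep_vars (\<lambda>b. PiM (D b) (\<lambda>_. N)) (\<lambda>b z. restrict (\<lambda>i. z i) (D b)) I"
    by (rule P.indep_vars_restrict[OF indep_coord D])
  \<comment> \<open>Missing coordinates are filled with 0 inside \<open>V\<close> and with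
    \<open>undefined\<close> outside, so that the result is a point of the product space.\<close>
  define G where "G b x = (\<lambda>j. if j \<in> D b then x j else if j \<in> V then 0 else (undefined :: real))"
    for b and x :: "'v \<Rightarrow> real"
  have Y_G: "Y b = (\<lambda>x. h b (G b x))" for b unfolding Y_def G_def by (rule refl)
  have Ym: "Y b \<in> borel_measurable (PiM (D b) (\<lambda>_. N))" if b: "b \<in> I" for b
  proof -
    have "G b \<in> measurable (PiM (D b) (\<lambda>_. N)) (PiM V (\<lambda>_. N))"
    proof (rule measurable_PiM_single')
      fix j assume "j \<in> V"
      show "(\<lambda>x. G b x j) \<in> measurable (PiM (D b) (\<lambda>_. N)) N"
      proof (cases "j \<in> D b")
        case True
        then have "(\<lambda>x. G b x j) = (\<lambda>x. x j)" by (auto simp: G_def)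
        then show ?thesis using measurable_component_singleton[OF True, of "\<lambda>_. N"] by metis
      next
        case False
        then have "(\<lambda>x. G b x j) = (\<lambda>x. if j \<in> V then 0 else undefined)" by (auto simp: G_def)
        then show ?thesis using measurable_const by simp
      qed
    next
      show "G b \<in> space (PiM (D b) (\<lambda>_. N)) \<rightarrow> (\<Pi>\<^sub>E i\<in>V. space N)"
      proof
        fix x
        have "G b x j = undefined" if "j \<notin> V" for j using that D(1)[OF b] by (auto simp: G_def)
        then show "G b x \<in> (\<Pi>\<^sub>E i\<in>V. space N)" by (auto simp: PiE_iff extensional_def)
      qed
    qed
    then have G: "G b \<in> measurable (PiM (D b) (\<lambda>_. N)) P" unfolding gspace_def .
    show ?thesis unfolding Y_G by (rule measurable_compose[OF G h(1)[OF b]])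
  qed
  have "P.indep_vars (\<lambda>_. borel) (\<lambda>b z. Y b (restrict (\<lambda>i. z i) (D b))) I"
    by (rule P.indep_vars_compose2[OF 1]) (rule Ym)
  moreover have "Y b (restrict (\<lambda>i. z i) (D b)) = h b z" if "b \<in> I" for b z
    unfolding Y_def by (rule depD[OF h(2)[OF that]]) simp
  then have "P.indep_vars (\<lambda>_. borel) (\<lambda>b z. Y b (restrict (\<lambda>i. z i) (D b))) I = P.indep_vars (\<lambda>_. borel) h I"
    by (intro P.indep_vars_cong refl ext)
  ultimately show ?thesis by blast
qed

subsection \<open>Functions of polynomial growth\<close>

definition sz :: "('v \<Rightarrow> real) \<Rightarrow> real" where "sz z = 1 + (\<Sum>j\<in>V. \<bar>z j\<bar>)"

text \<open>A class closed under sums, products and conditioning, all of whose members are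
  integrable. Its constants serve integrability only and may depend on the hypergraph; uniform
  bounds come from the moment estimates further below.\<close>

definition pg :: "(('v \<Rightarrow> real) \<Rightarrow> real) \<Rightarrow> bool" where
  "pg h \<longleftrightarrow> h \<in> borel_measurable P \<and> (\<exists>C k. \<forall>z\<in>space P. \<bar>h z\<bar> \<le> C * sz z ^ k)"

lemma sz_ge1: "1 \<le> sz z"
  by (simp add: sz_def sum_nonneg)

lemma measurable_sz [measurable]: "sz \<in> borel_measurable P"
  unfolding sz_def[abs_def] by (intro borel_measurable_add borel_measurable_sum borel_measurable_abs measurable_coord) auto

lemma integrable_coord_abs: "j \<in> V \<Longrightarrow> integrable P (\<lambda>z. \<bar>z j\<bar> ^ k)"
proof -
  assume j: "j \<in> V"
  have m: "(\<lambda>z. z j) \<in> measurable P N" using measurable_coord[OF j] by (simp cong: measurable_cong_sets)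
  have "integrable N (\<lambda>x. \<bar>x\<bar> ^ k)"
    using integrable_normal_moment_abs[of "sqrt \<delta>" 0 k] dpos
    by (subst integrable_density) auto
  then have "integrable (distr P N (\<lambda>z. z j)) (\<lambda>x. \<bar>x\<bar> ^ k)" by (simp add: distr_coord[OF j])
  then show ?thesis by (subst (asm) integrable_distr_eq[OF m]) auto
qed

lemma sz_power_le: "sz z ^ k \<le> (real (card V) + 1) ^ k * (1 + (\<Sum>j\<in>V. \<bar>z j\<bar> ^ k))"
proof -
  let ?S = "insert 1 ((\<lambda>j. \<bar>z j\<bar>) ` V)"
  define m where "m = Max ?S"
  have fin: "finite ?S" using finV by auto
  have m1: "m \<in> ?S" unfolding m_def by (rule Max_in[OF fin]) auto
  have le: "\<And>x. x \<in> ?S \<Longrightarrow> x \<le> m" unfolding m_def using fin by auto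
  have "sz z \<le> 1 * m + (\<Sum>j\<in>V. m)" unfolding sz_def by (intro add_mono sum_mono) (auto intro: le)
  also have "\<dots> = (real (card V) + 1) * m" by (simp add: algebra_simps)
  finally have "sz z ^ k \<le> ((real (card V) + 1) * m) ^ k"
    using sz_ge1[of z] by (intro power_mono) auto
  also have "\<dots> = (real (card V) + 1) ^ k * m ^ k" by (simp add: power_mult_distrib)
  also have "m ^ k \<le> 1 + (\<Sum>j\<in>V. \<bar>z j\<bar> ^ k)"
  proof (cases "m = 1")
    case True
    then show ?thesis by (simp add: sum_nonneg)
  next
    case False
    then obtain j where j: "j \<in> V" "m = \<bar>z j\<bar>" using m1 by auto
    have "\<bar>z j\<bar> ^ k \<le> (\<Sum>j\<in>V. \<bar>z j\<bar> ^ k)" by (rule member_le_sum[OF j(1)]) (auto simp: finV)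
    then show ?thesis using j by simp
  qed
  finally show ?thesis by (simp add: mult_left_mono)
qed

lemma integrable_sz: "integrable P (\<lambda>z. sz z ^ k)"
proof (rule Bochner_Integration.integrable_bound)
  show "integrable P (\<lambda>z. (real (card V) + 1) ^ k * (1 + (\<Sum>j\<in>V. \<bar>z j\<bar> ^ k)))"
    by (intro integrable_mult_right Bochner_Integration.integrable_add Bochner_Integration.integrable_sum integrable_coord_abs) auto
  show "AE z in P. norm (sz z ^ k) \<le> norm ((real (card V) + 1) ^ k * (1 + (\<Sum>j\<in>V. \<bar>z j\<bar> ^ k)))"
  proof (rule AE_I2)
    fix z
    have "0 \<le> sz z ^ k" using sz_ge1[of z] by simp
    then show "norm (sz z ^ k) \<le> norm ((real (card V) + 1) ^ k * (1 + (\<Sum>j\<in>V. \<bar>z j\<bar> ^ k)))"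
      using sz_power_le[of z k] by simp
  qed
qed measurable

lemma pg_measurable [measurable_dest]: "pg h \<Longrightarrow> h \<in> borel_measurable P"
  by (simp add: pg_def)

lemma pgE:
  assumes "pg h" obtains C k where "C \<ge> 0" "\<And>z. z \<in> space P \<Longrightarrow> \<bar>h z\<bar> \<le> C * sz z ^ k"
proof -
  obtain C k where C: "\<And>z. z \<in> space P \<Longrightarrow> \<bar>h z\<bar> \<le> C * sz z ^ k" using assms by (auto simp: pg_def)
  have "\<bar>h z\<bar> \<le> \<bar>C\<bar> * sz z ^ k" if "z \<in> space P" for z
  proof -
    have "C * sz z ^ k \<le> \<bar>C\<bar> * sz z ^ k" using sz_ge1[of z] by (intro mult_right_mono) auto
    then show ?thesis using C[OF that] by simp
  qed
  then show ?thesis using that[of "\<bar>C\<bar>" k] by auto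
qed

lemma pgI: "h \<in> borel_measurable P \<Longrightarrow> (\<And>z. z \<in> space P \<Longrightarrow> \<bar>h z\<bar> \<le> C * sz z ^ k) \<Longrightarrow> pg h"
  by (auto simp: pg_def)

lemma pg_integrable: assumes "pg h" shows "integrable P h"
proof -
  obtain C k where C: "C \<ge> 0" "\<And>z. z \<in> space P \<Longrightarrow> \<bar>h z\<bar> \<le> C * sz z ^ k" using pgE[OF assms] by blast
  show ?thesis
  proof (rule Bochner_Integration.integrable_bound[OF integrable_mult_right[OF integrable_sz[of k], of C]])
    show "AE z in P. norm (h z) \<le> norm (C * sz z ^ k)"
    proof (rule AE_I2)
      fix z assume "z \<in> space P"
      from C(2)[OF this] show "norm (h z) \<le> norm (C * sz z ^ k)" by simp
    qed
  qed (use assms in measurable)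
qed

lemma pg_bounded: "h \<in> borel_measurable P \<Longrightarrow> (\<And>z. z \<in> space P \<Longrightarrow> \<bar>h z\<bar> \<le> C) \<Longrightarrow> pg h"
  by (rule pgI[of h C 0]) auto

lemma pg_const: "pg (\<lambda>_. c)"
  by (rule pg_bounded[of _ "\<bar>c\<bar>"]) auto

lemma pg_coord: "j \<in> V \<Longrightarrow> pg (\<lambda>z. z j)"
proof (rule pgI[of _ 1 1])
  fix z :: "'v \<Rightarrow> real" assume "j \<in> V"
  then have "\<bar>z j\<bar> \<le> (\<Sum>j\<in>V. \<bar>z j\<bar>)"
    using member_le_sum[of j V "\<lambda>j. \<bar>z j\<bar>"] finV by auto
  then show "\<bar>z j\<bar> \<le> 1 * sz z ^ 1" by (simp add: sz_def)
qed (rule measurable_coord)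

lemma pg_add: assumes "pg g" "pg h" shows "pg (\<lambda>z. g z + h z)"
proof -
  obtain C k where C: "C \<ge> 0" "\<And>z. z \<in> space P \<Longrightarrow> \<bar>g z\<bar> \<le> C * sz z ^ k" using pgE[OF assms(1)] by blast
  obtain D m where D: "D \<ge> 0" "\<And>z. z \<in> space P \<Longrightarrow> \<bar>h z\<bar> \<le> D * sz z ^ m" using pgE[OF assms(2)] by blast
  show ?thesis
  proof (rule pgI[of _ "C + D" "k + m"])
    fix z assume z: "z \<in> space P"
    have "sz z ^ k \<le> sz z ^ (k + m)" "sz z ^ m \<le> sz z ^ (k + m)" using sz_ge1 by (auto intro: power_increasing)
    then have "C * sz z ^ k \<le> C * sz z ^ (k + m)" "D * sz z ^ m \<le> D * sz z ^ (k + m)"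
      using C D by (auto intro: mult_left_mono)
    then show "\<bar>g z + h z\<bar> \<le> (C + D) * sz z ^ (k + m)" using C(2)[OF z] D(2)[OF z] by (simp add: algebra_simps)
  qed (use assms in measurable)
qed

lemma pg_mult: assumes "pg g" "pg h" shows "pg (\<lambda>z. g z * h z)"
proof -
  obtain C k where C: "C \<ge> 0" "\<And>z. z \<in> space P \<Longrightarrow> \<bar>g z\<bar> \<le> C * sz z ^ k" using pgE[OF assms(1)] by blast
  obtain D m where D: "D \<ge> 0" "\<And>z. z \<in> space P \<Longrightarrow> \<bar>h z\<bar> \<le> D * sz z ^ m" using pgE[OF assms(2)] by blast
  show ?thesis
  proof (rule pgI[of _ "C * D" "k + m"])
    fix z assume z: "z \<in> space P"
    have "\<bar>g z\<bar> * \<bar>h z\<bar> \<le> (C * sz z ^ k) * (D * sz z ^ m)"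
      using C(2)[OF z] D(2)[OF z] by (intro mult_mono) auto
    then show "\<bar>g z * h z\<bar> \<le> C * D * sz z ^ (k + m)" by (simp add: abs_mult power_add mult_ac)
  qed (use assms in measurable)
qed

lemma pg_uminus: "pg g \<Longrightarrow> pg (\<lambda>z. - g z)"
  using pg_mult[OF pg_const[of "-1"], of g] by simp

lemma pg_diff: "pg g \<Longrightarrow> pg h \<Longrightarrow> pg (\<lambda>z. g z - h z)"
  using pg_add[of g "\<lambda>z. - h z"] pg_uminus[of h] by simp

lemma pg_divide: "pg g \<Longrightarrow> pg (\<lambda>z. g z / c)"
  using pg_mult[OF _ pg_const[of "1 / c"], of g] by simp

lemma pg_abs: "pg g \<Longrightarrow> pg (\<lambda>z. \<bar>g z\<bar>)"
  by (auto simp: pg_def)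

lemma pg_power: "pg g \<Longrightarrow> pg (\<lambda>z. g z ^ k)"
  by (induction k) (auto intro: pg_const pg_mult)

lemma pg_sum: "(\<And>b. b \<in> I \<Longrightarrow> pg (g b)) \<Longrightarrow> pg (\<lambda>z. \<Sum>b\<in>I. g b z)"
  by (induction I rule: infinite_finite_induct) (auto intro: pg_const pg_add)

lemma pg_prod: "(\<And>b. b \<in> I \<Longrightarrow> pg (g b)) \<Longrightarrow> pg (\<lambda>z. \<Prod>b\<in>I. g b z)"
  by (induction I rule: infinite_finite_induct) (auto intro: pg_const pg_mult)

text \<open>Both sizes are at least 1, so their sum is at most twice their product. Polynomial
  growth thus survives integration in one of the two arguments.\<close>

lemma sz_rs: "sz (rs \<Lambda> z y) \<le> 2 * sz z * sz y"
proof -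
  have "sz (rs \<Lambda> z y) \<le> 1 + (\<Sum>j\<in>V. \<bar>z j\<bar> + \<bar>y j\<bar>)"
    unfolding sz_def by (intro add_mono sum_mono) (auto simp: rs_def)
  also have "\<dots> \<le> sz z + sz y" by (simp add: sz_def sum.distrib)
  also have "\<dots> \<le> 2 * sz z * sz y"
  proof -
    have "sz z * 1 \<le> sz z * sz y" "1 * sz y \<le> sz z * sz y"
      using sz_ge1[of z] sz_ge1[of y] by (auto intro: mult_left_mono mult_right_mono)
    then show ?thesis by simp
  qed
  finally show ?thesis .
qed

lemma rs_growth:
  assumes "C \<ge> 0" "\<And>z. z \<in> space P \<Longrightarrow> \<bar>h z\<bar> \<le> C * sz z ^ k" "z \<in> space P" "y \<in> space P"
  shows "\<bar>h (rs \<Lambda> z y)\<bar> \<le> (C * (2 * sz z) ^ k) * sz y ^ k"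
proof -
  have "\<bar>h (rs \<Lambda> z y)\<bar> \<le> C * sz (rs \<Lambda> z y) ^ k" using assms rs_in_space by blast
  also have "\<dots> \<le> C * (2 * sz z * sz y) ^ k"
    using assms(1) sz_rs[of \<Lambda> z y] sz_ge1[of "rs \<Lambda> z y"] by (intro mult_left_mono power_mono) auto
  finally show ?thesis by (simp add: power_mult_distrib mult_ac)
qed

lemma pg_rs: assumes "pg h" "z \<in> space P" shows "pg (\<lambda>y. h (rs \<Lambda> z y))"
proof -
  obtain C k where C: "C \<ge> 0" "\<And>z. z \<in> space P \<Longrightarrow> \<bar>h z\<bar> \<le> C * sz z ^ k" using pgE[OF assms(1)] by blast
  show ?thesis
  proof (rule pgI[OF _ rs_growth[OF C assms(2)]])
    show "(\<lambda>y. h (rs \<Lambda> z y)) \<in> borel_measurable P"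
      by (rule measurable_compose[OF measurable_rs2[OF measurable_const measurable_ident_sets]])
        (use assms in \<open>auto dest: pg_measurable\<close>)
  qed
qed

text \<open>As the coordinates are independent, \<open>CE \<Lambda> h\<close> is a version of the conditional
  expectation of \<open>h\<close> given the coordinates outside \<open>\<Lambda>\<close>, defined everywhere.\<close>

definition CE :: "'v set \<Rightarrow> (('v \<Rightarrow> real) \<Rightarrow> real) \<Rightarrow> ('v \<Rightarrow> real) \<Rightarrow> real" where
  "CE \<Lambda> h z = (\<integral>y. h (rs \<Lambda> z y) \<partial>P)"

lemma pg_CE: assumes "pg h" shows "pg (CE \<Lambda> h)"
proof -
  obtain C k where C: "C \<ge> 0" "\<And>z. z \<in> space P \<Longrightarrow> \<bar>h z\<bar> \<le> C * sz z ^ k" using pgE[OF assms] by blast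
  have [measurable]: "h \<in> borel_measurable P" using assms by (rule pg_measurable)
  show ?thesis
  proof (rule pgI[of _ "C * 2 ^ k * (\<integral>y. sz y ^ k \<partial>P)" k])
    have "(\<lambda>x. h (rs \<Lambda> (fst x) (snd x))) \<in> borel_measurable (P \<Otimes>\<^sub>M P)" by measurable
    then show "CE \<Lambda> h \<in> borel_measurable P"
      unfolding CE_def[abs_def] by (intro P.borel_measurable_lebesgue_integral) (simp add: split_beta')
    fix z assume z: "z \<in> space P"
    note pgr = pg_rs[OF assms z, of \<Lambda>]
    have "\<bar>CE \<Lambda> h z\<bar> \<le> (\<integral>y. \<bar>h (rs \<Lambda> z y)\<bar> \<partial>P)" unfolding CE_def by (rule integral_abs_bound)
    also have "\<dots> \<le> (\<integral>y. (C * (2 * sz z) ^ k) * sz y ^ k \<partial>P)"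
      by (rule integral_mono[OF pg_integrable[OF pg_abs[OF pgr]] integrable_mult_right[OF integrable_sz] rs_growth[OF C z]])
    also have "\<dots> = C * 2 ^ k * (\<integral>y. sz y ^ k \<partial>P) * sz z ^ k" by (simp add: power_mult_distrib)
    finally show "\<bar>CE \<Lambda> h z\<bar> \<le> C * 2 ^ k * (\<integral>y. sz y ^ k \<partial>P) * sz z ^ k" .
  qed
qed

text \<open>The tower property, obtained from Fubini and the invariance of the law under
  resampling.\<close>

lemma expectation_CE: assumes "pg h" shows "(\<integral>z. CE \<Lambda> h z \<partial>P) = (\<integral>z. h z \<partial>P)"
proof -
  have [measurable]: "h \<in> borel_measurable P" using assms by (rule pg_measurable)
  have "integrable (distr (P \<Otimes>\<^sub>M P) P (\<lambda>(z, y). rs \<Lambda> z y)) h" using pg_integrable[OF assms] by (simp add: rs_push)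
  then have i: "integrable (P \<Otimes>\<^sub>M P) (\<lambda>x. h (rs \<Lambda> (fst x) (snd x)))"
    by (subst (asm) integrable_distr_eq[OF measurable_rs]) (auto simp: split_beta')
  have "(\<integral>z. CE \<Lambda> h z \<partial>P) = (\<integral>x. h (rs \<Lambda> (fst x) (snd x)) \<partial>(P \<Otimes>\<^sub>M P))"
    unfolding CE_def using PP2.integral_fst'[OF i] by simp
  also have "\<dots> = (\<integral>z. h z \<partial>distr (P \<Otimes>\<^sub>M P) P (\<lambda>(z, y). rs \<Lambda> z y))"
    by (subst integral_distr[OF measurable_rs]) (auto simp: split_beta')
  finally show ?thesis by (simp add: rs_push)
qed

lemma CE_add: "pg g \<Longrightarrow> pg h \<Longrightarrow> z \<in> space P \<Longrightarrow> CE \<Lambda> (\<lambda>z. g z + h z) z = CE \<Lambda> g z + CE \<Lambda> h z"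
  unfolding CE_def by (intro Bochner_Integration.integral_add pg_integrable pg_rs)

lemma CE_diff: "pg g \<Longrightarrow> pg h \<Longrightarrow> z \<in> space P \<Longrightarrow> CE \<Lambda> (\<lambda>z. g z - h z) z = CE \<Lambda> g z - CE \<Lambda> h z"
  unfolding CE_def by (intro Bochner_Integration.integral_diff pg_integrable pg_rs)

lemma CE_sum: "(\<And>b. b \<in> I \<Longrightarrow> pg (g b)) \<Longrightarrow> z \<in> space P \<Longrightarrow>
    CE \<Lambda> (\<lambda>z. \<Sum>b\<in>I. g b z) z = (\<Sum>b\<in>I. CE \<Lambda> (g b) z)"
  unfolding CE_def by (intro Bochner_Integration.integral_sum pg_integrable pg_rs)

lemma CE_cmult: "CE \<Lambda> (\<lambda>z. c * h z) z = c * CE \<Lambda> h z"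
  unfolding CE_def by simp

lemma CE_divide: "CE \<Lambda> (\<lambda>z. h z / c) z = CE \<Lambda> h z / c"
  unfolding CE_def by simp

lemma CE_take_out: "dep D g \<Longrightarrow> D \<inter> \<Lambda> = {} \<Longrightarrow> CE \<Lambda> (\<lambda>z. g z * h z) z = g z * CE \<Lambda> h z"
  unfolding CE_def by (simp add: dep_rs_eq)

lemma CE_dep: "dep D g \<Longrightarrow> D \<inter> \<Lambda> = {} \<Longrightarrow> CE \<Lambda> g z = g z"
  unfolding CE_def by (simp add: dep_rs_eq P.prob_space)

text \<open>Serves to replace the leaves of the whole tree by those of a single branch.\<close>

lemma CE_cong_set: assumes "dep D h" "\<Lambda> \<inter> D = \<Lambda>' \<inter> D" shows "CE \<Lambda> h z = CE \<Lambda>' h z"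
proof -
  have "h (rs \<Lambda> z y) = h (rs \<Lambda>' z y)" for y
    by (rule depD[OF assms(1)]) (use assms(2) in \<open>auto simp: rs_def\<close>)
  then show ?thesis by (simp add: CE_def)
qed

lemma dep_CE: "dep D h \<Longrightarrow> dep (D - \<Lambda>) (CE \<Lambda> h)"
proof -
  assume D: "dep D h"
  have "h (rs \<Lambda> z y) = h (rs \<Lambda> z' y)" if "\<forall>j\<in>D - \<Lambda>. z j = z' j" for z z' y
    by (rule depD[OF D]) (use that in \<open>auto simp: rs_def\<close>)
  then show ?thesis unfolding dep_def CE_def by (intro allI impI Bochner_Integration.integral_cong) auto
qed

lemma CE_nonneg: "(\<And>z. 0 \<le> h z) \<Longrightarrow> 0 \<le> CE \<Lambda> h z"
  unfolding CE_def by (rule Bochner_Integration.integral_nonneg) auto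

lemma CE_jensen_sq: assumes "pg h" "z \<in> space P" shows "(CE \<Lambda> h z)\<^sup>2 \<le> CE \<Lambda> (\<lambda>z. (h z)\<^sup>2) z"
proof -
  have i: "integrable P (\<lambda>y. h (rs \<Lambda> z y))" "integrable P (\<lambda>y. (h (rs \<Lambda> z y))\<^sup>2)"
    by (rule pg_integrable[OF pg_rs[OF assms]],
        rule pg_integrable[OF pg_power[OF pg_rs[OF assms]]])
  have "0 \<le> P.variance (\<lambda>y. h (rs \<Lambda> z y))" by (rule P.variance_positive)
  then show ?thesis unfolding CE_def using P.variance_eq[OF i] by simp
qed

lemma expectation_prod_dep:
  assumes "finite I" "\<And>b. b \<in> I \<Longrightarrow> pg (h b)" "\<And>b. b \<in> I \<Longrightarrow> dep (D b) (h b)"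
    and "\<And>b. b \<in> I \<Longrightarrow> D b \<subseteq> V" "disjoint_family_on D I"
  shows "(\<integral>z. (\<Prod>b\<in>I. h b z) \<partial>P) = (\<Prod>b\<in>I. (\<integral>z. h b z \<partial>P))"
  using assms by (intro P.indep_vars_lebesgue_integral indep_dep[where D = D] pg_integrable) (auto dest: pg_measurable)

lemma CE_prod_dep:
  assumes "finite I" "\<And>b. b \<in> I \<Longrightarrow> pg (h b)" "\<And>b. b \<in> I \<Longrightarrow> dep (D b) (h b)"
    and "\<And>b. b \<in> I \<Longrightarrow> D b \<subseteq> V" "disjoint_family_on D I" "z \<in> space P"
  shows "CE \<Lambda> (\<lambda>z. \<Prod>b\<in>I. h b z) z = (\<Prod>b\<in>I. CE \<Lambda> (h b) z)"
  unfolding CE_def using assms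
  by (intro expectation_prod_dep[where D = D]) (auto intro: pg_rs dep_rs)

end

subsection \<open>Square sums and multilinear forms of independent functions\<close>

context gauss
begin

text \<open>Unconditional statements are the case in which all coordinates are resampled, so facts
  proved for \<open>CE\<close> specialise to plain expectations.\<close>

lemma CE_V: "z \<in> space P \<Longrightarrow> CE V h z = (\<integral>y. h y \<partial>P)"
proof -
  assume z: "z \<in> space P"
  have "rs V z y = y" if "y \<in> space P" for y
    using that z by (auto simp: rs_def space_P PiE_iff extensional_def)
  then show ?thesis unfolding CE_def by (intro Bochner_Integration.integral_cong) auto
qed

lemma space_nonempty: obtains z where "z \<in> space P"
  using P.not_empty by blast

lemma CE_mult_dep:
  assumes "pg g" "pg h" "dep D g" "dep D' h" "D \<subseteq> V" "D' \<subseteq> V" "D \<inter> D' = {}" "z \<in> space P"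
  shows "CE \<Lambda> (\<lambda>z. g z * h z) z = CE \<Lambda> g z * CE \<Lambda> h z"
proof -
  have "CE \<Lambda> (\<lambda>z. \<Prod>b\<in>{True, False}. (if b then g else h) z) z = (\<Prod>b\<in>{True, False}. CE \<Lambda> (if b then g else h) z)"
    by (rule CE_prod_dep[where D = "\<lambda>b. if b then D else D'"])
      (use assms in \<open>auto simp: disjoint_family_on_def\<close>)
  then show ?thesis by simp
qed

lemma CE_square_sum:
  assumes I: "finite I" and h: "\<And>b. b \<in> I \<Longrightarrow> pg (h b)" "\<And>b. b \<in> I \<Longrightarrow> dep (D b) (h b)"
    and D: "\<And>b. b \<in> I \<Longrightarrow> D b \<subseteq> V" "disjoint_family_on D I" and z: "z \<in> space P"
    and m: "\<And>b. b \<in> I \<Longrightarrow> CE \<Lambda> (h b) z = 0"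
  shows "CE \<Lambda> (\<lambda>z. (\<Sum>b\<in>I. h b z)\<^sup>2) z = (\<Sum>b\<in>I. CE \<Lambda> (\<lambda>z. (h b z)\<^sup>2) z)"
proof -
  have "CE \<Lambda> (\<lambda>z. (\<Sum>b\<in>I. h b z)\<^sup>2) z = CE \<Lambda> (\<lambda>z. \<Sum>b\<in>I. \<Sum>c\<in>I. h b z * h c z) z"
    by (simp add: power2_eq_square sum_product)
  also have "\<dots> = (\<Sum>b\<in>I. CE \<Lambda> (\<lambda>z. \<Sum>c\<in>I. h b z * h c z) z)"
    by (rule CE_sum) (use h z in \<open>auto intro!: pg_sum pg_mult\<close>)
  also have "\<dots> = (\<Sum>b\<in>I. \<Sum>c\<in>I. CE \<Lambda> (\<lambda>z. h b z * h c z) z)"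
    by (intro sum.cong refl CE_sum) (use h z in \<open>auto intro!: pg_sum pg_mult\<close>)
  also have "\<dots> = (\<Sum>b\<in>I. \<Sum>c\<in>I. if c = b then CE \<Lambda> (\<lambda>z. (h b z)\<^sup>2) z else 0)"
  proof (intro sum.cong refl)
    fix b c assume bc: "b \<in> I" "c \<in> I"
    show "CE \<Lambda> (\<lambda>z. h b z * h c z) z = (if c = b then CE \<Lambda> (\<lambda>z. (h b z)\<^sup>2) z else 0)"
    proof (cases "c = b")
      case False
      have "D b \<inter> D c = {}" using D(2) bc False by (auto simp: disjoint_family_on_def)
      then have "CE \<Lambda> (\<lambda>z. h b z * h c z) z = CE \<Lambda> (h b) z * CE \<Lambda> (h c) z"
        by (rule CE_mult_dep[OF h(1)[OF bc(1)] h(1)[OF bc(2)] h(2)[OF bc(1)] h(2)[OF bc(2)] D(1)[OF bc(1)] D(1)[OF bc(2)] _ z])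
      then show ?thesis using m bc False by simp
    qed (simp add: power2_eq_square)
  qed
  also have "\<dots> = (\<Sum>b\<in>I. CE \<Lambda> (\<lambda>z. (h b z)\<^sup>2) z)"
    using I by (simp add: sum.delta)
  finally show ?thesis .
qed

lemma variance_sum_le:
  assumes I: "finite I" and h: "\<And>b. b \<in> I \<Longrightarrow> pg (h b)" "\<And>b. b \<in> I \<Longrightarrow> dep (D b) (h b)"
    and D: "\<And>b. b \<in> I \<Longrightarrow> D b \<subseteq> V" "disjoint_family_on D I"
  shows "(\<integral>z. ((\<Sum>b\<in>I. h b z) - (\<Sum>b\<in>I. \<integral>z. h b z \<partial>P))\<^sup>2 \<partial>P) \<le> (\<Sum>b\<in>I. \<integral>z. (h b z)\<^sup>2 \<partial>P)"
proof -
  obtain z where z: "z \<in> space P" using space_nonempty .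
  define g where "g b z = h b z - (\<integral>z. h b z \<partial>P)" for b z
  have g: "pg (g b)" "dep (D b) (g b)" if "b \<in> I" for b
    unfolding g_def[abs_def] using h that by (auto intro: pg_diff pg_const dep_compose)
  have "CE V (g b) z = 0" if "b \<in> I" for b
    unfolding CE_V[OF z] unfolding g_def using pg_integrable[OF h(1)[OF that]]
    by (simp add: P.prob_space)
  from CE_square_sum[OF I g D z this]
  have "(\<integral>z. (\<Sum>b\<in>I. g b z)\<^sup>2 \<partial>P) = (\<Sum>b\<in>I. (\<integral>z. (g b z)\<^sup>2 \<partial>P))" by (simp add: CE_V[OF z])
  also have "\<dots> \<le> (\<Sum>b\<in>I. \<integral>z. (h b z)\<^sup>2 \<partial>P)"
  proof (rule sum_mono)
    fix b assume b: "b \<in> I"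
    show "(\<integral>z. (g b z)\<^sup>2 \<partial>P) \<le> (\<integral>z. (h b z)\<^sup>2 \<partial>P)"
      unfolding g_def using P.variance_eq[OF pg_integrable[OF h(1)[OF b]] pg_integrable[OF pg_power[OF h(1)[OF b]]]]
      by simp
  qed
  finally show ?thesis by (simp add: g_def sum_subtractf)
qed

text \<open>Products over different index sets are orthogonal: an index in exactly one of the two
  sets contributes a factor of mean zero. Only the diagonal of the double sum remains.\<close>

lemma multilinear_second_moment:
  fixes X :: "nat \<Rightarrow> ('v \<Rightarrow> real) \<Rightarrow> real"
  assumes T: "finite T" and X: "\<And>k. k \<in> T \<Longrightarrow> pg (X k)" "\<And>k. k \<in> T \<Longrightarrow> dep (D k) (X k)"
    and D: "\<And>k. k \<in> T \<Longrightarrow> D k \<subseteq> V" "disjoint_family_on D T"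
    and m: "\<And>k. k \<in> T \<Longrightarrow> (\<integral>z. X k z \<partial>P) = 0"
    and F: "finite F" "inj_on g F" "\<And>S. S \<in> F \<Longrightarrow> g S \<subseteq> T"
  shows "(\<integral>z. (\<Sum>S\<in>F. c S * (\<Prod>k\<in>g S. X k z))\<^sup>2 \<partial>P) = (\<Sum>S\<in>F. (c S)\<^sup>2 * (\<Prod>k\<in>g S. \<integral>z. (X k z)\<^sup>2 \<partial>P))"
proof -
  have pgp: "pg (\<lambda>z. \<Prod>k\<in>g S. X k z)" if "S \<in> F" for S using F(3)[OF that] X(1) by (intro pg_prod) auto
  have cross: "(\<integral>z. (\<Prod>k\<in>g S. X k z) * (\<Prod>k\<in>g S'. X k z) \<partial>P) = (if S' = S then \<Prod>k\<in>g S. \<integral>z. (X k z)\<^sup>2 \<partial>P else 0)"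
    if S: "S \<in> F" "S' \<in> F" for S S'
  proof -
    \<comment> \<open>Both products are padded with factors 1 to products over all of
      \<open>T\<close>, so that the mixed term is one product of independent functions.\<close>
    define e where "e k z = (if k \<in> g S then X k z else 1) * (if k \<in> g S' then X k z else 1)" for k z
    have pr: "(\<Prod>k\<in>g R. X k z) = (\<Prod>k\<in>T. if k \<in> g R then X k z else 1)" if "R \<in> F" for R z
      using T F(3)[OF that] by (simp add: prod.inter_restrict[symmetric] Int_absorb1)
    have "(\<integral>z. (\<Prod>k\<in>g S. X k z) * (\<Prod>k\<in>g S'. X k z) \<partial>P) = (\<integral>z. (\<Prod>k\<in>T. e k z) \<partial>P)"
      by (simp add: pr S e_def prod.distrib)
    also have "\<dots> = (\<Prod>k\<in>T. \<integral>z. e k z \<partial>P)"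
    proof (rule expectation_prod_dep[OF T _ _ D])
      fix k assume k: "k \<in> T"
      have "pg (\<lambda>z. if k \<in> g R then X k z else 1)" for R
        using X(1)[OF k] by (cases "k \<in> g R") (auto intro: pg_const)
      then show "pg (e k)" unfolding e_def[abs_def] by (intro pg_mult)
      show "dep (D k) (e k)" unfolding e_def[abs_def] by (rule dep_compose[OF X(2)[OF k], of "\<lambda>x. (if k \<in> g S then x else 1) * (if k \<in> g S' then x else 1)"])
    qed auto
    also have "\<dots> = (if S' = S then \<Prod>k\<in>g S. \<integral>z. (X k z)\<^sup>2 \<partial>P else 0)"
    proof (cases "S' = S")
      case True
      have "(\<integral>z. e k z \<partial>P) = (if k \<in> g S then \<integral>z. (X k z)\<^sup>2 \<partial>P else 1)" for k
        by (simp add: e_def True power2_eq_square P.prob_space)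
      then show ?thesis using T F(3)[OF S(1)] True by (simp add: prod.inter_restrict[symmetric] Int_absorb1)
    next
      case False
      then have "g S \<noteq> g S'" using F(2) S by (auto dest: inj_onD)
      then obtain k where k: "(k \<in> g S) \<noteq> (k \<in> g S')" by blast
      then have kT: "k \<in> T" using F(3) S by blast
      have "(\<integral>z. e k z \<partial>P) = 0" using k m[OF kT] by (auto simp: e_def)
      then show ?thesis using False T kT by (auto simp: prod_zero_iff)
    qed
    finally show ?thesis .
  qed
  have "(\<integral>z. (\<Sum>S\<in>F. c S * (\<Prod>k\<in>g S. X k z))\<^sup>2 \<partial>P)
     = (\<integral>z. (\<Sum>S\<in>F. \<Sum>S'\<in>F. (c S * c S') * ((\<Prod>k\<in>g S. X k z) * (\<Prod>k\<in>g S'. X k z))) \<partial>P)"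
    by (simp add: power2_eq_square sum_product mult_ac)
  also have "\<dots> = (\<Sum>S\<in>F. \<Sum>S'\<in>F. (c S * c S') * (\<integral>z. (\<Prod>k\<in>g S. X k z) * (\<Prod>k\<in>g S'. X k z) \<partial>P))"
  proof -
    have pgc: "pg (\<lambda>z. (c S * c S') * ((\<Prod>k\<in>g S. X k z) * (\<Prod>k\<in>g S'. X k z)))" if "S \<in> F" "S' \<in> F" for S S'
      using that by (intro pg_mult pg_const pgp)
    have "(\<integral>z. (\<Sum>S'\<in>F. (c S * c S') * ((\<Prod>k\<in>g S. X k z) * (\<Prod>k\<in>g S'. X k z))) \<partial>P)
        = (\<Sum>S'\<in>F. (c S * c S') * (\<integral>z. (\<Prod>k\<in>g S. X k z) * (\<Prod>k\<in>g S'. X k z) \<partial>P))" if "S \<in> F" for S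
      by (subst Bochner_Integration.integral_sum) (auto intro!: pg_integrable pg_mult pgp that)
    then show ?thesis
      by (subst Bochner_Integration.integral_sum) (auto intro!: pg_integrable pgc pg_sum)
  qed
  also have "\<dots> = (\<Sum>S\<in>F. \<Sum>S'\<in>F. if S' = S then (c S)\<^sup>2 * (\<Prod>k\<in>g S. \<integral>z. (X k z)\<^sup>2 \<partial>P) else 0)"
    by (intro sum.cong refl) (simp add: cross power2_eq_square)
  also have "\<dots> = (\<Sum>S\<in>F. (c S)\<^sup>2 * (\<Prod>k\<in>g S. \<integral>z. (X k z)\<^sup>2 \<partial>P))"
    using F(1) by (simp add: sum.delta)
  finally show ?thesis .
qed

end

subsection \<open>The messages\<close>

lemma pderiv_ml_eq:
  assumes "\<iota> < r"
  shows "pderiv_ml r f \<iota> y = (\<Sum>S\<in>{S. S \<subseteq> {..<r} \<and> \<iota> \<in> S}. fourier r f S * (\<Prod>\<kappa>\<in>S - {\<iota>}. y \<kappa>))"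
proof -
  let ?g = "\<lambda>S t. fourier r f S * (\<Prod>\<kappa>\<in>S. (y(\<iota> := t)) \<kappa>)"
  have 1: "(?g S has_field_derivative (if \<iota> \<in> S then fourier r f S * (\<Prod>\<kappa>\<in>S - {\<iota>}. y \<kappa>) else 0)) (at t)"
    if "S \<in> Pow {..<r}" for S t
  proof -
    have fin: "finite S" using that by (auto intro: finite_subset)
    show ?thesis
    proof (cases "\<iota> \<in> S")
      case True
      have "?g S = (\<lambda>t. fourier r f S * (t * (\<Prod>\<kappa>\<in>S - {\<iota>}. y \<kappa>)))"
      proof
        fix t
        have "(\<Prod>\<kappa>\<in>S - {\<iota>}. (y(\<iota> := t)) \<kappa>) = (\<Prod>\<kappa>\<in>S - {\<iota>}. y \<kappa>)" by (intro prod.cong) auto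
        then show "?g S t = fourier r f S * (t * (\<Prod>\<kappa>\<in>S - {\<iota>}. y \<kappa>))"
          using prod.remove[OF fin True, of "y(\<iota> := t)"] by simp
      qed
      then show ?thesis using True by (auto intro!: derivative_eq_intros)
    next
      case False
      have "(\<Prod>\<kappa>\<in>S. (y(\<iota> := t)) \<kappa>) = (\<Prod>\<kappa>\<in>S. y \<kappa>)" for t using False by (intro prod.cong) auto
      then show ?thesis using False by simp
    qed
  qed
  have "((\<lambda>t. mlext r f (y(\<iota> := t))) has_field_derivative
      (\<Sum>S\<in>Pow {..<r}. if \<iota> \<in> S then fourier r f S * (\<Prod>\<kappa>\<in>S - {\<iota>}. y \<kappa>) else 0)) (at (y \<iota>))"
    unfolding mlext_def by (intro DERIV_sum 1)
  then have "pderiv_ml r f \<iota> y = (\<Sum>S\<in>Pow {..<r}. if \<iota> \<in> S then fourier r f S * (\<Prod>\<kappa>\<in>S - {\<iota>}. y \<kappa>) else 0)"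
    unfolding pderiv_ml_def by (rule DERIV_imp_deriv)
  also have "\<dots> = (\<Sum>S\<in>{S. S \<subseteq> {..<r} \<and> \<iota> \<in> S}. fourier r f S * (\<Prod>\<kappa>\<in>S - {\<iota>}. y \<kappa>))"
    by (intro sum.mono_neutral_cong_right) auto
  finally show ?thesis .
qed

text \<open>Each level adds one entry to the history and never overwrites an earlier one.\<close>

lemma whist_stable:
  "s \<le> l \<Longrightarrow> whist r f d Fs vf Fm z l s = whist r f d Fs vf Fm z s s"
proof (induction l)
  case (Suc l)
  then show ?case by (cases "s = Suc l") (auto simp: Let_def)
qed simp

definition Fam :: "nat \<Rightarrow> nat \<Rightarrow> nat set set" where
  "Fam r \<iota> = {S. S \<subseteq> {..<r} \<and> \<iota> \<in> S}"

lemma finite_Fam: "finite (Fam r \<iota>)"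
  unfolding Fam_def by (rule finite_subset[of _ "Pow {..<r}"]) auto

locale amp = gauss V \<delta> for V :: "'v set" and \<delta> :: real +
  fixes r :: nat and f :: "(nat \<Rightarrow> real) \<Rightarrow> real" and K :: real and L :: nat
    and Fs :: "'f set" and vf :: "'f \<Rightarrow> nat \<Rightarrow> 'v" and d :: nat and Fm :: "nat \<Rightarrow> (nat \<Rightarrow> real) \<Rightarrow> real"
  assumes r2: "r \<ge> 2"
    and f_deg1: "\<forall>S\<subseteq>{..<r}. card S = 1 \<longrightarrow> fourier r f S = 0"
    and Kpos: "K > 0"
    and regular: "index_regular V Fs vf r d"
    and girth: "no_short_cycle Fs vf r (4 * L + 4)"
    and Fm_meas: "\<And>k. k < L \<Longrightarrow> Fm k \<in> borel_measurable (PiM {..<k} (\<lambda>_. borel))"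
    and Fm_bdd: "\<And>k x. k < L \<Longrightarrow> x \<in> {..<k} \<rightarrow>\<^sub>E UNIV \<Longrightarrow> \<bar>Fm k x\<bar> \<le> K"
begin

abbreviation "nb i \<equiv> nbhd Fs vf r i"
abbreviation "ix b i \<equiv> idx vf r b i"
abbreviation "lf l i a \<equiv> leaf Fs vf r l i a"
abbreviation "cn l i a \<equiv> cone Fs vf r l i a"

definition "w l i a z = whist r f d Fs vf Fm z l l i a"
definition "u l i a z = umsg r f d Fs vf Fm z l i a"
definition "A l i a z = Amsgl r f d Fs vf Fm z l i a"
definition "zz l i a z = zmsg Fm z (whist r f d Fs vf Fm z l) l i a"
text \<open>With the convention \<open>z\<^sup>-\<^sup>1 = 0\<close> the martingale property and the increments of the
  sums defining \<open>w\<close> need no separate initial case.\<close>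

definition "zp l i a z = (if l = 0 then 0 else zz (l - 1) i a z)"

text \<open>\<open>dm\<close> is the message derivative at level l and \<open>dp\<close> the one at
  level l - 1; their difference \<open>Y\<close> is the summand that factor \<open>b\<close>
  contributes to the increment of level l + 1.\<close>

definition "dm l b i z = (\<Sum>S\<in>Fam r (ix b i). fourier r f S * (\<Prod>\<kappa>\<in>S - {ix b i}. zz l (vf b \<kappa>) b z))"
definition "dp l b i z = (\<Sum>S\<in>Fam r (ix b i). fourier r f S * (\<Prod>\<kappa>\<in>S - {ix b i}. zp l (vf b \<kappa>) b z))"
definition "Y l b i z = dm l b i z - dp l b i z"

lemma finite_nb: "finite (nb i)"
  using regular by (auto simp: index_regular_def nbhd_def)

lemma vf_V: "b \<in> Fs \<Longrightarrow> \<kappa> < r \<Longrightarrow> vf b \<kappa> \<in> V"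
  using regular by (auto simp: index_regular_def)

lemma vf_inj: "b \<in> Fs \<Longrightarrow> inj_on (vf b) {..<r}"
  using regular by (auto simp: index_regular_def)

lemma nb_Fs: "b \<in> nb i \<Longrightarrow> b \<in> Fs"
  by (simp add: nbhd_def)

lemma idx_props: assumes "b \<in> nb i" shows "ix b i < r" "vf b (ix b i) = i"
proof -
  have "\<exists>!\<iota>. \<iota> < r \<and> vf b \<iota> = i"
    using assms vf_inj[of b] by (auto simp: nbhd_def fvars_def inj_on_def)
  from theI'[OF this] show "ix b i < r" "vf b (ix b i) = i" by (auto simp: idx_def)
qed

lemma idx_eq: "b \<in> Fs \<Longrightarrow> \<kappa> < r \<Longrightarrow> ix b (vf b \<kappa>) = \<kappa>"
  using idx_props[of b "vf b \<kappa>"] vf_inj[of b] by (auto simp: nbhd_def fvars_def inj_on_def)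

lemma branch_props:
  assumes b: "b \<in> nb i" and k: "\<kappa> < r" "\<kappa> \<noteq> ix b i"
  shows "vf b \<kappa> \<in> V" "vf b \<kappa> \<noteq> i" "vf b \<kappa> \<in> fvars vf r b" "b \<in> nb (vf b \<kappa>)"
proof -
  have b': "b \<in> Fs" using b by (rule nb_Fs)
  show "vf b \<kappa> \<in> V" using vf_V b' k by blast
  show "vf b \<kappa> \<noteq> i" using idx_eq[OF b' k(1)] k(2) by auto
  show "vf b \<kappa> \<in> fvars vf r b" "b \<in> nb (vf b \<kappa>)" using b' k by (auto simp: nbhd_def fvars_def)
qed

lemma Fam_mem: "S \<in> Fam r \<iota> \<Longrightarrow> \<kappa> \<in> S - {\<iota>} \<Longrightarrow> \<kappa> < r \<and> \<kappa> \<noteq> \<iota>"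
  by (auto simp: Fam_def)

lemma whist_eq_w: "s \<le> l \<Longrightarrow> whist r f d Fs vf Fm z l s i a = w s i a z"
  unfolding w_def by (simp only: whist_stable[of s l])

lemma w_0: "w 0 i a z = 0" by (simp add: w_def)

lemma w_Suc: "w (Suc l) i a z = (\<Sum>b\<in>nb i - {a}. dm l b i z) / sqrt (real d - 1)"
proof -
  have "Dmsg r f vf b i (zmsg Fm z (whist r f d Fs vf Fm z l) l) = dm l b i z" if "b \<in> nb i - {a}" for b
    using that idx_props[of b i] by (simp add: Dmsg_def pderiv_ml_eq dm_def Fam_def zz_def)
  then have "(\<Sum>b\<in>nb i - {a}. Dmsg r f vf b i (zmsg Fm z (whist r f d Fs vf Fm z l) l)) = (\<Sum>b\<in>nb i - {a}. dm l b i z)"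
    by (intro sum.cong) auto
  then show ?thesis by (simp add: w_def Let_def)
qed

lemma u_eq: "u (Suc l) i a z = w (Suc l) i a z - w l i a z"
  unfolding u_def umsg_def by (simp only: diff_Suc_1 whist_eq_w le_SucI le_refl)

lemma u_0: "u 0 i a z = 0"
  by (simp add: u_def umsg_def)

lemma Amsg_eq: assumes "l \<le> m" shows "Amsg Fm (whist r f d Fs vf Fm z m) l i a = Fm l (\<lambda>k\<in>{..<l}. u (Suc k) i a z)"
  unfolding Amsg_def u_eq
proof (intro arg_cong[where f = "Fm l"] restrict_ext)
  fix k assume "k \<in> {..<l}"
  then have "Suc k \<le> m" "k \<le> m" using assms by auto
  then show "whist r f d Fs vf Fm z m (Suc k) i a - whist r f d Fs vf Fm z m k i a = w (Suc k) i a z - w k i a z"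
    by (simp only: whist_eq_w)
qed

lemma A_eq: "A l i a z = Fm l (\<lambda>k\<in>{..<l}. u (Suc k) i a z)"
  unfolding A_def Amsgl_def by (rule Amsg_eq) simp

lemma zz_eq: "zz l i a z = z i + (\<Sum>s\<in>{1..l}. A (s - 1) i a z * u s i a z)"
  unfolding zz_def zmsg_def
proof (intro arg_cong2[where f = "(+)"] sum.cong refl arg_cong2[where f = "(*)"])
  fix s assume s: "s \<in> {1..l}"
  show "Amsg Fm (whist r f d Fs vf Fm z l) (s - 1) i a = A (s - 1) i a z"
    using s Amsg_eq[of "s - 1" l] A_eq by auto
  obtain m where m: "s = Suc m" using s by (cases s) auto
  have le: "Suc m \<le> l" "m \<le> l" using s m by auto
  show "whist r f d Fs vf Fm z l s i a - whist r f d Fs vf Fm z l (s - 1) i a = u s i a z"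
    unfolding m u_eq diff_Suc_1 using le by (simp only: whist_eq_w)
qed

lemma zz_0: "zz 0 i a z = z i" by (simp add: zz_eq)

lemma zz_Suc: "zz (Suc l) i a z = zz l i a z + A l i a z * u (Suc l) i a z"
  by (simp add: zz_eq)

lemma zp_0: "zp 0 i a z = 0" and zp_Suc: "zp (Suc l) i a z = zz l i a z"
  by (simp_all add: zp_def)

text \<open>Here the absence of degree-one coefficients enters: at the zero point only the set
  \<open>{ix b i}\<close> could contribute. Hence the convention z^(-1) = 0 agrees with w^0 =
  0.\<close>

lemma dp_0: assumes "b \<in> nb i" shows "dp 0 b i z = 0"
  unfolding dp_def
proof (rule sum.neutral, rule ballI)
  fix S assume S: "S \<in> Fam r (ix b i)"
  have fin: "finite S" using S by (auto simp: Fam_def intro: finite_subset)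
  show "fourier r f S * (\<Prod>\<kappa>\<in>S - {ix b i}. zp 0 (vf b \<kappa>) b z) = 0"
  proof (cases "S - {ix b i} = {}")
    case True
    then have "S = {ix b i}" using S by (auto simp: Fam_def)
    then show ?thesis using f_deg1 S by (auto simp: Fam_def)
  next
    case False
    then show ?thesis using fin by (auto simp: zp_0 prod_zero_iff)
  qed
qed

lemma dp_Suc: "dp (Suc l) b i z = dm l b i z"
  by (simp add: dp_def dm_def zp_Suc)

lemma u_Suc: "u (Suc l) i a z = (\<Sum>b\<in>nb i - {a}. Y l b i z) / sqrt (real d - 1)"
proof (cases l)
  case 0
  then show ?thesis by (auto simp: u_eq w_Suc w_0 Y_def dp_0 intro!: sum.cong)
next
  case (Suc m)
  then show ?thesis by (simp add: u_eq w_Suc Y_def dp_Suc sum_subtractf diff_divide_distrib)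
qed

lemma abs_A_le: "l < L \<Longrightarrow> \<bar>A l i a z\<bar> \<le> K"
  unfolding A_eq by (rule Fm_bdd) auto

subsection \<open>Locality of the messages\<close>

text \<open>Separated from \<open>dep_w\<close> because w at level l + 1 is built from zz at level
  l, which in turn is built from w at all levels up to l.\<close>

lemma dep_zz_aux:
  assumes "\<And>s. s \<le> l \<Longrightarrow> dep (cn s i a) (w s i a)"
  shows "dep (cn l i a) (zz l i a)"
proof -
  have w: "dep (cn l i a) (w s i a)" if "s \<le> l" for s
    using dep_mono[OF assms[OF that] cone_mono[OF that]] .
  have u: "dep (cn l i a) (u s i a)" if s: "s \<le> l" for s
  proof (cases s)
    case 0
    then show ?thesis by (simp add: u_0[abs_def] dep_const)
  next
    case (Suc m)
    then have "dep (cn l i a) (w (Suc m) i a)" "dep (cn l i a) (w m i a)" using w s by auto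
    from dep_compose2[OF this] show ?thesis unfolding Suc by (rule dep_cong) (rule u_eq)
  qed
  have A: "dep (cn l i a) (A s i a)" if s: "s \<le> l" for s
    unfolding dep_def A_eq
  proof (intro allI impI arg_cong[where f = "Fm s"] restrict_ext)
    fix z z' :: "'v \<Rightarrow> real" and k assume zz: "\<forall>j\<in>cn l i a. z j = z' j" and "k \<in> {..<s}"
    then have "Suc k \<le> l" using s by simp
    then show "u (Suc k) i a z = u (Suc k) i a z'" by (rule depD[OF u]) (use zz in blast)
  qed
  have i: "i \<in> cn l i a" unfolding cone_def by (rule UN_I[of 0]) auto
  show ?thesis
    unfolding dep_def zz_eq
  proof (intro allI impI arg_cong2[where f = "(+)"] sum.cong refl arg_cong2[where f = "(*)"])
    fix z z' :: "'v \<Rightarrow> real" assume zz: "\<forall>j\<in>cn l i a. z j = z' j"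
    show "z i = z' i" using zz i by blast
    fix s assume s: "s \<in> {1..l}"
    then have le: "s - 1 \<le> l" "s \<le> l" by auto
    show "A (s - 1) i a z = A (s - 1) i a z'" by (rule depD[OF A[OF le(1)]]) (use zz in blast)
    show "u s i a z = u s i a z'" by (rule depD[OF u[OF le(2)]]) (use zz in blast)
  qed
qed

lemma dep_w: "dep (cn l i a) (w l i a)"
proof (induction l arbitrary: i a rule: less_induct)
  case (less l)
  show ?case
  proof (cases l)
    case 0
    then show ?thesis by (simp add: w_0[abs_def] dep_const)
  next
    case (Suc m)
    have "dep (cn (Suc m) i a) (zz m (vf b \<kappa>) b)"
      if "b \<in> nb i - {a}" "\<kappa> < r" "\<kappa> \<noteq> ix b i" for b \<kappa>
    proof (rule dep_mono)
      show "dep (cn m (vf b \<kappa>) b) (zz m (vf b \<kappa>) b)"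
        by (rule dep_zz_aux) (use less Suc in auto)
      show "cn m (vf b \<kappa>) b \<subseteq> cn (Suc m) i a"
        using that branch_props[of b i \<kappa>] by (intro cone_branch_subset) auto
    qed
    then have "dep (cn (Suc m) i a) (\<lambda>z. \<Prod>\<kappa>\<in>S - {ix b i}. zz m (vf b \<kappa>) b z)"
      if "b \<in> nb i - {a}" "S \<in> Fam r (ix b i)" for b S
      using that by (intro dep_prod) (auto dest: Fam_mem)
    then have "dep (cn (Suc m) i a) (dm m b i)" if "b \<in> nb i - {a}" for b
      unfolding dm_def[abs_def] using that by (intro dep_sum dep_compose[where F = "\<lambda>x. _ * x"])
    then have "dep (cn (Suc m) i a) (\<lambda>z. (\<Sum>b\<in>nb i - {a}. dm m b i z) / sqrt (real d - 1))"
      by (intro dep_compose[where F = "\<lambda>x. x / sqrt (real d - 1)"] dep_sum)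
    then show ?thesis unfolding Suc by (rule dep_cong) (rule w_Suc)
  qed
qed

lemma dep_zz: "dep (cn l i a) (zz l i a)"
  by (rule dep_zz_aux) (rule dep_w)

lemma dep_u: "dep (cn l i a) (u l i a)"
proof (cases l)
  case 0
  then show ?thesis by (simp add: u_0[abs_def] dep_const)
next
  case (Suc m)
  have "dep (cn (Suc m) i a) (w m i a)" by (rule dep_mono[OF dep_w cone_mono]) simp
  from dep_compose2[OF dep_w[of "Suc m" i a] this] show ?thesis unfolding Suc by (rule dep_cong) (rule u_eq)
qed

lemma dep_A: "dep (cn l i a) (A l i a)"
  unfolding dep_def A_eq
proof (intro allI impI arg_cong[where f = "Fm l"] restrict_ext)
  fix z z' :: "'v \<Rightarrow> real" and k assume zz: "\<forall>j\<in>cn l i a. z j = z' j" and "k \<in> {..<l}"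
  then have "Suc k \<le> l" by simp
  then show "u (Suc k) i a z = u (Suc k) i a z'"
    by (rule depD[OF dep_mono[OF dep_u cone_mono]]) (use zz in blast)
qed

lemma cn_lf_disjoint: "m < L \<Longrightarrow> cn m i a \<inter> lf (Suc m) i a = {}"
  using leaf_Suc_cone_disjoint[OF girth, of m i a] by auto

text \<open>For positive l the previous level sees only the cone of depth l - 1, which misses the
  leaves at depth l; so \<open>zp l\<close> stays fixed while those leaves are resampled.\<close>

lemma dep_zp: assumes "l \<le> L" shows "dep (cn l i a - lf l i a) (zp l i a)"
proof (cases l)
  case 0
  then show ?thesis by (simp add: zp_0[abs_def] dep_const)
next
  case (Suc m)
  have "cn m i a \<subseteq> cn l i a - lf l i a"
    using cn_lf_disjoint[of m i a] cone_mono[of m l Fs vf r i a] assms Suc by auto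
  then have "dep (cn l i a - lf l i a) (zz m i a)" by (rule dep_mono[OF dep_zz])
  then show ?thesis by (rule dep_cong) (simp add: Suc zp_Suc)
qed

lemma cn_V: "i \<in> V \<Longrightarrow> cn l i a \<subseteq> V"
  using leaf_subset_V[of Fs r vf V i] vf_V by (fastforce simp: cone_def)

lemma pg_multilinear:
  assumes "\<And>\<kappa>. \<kappa> < r \<Longrightarrow> \<kappa> \<noteq> \<iota> \<Longrightarrow> pg (X \<kappa>)"
  shows "pg (\<lambda>z. \<Sum>S\<in>Fam r \<iota>. c S * (\<Prod>\<kappa>\<in>S - {\<iota>}. X \<kappa> z))"
proof (rule pg_sum)
  fix S assume "S \<in> Fam r \<iota>"
  then have "pg (\<lambda>z. \<Prod>\<kappa>\<in>S - {\<iota>}. X \<kappa> z)"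
    using Fam_mem by (intro pg_prod assms) blast+
  then show "pg (\<lambda>z. c S * (\<Prod>\<kappa>\<in>S - {\<iota>}. X \<kappa> z))" by (rule pg_mult[OF pg_const])
qed

lemma pg_A_aux:
  assumes "l < L" "\<And>k. k < l \<Longrightarrow> pg (u (Suc k) i a)"
  shows "pg (A l i a)"
proof (rule pg_bounded)
  have "(\<lambda>z. \<lambda>k\<in>{..<l}. u (Suc k) i a z) \<in> measurable P (PiM {..<l} (\<lambda>_. borel))"
    by (rule measurable_restrict) (use assms in \<open>auto intro: pg_measurable\<close>)
  from measurable_compose[OF this Fm_meas[of l]] show "A l i a \<in> borel_measurable P"
    unfolding A_eq[abs_def] using assms by simp
  show "\<bar>A l i a z\<bar> \<le> K" for z using abs_A_le assms by simp
qed

lemma pg_messages: "l \<le> L \<Longrightarrow> i \<in> V \<Longrightarrow> pg (w l i a) \<and> pg (zz l i a)"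
proof (induction l arbitrary: i a rule: less_induct)
  case (less l)
  have pw: "pg (w l i a)"
  proof (cases l)
    case 0
    then show ?thesis by (simp add: w_0[abs_def] pg_const)
  next
    case (Suc m)
    have "pg (zz m (vf b \<kappa>) b)" if "b \<in> nb i - {a}" "\<kappa> < r" "\<kappa> \<noteq> ix b i" for b \<kappa>
      using less.IH[of m "vf b \<kappa>" b] Suc less.prems branch_props[of b i \<kappa>] that by auto
    then have "pg (dm m b i)" if "b \<in> nb i - {a}" for b
      unfolding dm_def[abs_def] using that by (intro pg_multilinear)
    then have "pg (\<lambda>z. (\<Sum>b\<in>nb i - {a}. dm m b i z) / sqrt (real d - 1))"
      by (intro pg_divide pg_sum)
    then show ?thesis using Suc by (simp add: w_Suc[abs_def])
  qed
  have w: "pg (w s i a)" if "s \<le> l" for s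
    using less.IH[of s i a] less.prems pw that by (cases "s = l") auto
  have u: "pg (u s i a)" if s: "s \<le> l" for s
  proof (cases s)
    case 0
    then show ?thesis by (simp add: u_0[abs_def] pg_const)
  next
    case (Suc m)
    then show ?thesis using pg_diff[OF w[of "Suc m"] w[of m]] s by (simp add: u_eq[abs_def])
  qed
  have A: "pg (A s i a)" if s: "s < l" for s
    by (rule pg_A_aux) (use s u less.prems in auto)
  have "pg (\<lambda>z. z i + (\<Sum>s\<in>{1..l}. A (s - 1) i a z * u s i a z))"
    using less.prems by (intro pg_add pg_coord pg_sum pg_mult A u) auto
  then show ?case using pw by (simp add: zz_eq[abs_def])
qed

lemma pg_w: "l \<le> L \<Longrightarrow> i \<in> V \<Longrightarrow> pg (w l i a)"
  and pg_zz: "l \<le> L \<Longrightarrow> i \<in> V \<Longrightarrow> pg (zz l i a)"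
  using pg_messages by blast+

lemma pg_u: "l \<le> L \<Longrightarrow> i \<in> V \<Longrightarrow> pg (u l i a)"
  by (cases l) (auto simp: u_0[abs_def] u_eq[abs_def] intro!: pg_const pg_diff pg_w)

lemma pg_A: "l < L \<Longrightarrow> i \<in> V \<Longrightarrow> pg (A l i a)"
  by (rule pg_A_aux) (auto intro: pg_u)

lemma pg_zp: "l \<le> L \<Longrightarrow> i \<in> V \<Longrightarrow> pg (zp l i a)"
  by (cases l) (auto simp: zp_0[abs_def] zp_Suc[abs_def] intro!: pg_const pg_zz)

lemma pg_dm: "l \<le> L \<Longrightarrow> b \<in> nb i \<Longrightarrow> pg (dm l b i)"
  unfolding dm_def[abs_def] by (intro pg_multilinear pg_zz branch_props)

lemma pg_dp: "l \<le> L \<Longrightarrow> b \<in> nb i \<Longrightarrow> pg (dp l b i)"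
  unfolding dp_def[abs_def] by (intro pg_multilinear pg_zp branch_props)

lemma pg_Y: "l \<le> L \<Longrightarrow> b \<in> nb i \<Longrightarrow> pg (Y l b i)"
  unfolding Y_def[abs_def] by (intro pg_diff pg_dm pg_dp)

end

subsection \<open>Conditional means\<close>

declare leaf.simps(2) [simp del]

context amp
begin

text \<open>The part of the tree at \<open>i\<close> that hangs below the factor \<open>b\<close>;
  these parts are disjoint for different factors.\<close>

definition "bs m b i = (\<Union>\<kappa>\<in>{..<r} - {ix b i}. cn m (vf b \<kappa>) b)"

lemma cn_disjoint:
  assumes "m < L" "b \<in> nb i"
  shows "disjoint_family_on (\<lambda>\<kappa>. cn m (vf b \<kappa>) b) ({..<r} - {ix b i})"
  unfolding disjoint_family_on_def
proof (intro ballI impI)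
  fix \<kappa> \<kappa>' assume k: "\<kappa> \<in> {..<r} - {ix b i}" "\<kappa>' \<in> {..<r} - {ix b i}" "\<kappa> \<noteq> \<kappa>'"
  have "vf b \<kappa> \<noteq> vf b \<kappa>'" using vf_inj[OF nb_Fs[OF assms(2)]] k by (auto dest: inj_onD)
  then show "cn m (vf b \<kappa>) b \<inter> cn m (vf b \<kappa>') b = {}"
    using branch_props[OF assms(2), of \<kappa>] branch_props[OF assms(2), of \<kappa>'] k assms
    by (intro cone_branch_disjoint[OF girth, of m b i]) auto
qed

lemma bs_disjoint:
  assumes "m < L"
  shows "disjoint_family_on (\<lambda>b. bs m b i) (nb i)"
  unfolding disjoint_family_on_def
proof (intro ballI impI)
  fix b b' assume b: "b \<in> nb i" "b' \<in> nb i" "b \<noteq> b'"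
  have "cn m (vf b \<kappa>) b \<inter> cn m (vf b' \<kappa>') b' = {}"
    if k: "\<kappa> \<in> {..<r} - {ix b i}" "\<kappa>' \<in> {..<r} - {ix b' i}" for \<kappa> \<kappa>'
    using branch_props[OF b(1), of \<kappa>] branch_props[OF b(2), of \<kappa>'] k assms b
    by (intro cone_branch_disjoint[OF girth, of m b i]) auto
  then show "bs m b i \<inter> bs m b' i = {}" unfolding bs_def by blast
qed

lemma bs_V: "b \<in> nb i \<Longrightarrow> bs m b i \<subseteq> V"
  unfolding bs_def using cn_V branch_props(1) by blast

lemma cn_branch_V: "b \<in> nb i \<Longrightarrow> \<kappa> \<in> {..<r} - {ix b i} \<Longrightarrow> cn m (vf b \<kappa>) b \<subseteq> V"
  using cn_V branch_props(1) by blast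

lemma lf_cn_branch:
  assumes "m < L" "b \<in> nb i - {a}" "\<kappa> \<in> {..<r} - {ix b i}"
  shows "lf (Suc m) i a \<inter> cn m (vf b \<kappa>) b = lf m (vf b \<kappa>) b"
  using branch_props[of b i \<kappa>] assms by (intro leaf_cone_branch[OF girth]) auto

lemma dep_multilinear:
  assumes "\<And>\<kappa>. \<kappa> \<in> {..<r} - {\<iota>} \<Longrightarrow> dep D (X \<kappa>)"
  shows "dep D (\<lambda>z. \<Sum>S\<in>Fam r \<iota>. c S * (\<Prod>\<kappa>\<in>S - {\<iota>}. X \<kappa> z))"
proof (rule dep_sum)
  fix S assume S: "S \<in> Fam r \<iota>"
  have "dep D (\<lambda>z. \<Prod>\<kappa>\<in>S - {\<iota>}. X \<kappa> z)"
    by (intro dep_prod assms) (use Fam_mem[OF S] in blast)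
  then show "dep D (\<lambda>z. c S * (\<Prod>\<kappa>\<in>S - {\<iota>}. X \<kappa> z))" by (rule dep_compose[where F = "\<lambda>x. c S * x"])
qed

lemma dep_dm: "dep (bs m b i) (dm m b i)"
  unfolding dm_def[abs_def] bs_def by (rule dep_multilinear, rule dep_mono[OF dep_zz]) blast

lemma dep_dp: "m \<le> L \<Longrightarrow> dep (bs m b i) (dp m b i)"
  unfolding dp_def[abs_def] bs_def by (rule dep_multilinear, rule dep_mono[OF dep_zp]) blast+

text \<open>The leaves of the whole tree meet the cone of a slot exactly in the slot's own leaves,
  on which \<open>zp\<close> does not depend.\<close>

lemma dep_dp':
  assumes "m < L" "b \<in> nb i - {a}"
  shows "dep (bs m b i - lf (Suc m) i a) (dp m b i)"
  unfolding dp_def[abs_def]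
proof (rule dep_multilinear, rule dep_mono[OF dep_zp])
  fix \<kappa> assume k: "\<kappa> \<in> {..<r} - {ix b i}"
  show "cn m (vf b \<kappa>) b - lf m (vf b \<kappa>) b \<subseteq> bs m b i - lf (Suc m) i a"
    using lf_cn_branch[OF assms k] k unfolding bs_def by blast
qed (use assms in simp)

lemma dep_Y: "m \<le> L \<Longrightarrow> dep (bs m b i) (Y m b i)"
  unfolding Y_def[abs_def] by (rule dep_compose2[OF dep_dm dep_dp])

text \<open>The slots of a factor carry functions of disjoint cones, so the conditional mean of a
  monomial is the product of conditional means, and \<open>IH\<close> lowers each of them by one
  level.\<close>

lemma CE_dm_aux:
  assumes m: "m < L" and b: "b \<in> nb i - {a}" and z: "z \<in> space P"
    and IH: "\<And>j c. j \<in> V \<Longrightarrow> CE (lf m j c) (zz m j c) z = zp m j c z"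
  shows "CE (lf (Suc m) i a) (dm m b i) z = dp m b i z"
proof -
  let ?T = "{..<r} - {ix b i}" and ?\<Lambda> = "lf (Suc m) i a"
  have b': "b \<in> nb i" using b by simp
  have pz: "pg (zz m (vf b \<kappa>) b)" if "\<kappa> \<in> ?T" for \<kappa>
    using that m branch_props(1)[OF b'] by (intro pg_zz) auto
  have 1: "CE ?\<Lambda> (\<lambda>z. \<Prod>\<kappa>\<in>S - {ix b i}. zz m (vf b \<kappa>) b z) z = (\<Prod>\<kappa>\<in>S - {ix b i}. zp m (vf b \<kappa>) b z)"
    and 2: "pg (\<lambda>z. \<Prod>\<kappa>\<in>S - {ix b i}. zz m (vf b \<kappa>) b z)" if S: "S \<in> Fam r (ix b i)" for S
  proof -
    have sub: "S - {ix b i} \<subseteq> ?T" using S by (auto simp: Fam_def)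
    have fin: "finite (S - {ix b i})" using sub finite_subset by blast
    show "pg (\<lambda>z. \<Prod>\<kappa>\<in>S - {ix b i}. zz m (vf b \<kappa>) b z)" using sub by (intro pg_prod pz) blast
    have "CE ?\<Lambda> (\<lambda>z. \<Prod>\<kappa>\<in>S - {ix b i}. zz m (vf b \<kappa>) b z) z = (\<Prod>\<kappa>\<in>S - {ix b i}. CE ?\<Lambda> (zz m (vf b \<kappa>) b) z)"
    proof (rule CE_prod_dep[OF fin _ dep_zz _ _ z])
      show "disjoint_family_on (\<lambda>\<kappa>. cn m (vf b \<kappa>) b) (S - {ix b i})"
        by (rule disjoint_family_on_mono[OF sub cn_disjoint[OF m b']])
      show "pg (zz m (vf b \<kappa>) b)" "cn m (vf b \<kappa>) b \<subseteq> V" if "\<kappa> \<in> S - {ix b i}" for \<kappa>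
        using that sub pz cn_branch_V[OF b'] by blast+
    qed
    also have "\<dots> = (\<Prod>\<kappa>\<in>S - {ix b i}. zp m (vf b \<kappa>) b z)"
    proof (rule prod.cong[OF refl])
      fix \<kappa> assume "\<kappa> \<in> S - {ix b i}"
      then have k: "\<kappa> \<in> ?T" using sub by blast
      have "CE ?\<Lambda> (zz m (vf b \<kappa>) b) z = CE (lf m (vf b \<kappa>) b) (zz m (vf b \<kappa>) b) z"
        by (rule CE_cong_set[OF dep_zz]) (use lf_cn_branch[OF m b k] leaf_subset_cone in blast)
      then show "CE ?\<Lambda> (zz m (vf b \<kappa>) b) z = zp m (vf b \<kappa>) b z"
        using IH branch_props(1)[OF b', of \<kappa>] k by auto
    qed
    finally show "CE ?\<Lambda> (\<lambda>z. \<Prod>\<kappa>\<in>S - {ix b i}. zz m (vf b \<kappa>) b z) z = (\<Prod>\<kappa>\<in>S - {ix b i}. zp m (vf b \<kappa>) b z)" .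
  qed
  show ?thesis
    unfolding dm_def[abs_def] dp_def
    by (subst CE_sum[OF pg_mult[OF pg_const 2] z]) (auto intro!: sum.cong simp: CE_cmult 1)
qed

lemma CE_Y_aux:
  assumes m: "m < L" and b: "b \<in> nb i - {a}" and z: "z \<in> space P"
    and IH: "\<And>j c. j \<in> V \<Longrightarrow> CE (lf m j c) (zz m j c) z = zp m j c z"
  shows "CE (lf (Suc m) i a) (Y m b i) z = 0"
proof -
  have b': "b \<in> nb i" using b by simp
  have "CE (lf (Suc m) i a) (Y m b i) z = CE (lf (Suc m) i a) (dm m b i) z - CE (lf (Suc m) i a) (dp m b i) z"
    unfolding Y_def[abs_def] using m by (intro CE_diff pg_dm pg_dp b' z) auto
  also have "CE (lf (Suc m) i a) (dp m b i) z = dp m b i z"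
    by (rule CE_dep[OF dep_dp'[OF m b]]) blast
  finally show ?thesis using CE_dm_aux[OF m b z IH] by simp
qed

lemma CE_zero_u_aux:
  assumes m: "m < L" and i: "i \<in> V" and z: "z \<in> space P"
    and IH: "\<And>j c. j \<in> V \<Longrightarrow> CE (lf m j c) (zz m j c) z = zp m j c z"
  shows "CE (lf (Suc m) i a) (u (Suc m) i a) z = 0"
  unfolding u_Suc[abs_def] CE_divide using m
  by (subst CE_sum[OF pg_Y z]) (auto simp: CE_Y_aux[OF m _ z IH])

text \<open>\<open>A\<close> is fixed outside the new leaves, so the increment \<open>A * u\<close>
  has conditional mean zero once every \<open>Y\<close> has, and that is the same property for the
  neighbours one level below. The base case is the centring of the initial Gaussian.\<close>

lemma CE_zz: "l \<le> L \<Longrightarrow> i \<in> V \<Longrightarrow> z \<in> space P \<Longrightarrow> CE (lf l i a) (zz l i a) z = zp l i a z"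
proof (induction l arbitrary: i a)
  case 0
  have "(\<integral>x. normal_density 0 (sqrt \<delta>) x * x \<partial>lborel) = 0"
    using integral_normal_moment_nz_1[of "sqrt \<delta>" 0] dpos by simp
  then have "(\<integral>x. x \<partial>N) = 0" by (subst integral_density) auto
  moreover have m: "(\<lambda>y. y i) \<in> measurable P N"
    using measurable_coord[OF 0(2)] by (simp cong: measurable_cong_sets)
  have "(\<integral>x. x \<partial>N) = (\<integral>y. y i \<partial>P)"
    by (subst distr_coord[OF 0(2), symmetric], subst integral_distr[OF m]) auto
  ultimately show ?case by (simp add: zz_0[abs_def] zp_0 CE_def rs_def)
next
  case (Suc m)
  have m: "m < L" using Suc.prems by simp
  have u0: "CE (lf (Suc m) i a) (u (Suc m) i a) z = 0"
    using Suc m by (intro CE_zero_u_aux Suc.IH) auto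
  have "CE (lf (Suc m) i a) (zz (Suc m) i a) z
      = CE (lf (Suc m) i a) (zz m i a) z + CE (lf (Suc m) i a) (\<lambda>z. A m i a z * u (Suc m) i a z) z"
    unfolding zz_Suc[abs_def] using m Suc.prems
    by (intro CE_add pg_zz pg_mult pg_A pg_u) auto
  also have "CE (lf (Suc m) i a) (zz m i a) z = zz m i a z"
    by (rule CE_dep[OF dep_zz cn_lf_disjoint[OF m]])
  also have "CE (lf (Suc m) i a) (\<lambda>z. A m i a z * u (Suc m) i a z) z = 0"
    by (subst CE_take_out[OF dep_A cn_lf_disjoint[OF m]]) (simp add: u0)
  finally show ?case by (simp add: zp_Suc)
qed

lemma CE_u: "l < L \<Longrightarrow> i \<in> V \<Longrightarrow> z \<in> space P \<Longrightarrow> CE (lf (Suc l) i a) (u (Suc l) i a) z = 0"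
  by (rule CE_zero_u_aux) (auto intro: CE_zz)

lemma CE_dm: "m < L \<Longrightarrow> b \<in> nb i - {a} \<Longrightarrow> z \<in> space P \<Longrightarrow> CE (lf (Suc m) i a) (dm m b i) z = dp m b i z"
  by (rule CE_dm_aux) (auto intro: CE_zz)

lemma CE_Y: "m < L \<Longrightarrow> b \<in> nb i - {a} \<Longrightarrow> z \<in> space P \<Longrightarrow> CE (lf (Suc m) i a) (Y m b i) z = 0"
  by (rule CE_Y_aux) (auto intro: CE_zz)

lemma mean_zz: "l \<le> L \<Longrightarrow> i \<in> V \<Longrightarrow> (\<integral>z. zz l i a z \<partial>P) = 0"
proof (induction l)
  case 0
  have "(\<integral>z. zz 0 i a z \<partial>P) = (\<integral>z. CE (lf 0 i a) (zz 0 i a) z \<partial>P)"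
    using 0 by (intro expectation_CE[symmetric] pg_zz)
  also have "\<dots> = (\<integral>z. zp 0 i a z \<partial>P)"
    using 0 by (intro Bochner_Integration.integral_cong refl CE_zz)
  finally show ?case by (simp add: zp_0)
next
  case (Suc l)
  have "(\<integral>z. zz (Suc l) i a z \<partial>P) = (\<integral>z. CE (lf (Suc l) i a) (zz (Suc l) i a) z \<partial>P)"
    using Suc by (intro expectation_CE[symmetric] pg_zz)
  also have "\<dots> = (\<integral>z. zp (Suc l) i a z \<partial>P)"
    using Suc by (intro Bochner_Integration.integral_cong refl CE_zz)
  finally show ?case using Suc by (simp add: zp_Suc)
qed

lemma mean_zp: "l \<le> L \<Longrightarrow> i \<in> V \<Longrightarrow> (\<integral>z. zp l i a z \<partial>P) = 0"
  by (cases l) (auto simp: zp_0 zp_Suc mean_zz)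

lemma mean_Y: assumes "m < L" "b \<in> nb i - {a}" shows "(\<integral>z. Y m b i z \<partial>P) = 0"
proof -
  have "(\<integral>z. Y m b i z \<partial>P) = (\<integral>z. CE (lf (Suc m) i a) (Y m b i) z \<partial>P)"
    using assms by (intro expectation_CE[symmetric] pg_Y) auto
  also have "\<dots> = (\<integral>z. 0 \<partial>P)"
    using assms by (intro Bochner_Integration.integral_cong refl CE_Y)
  finally show ?thesis by simp
qed

subsection \<open>Second moments\<close>

lemma inj_Fam: "inj_on (\<lambda>S. S - {\<iota>}) (Fam r \<iota>)"
  unfolding Fam_def inj_on_def by blast

lemma second_moment_form:
  assumes m: "m < L" and b: "b \<in> nb i"
    and X: "\<And>\<kappa>. \<kappa> \<in> {..<r} - {ix b i} \<Longrightarrow> pg (X \<kappa>) \<and> dep (cn m (vf b \<kappa>) b) (X \<kappa>) \<and> (\<integral>z. X \<kappa> z \<partial>P) = 0"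
  shows "(\<integral>z. (\<Sum>S\<in>Fam r (ix b i). c S * (\<Prod>\<kappa>\<in>S - {ix b i}. X \<kappa> z))\<^sup>2 \<partial>P)
     = (\<Sum>S\<in>Fam r (ix b i). (c S)\<^sup>2 * (\<Prod>\<kappa>\<in>S - {ix b i}. \<integral>z. (X \<kappa> z)\<^sup>2 \<partial>P))"
  by (rule multilinear_second_moment[where T = "{..<r} - {ix b i}" and D = "\<lambda>\<kappa>. cn m (vf b \<kappa>) b"])
    (use X cn_branch_V[OF b] cn_disjoint[OF m b] in \<open>auto simp: finite_Fam inj_Fam dest: Fam_mem\<close>)

lemma second_moment_dm:
  assumes m: "m < L" and b: "b \<in> nb i"
  shows "(\<integral>z. (dm m b i z)\<^sup>2 \<partial>P)
     = (\<Sum>S\<in>Fam r (ix b i). (fourier r f S)\<^sup>2 * (\<Prod>\<kappa>\<in>S - {ix b i}. \<integral>z. (zz m (vf b \<kappa>) b z)\<^sup>2 \<partial>P))"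
  unfolding dm_def
  by (rule second_moment_form[OF m b]) (use m branch_props(1)[OF b] in \<open>auto intro!: pg_zz dep_zz mean_zz\<close>)

lemma second_moment_dp:
  assumes m: "m < L" and b: "b \<in> nb i"
  shows "(\<integral>z. (dp m b i z)\<^sup>2 \<partial>P)
     = (\<Sum>S\<in>Fam r (ix b i). (fourier r f S)\<^sup>2 * (\<Prod>\<kappa>\<in>S - {ix b i}. \<integral>z. (zp m (vf b \<kappa>) b z)\<^sup>2 \<partial>P))"
  unfolding dp_def
  by (rule second_moment_form[OF m b])
    (use m branch_props(1)[OF b] in \<open>auto intro!: pg_zp dep_mono[OF dep_zp Diff_subset] mean_zp\<close>)

text \<open>Pythagoras for martingale differences: conditioning on the coordinates outside the
  leaves replaces \<open>dm\<close> by \<open>dp\<close> in the mixed term.\<close>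

lemma second_moment_Y:
  assumes m: "m < L" and b: "b \<in> nb i - {a}"
  shows "(\<integral>z. (Y m b i z)\<^sup>2 \<partial>P) = (\<integral>z. (dm m b i z)\<^sup>2 \<partial>P) - (\<integral>z. (dp m b i z)\<^sup>2 \<partial>P)"
proof -
  let ?\<Lambda> = "lf (Suc m) i a"
  have b': "b \<in> nb i" and m': "m \<le> L" using b m by auto
  note pg = pg_dm[OF m' b'] pg_dp[OF m' b']
  note int = pg_integrable[OF pg_power[OF pg(1), of 2]] pg_integrable[OF pg_power[OF pg(2), of 2]]
    pg_integrable[OF pg_mult[OF pg(2) pg(1)]]
  have "(\<integral>z. dp m b i z * dm m b i z \<partial>P) = (\<integral>z. CE ?\<Lambda> (\<lambda>z. dp m b i z * dm m b i z) z \<partial>P)"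
    by (rule expectation_CE[OF pg_mult[OF pg(2) pg(1)], symmetric])
  also have "\<dots> = (\<integral>z. (dp m b i z)\<^sup>2 \<partial>P)"
  proof (rule Bochner_Integration.integral_cong[OF refl])
    fix z assume z: "z \<in> space P"
    have "(bs m b i - ?\<Lambda>) \<inter> ?\<Lambda> = {}" by blast
    from CE_take_out[OF dep_dp'[OF m b] this, of "dm m b i" z]
    show "CE ?\<Lambda> (\<lambda>z. dp m b i z * dm m b i z) z = (dp m b i z)\<^sup>2"
      using CE_dm[OF m b z] by (simp add: power2_eq_square)
  qed
  finally have c: "(\<integral>z. dp m b i z * dm m b i z \<partial>P) = (\<integral>z. (dp m b i z)\<^sup>2 \<partial>P)" .
  have "(\<integral>z. (Y m b i z)\<^sup>2 \<partial>P) = (\<integral>z. (dm m b i z)\<^sup>2 + (dp m b i z)\<^sup>2 - 2 * (dp m b i z * dm m b i z) \<partial>P)"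
    by (simp add: Y_def power2_diff mult_ac)
  also have "\<dots> = (\<integral>z. (dm m b i z)\<^sup>2 \<partial>P) + (\<integral>z. (dp m b i z)\<^sup>2 \<partial>P) - 2 * (\<integral>z. dp m b i z * dm m b i z \<partial>P)"
    using int by simp
  finally show ?thesis using c by simp
qed

text \<open>As u has conditional mean zero, this is its conditional variance given the coordinates
  outside the leaves; \<open>sg\<close> below is the same for the summand of one factor.\<close>

definition "V2 l i a = CE (lf l i a) (\<lambda>z. (u l i a z)\<^sup>2)"

definition "sg m b i a = CE (lf (Suc m) i a) (\<lambda>z. (Y m b i z)\<^sup>2)"

lemma pg_V2: "l \<le> L \<Longrightarrow> i \<in> V \<Longrightarrow> pg (V2 l i a)"
  unfolding V2_def by (intro pg_CE pg_power pg_u)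

lemma V2_eq:
  assumes m: "m < L" and i: "i \<in> V" and z: "z \<in> space P" and d: "d \<ge> 1"
  shows "V2 (Suc m) i a z = (\<Sum>b\<in>nb i - {a}. sg m b i a z) / (real d - 1)"
proof -
  have "CE (lf (Suc m) i a) (\<lambda>z. (\<Sum>b\<in>nb i - {a}. Y m b i z)\<^sup>2) z = (\<Sum>b\<in>nb i - {a}. sg m b i a z)"
    unfolding sg_def
  proof (rule CE_square_sum[where D = "\<lambda>b. bs m b i"])
    show "disjoint_family_on (\<lambda>b. bs m b i) (nb i - {a})"
      by (rule disjoint_family_on_mono[OF Diff_subset bs_disjoint[OF m]])
    show "finite (nb i - {a})" using finite_nb by simp
  qed (use m z in \<open>auto intro!: pg_Y dep_Y CE_Y dest: bs_V[THEN subsetD]\<close>)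
  then show ?thesis
    unfolding V2_def u_Suc power_divide CE_divide using d by simp
qed

text \<open>In the square of \<open>zz + A * u\<close> the mixed term vanishes by conditioning. In
  the last term \<open>A\<close> is fixed outside the leaves, so conditioning turns the square of u
  into \<open>V2\<close>.\<close>

lemma second_moment_zz_Suc:
  assumes m: "m < L" and i: "i \<in> V"
  shows "(\<integral>z. (zz (Suc m) i a z)\<^sup>2 \<partial>P) = (\<integral>z. (zz m i a z)\<^sup>2 \<partial>P) + (\<integral>z. (A m i a z)\<^sup>2 * V2 (Suc m) i a z \<partial>P)"
proof -
  let ?\<Lambda> = "lf (Suc m) i a"
  have pz: "pg (zz m i a)" and pA: "pg (A m i a)" and pu: "pg (u (Suc m) i a)"
    using m i by (auto intro: pg_zz pg_A pg_u)
  have pzA: "pg (\<lambda>z. zz m i a z * A m i a z)" by (rule pg_mult[OF pz pA])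
  have "(\<integral>z. (zz m i a z * A m i a z) * u (Suc m) i a z \<partial>P) = (\<integral>z. CE ?\<Lambda> (\<lambda>z. (zz m i a z * A m i a z) * u (Suc m) i a z) z \<partial>P)"
    by (rule expectation_CE[OF pg_mult[OF pzA pu], symmetric])
  also have "\<dots> = (\<integral>z. 0 \<partial>P)"
  proof (rule Bochner_Integration.integral_cong[OF refl])
    fix z assume z: "z \<in> space P"
    show "CE ?\<Lambda> (\<lambda>z. (zz m i a z * A m i a z) * u (Suc m) i a z) z = 0"
      by (subst CE_take_out[OF dep_compose2[OF dep_zz dep_A] cn_lf_disjoint[OF m]])
        (simp add: CE_u[OF m i z])
  qed
  finally have c: "(\<integral>z. (zz m i a z * A m i a z) * u (Suc m) i a z \<partial>P) = 0" by simp
  have pA2: "pg (\<lambda>z. (A m i a z)\<^sup>2)" and pu2: "pg (\<lambda>z. (u (Suc m) i a z)\<^sup>2)" by (intro pg_power pA pu)+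
  have "(\<integral>z. (A m i a z)\<^sup>2 * (u (Suc m) i a z)\<^sup>2 \<partial>P) = (\<integral>z. CE ?\<Lambda> (\<lambda>z. (A m i a z)\<^sup>2 * (u (Suc m) i a z)\<^sup>2) z \<partial>P)"
    by (rule expectation_CE[OF pg_mult[OF pA2 pu2], symmetric])
  also have "\<dots> = (\<integral>z. (A m i a z)\<^sup>2 * V2 (Suc m) i a z \<partial>P)"
    unfolding V2_def
    by (intro Bochner_Integration.integral_cong refl CE_take_out[OF dep_compose[OF dep_A, where F = "\<lambda>x. x\<^sup>2"] cn_lf_disjoint[OF m]])
  finally have e: "(\<integral>z. (A m i a z)\<^sup>2 * (u (Suc m) i a z)\<^sup>2 \<partial>P) = (\<integral>z. (A m i a z)\<^sup>2 * V2 (Suc m) i a z \<partial>P)" .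
  have "(\<integral>z. (zz (Suc m) i a z)\<^sup>2 \<partial>P) = (\<integral>z. (zz m i a z)\<^sup>2 + (A m i a z)\<^sup>2 * (u (Suc m) i a z)\<^sup>2
      + 2 * ((zz m i a z * A m i a z) * u (Suc m) i a z) \<partial>P)"
    by (simp add: zz_Suc power2_sum power_mult_distrib mult_ac)
  also have "\<dots> = (\<integral>z. (zz m i a z)\<^sup>2 \<partial>P) + (\<integral>z. (A m i a z)\<^sup>2 * (u (Suc m) i a z)\<^sup>2 \<partial>P)
      + 2 * (\<integral>z. (zz m i a z * A m i a z) * u (Suc m) i a z \<partial>P)"
    using pg_integrable[OF pg_power[OF pz, of 2]] pg_integrable[OF pg_mult[OF pA2 pu2]] pg_integrable[OF pg_mult[OF pzA pu]]
    by simp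
  finally show ?thesis using c e by simp
qed

lemma second_moment_zz_0:
  assumes i: "i \<in> V" shows "(\<integral>z. (zz 0 i a z)\<^sup>2 \<partial>P) = \<delta>"
proof -
  have m: "(\<lambda>y. y i) \<in> measurable P N"
    using measurable_coord[OF i] by (simp cong: measurable_cong_sets)
  have "(\<integral>x. normal_density 0 (sqrt \<delta>) x * x\<^sup>2 \<partial>lborel) = \<delta>"
    using integral_normal_moment_even[of "sqrt \<delta>" 0 1] dpos by simp
  then have "(\<integral>x. x\<^sup>2 \<partial>N) = \<delta>" by (subst integral_density) auto
  moreover have "(\<integral>x. x\<^sup>2 \<partial>N) = (\<integral>y. (y i)\<^sup>2 \<partial>P)"
    by (subst distr_coord[OF i, symmetric], subst integral_distr[OF m]) auto
  ultimately show ?thesis by (simp add: zz_0)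
qed

lemma second_moment_sg:
  assumes "m < L" "b \<in> nb i"
  shows "(\<integral>z. (sg m b i a z)\<^sup>2 \<partial>P) \<le> (\<integral>z. (Y m b i z)^4 \<partial>P)"
proof -
  have p2: "pg (\<lambda>z. (Y m b i z)\<^sup>2)" using assms by (intro pg_power pg_Y) auto
  have p4: "pg (\<lambda>z. ((Y m b i z)\<^sup>2)\<^sup>2)" by (rule pg_power[OF p2])
  have "(\<integral>z. (sg m b i a z)\<^sup>2 \<partial>P) \<le> (\<integral>z. CE (lf (Suc m) i a) (\<lambda>z. ((Y m b i z)\<^sup>2)\<^sup>2) z \<partial>P)"
    unfolding sg_def
    by (rule integral_mono[OF pg_integrable[OF pg_power[OF pg_CE[OF p2]]] pg_integrable[OF pg_CE[OF p4]] CE_jensen_sq[OF p2]])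
  also have "\<dots> = (\<integral>z. (Y m b i z)^4 \<partial>P)" by (subst expectation_CE[OF p4]) (simp add: power_mult[symmetric])
  finally show ?thesis .
qed

text \<open>\<open>V2\<close> is an average of independent terms \<open>sg\<close>, whose second
  moments are bounded through Jensen by fourth moments of \<open>Y\<close>; variances of independent
  terms add.\<close>

lemma V2_LLN:
  assumes m: "m < L" and i: "i \<in> V" and d: "d \<ge> 2"
  shows "(\<integral>z. (V2 (Suc m) i a z - (\<Sum>b\<in>nb i - {a}. \<integral>z. (Y m b i z)\<^sup>2 \<partial>P) / (real d - 1))\<^sup>2 \<partial>P)
     \<le> (\<Sum>b\<in>nb i - {a}. \<integral>z. (Y m b i z)^4 \<partial>P) / (real d - 1)\<^sup>2"
proof -
  have pY: "pg (\<lambda>z. (Y m b i z)\<^sup>2)" if "b \<in> nb i - {a}" for b using m that by (intro pg_power pg_Y) auto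
  have psg: "pg (sg m b i a)" if "b \<in> nb i - {a}" for b unfolding sg_def by (rule pg_CE[OF pY[OF that]])
  have dsg: "dep (bs m b i) (sg m b i a)" for b
    unfolding sg_def using m by (intro dep_mono[OF dep_CE[OF dep_compose[OF dep_Y, where F = "\<lambda>x. x\<^sup>2"]] Diff_subset]) simp
  have esg: "(\<integral>z. sg m b i a z \<partial>P) = (\<integral>z. (Y m b i z)\<^sup>2 \<partial>P)" if "b \<in> nb i - {a}" for b
    unfolding sg_def by (rule expectation_CE[OF pY[OF that]])
  have sq: "(\<integral>z. (sg m b i a z)\<^sup>2 \<partial>P) \<le> (\<integral>z. (Y m b i z)^4 \<partial>P)" if b: "b \<in> nb i - {a}" for b
    using m b by (intro second_moment_sg) auto
  let ?I = "nb i - {a}"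
  have dpos1: "(real d - 1)\<^sup>2 > 0" using d by simp
  have "(\<integral>z. (V2 (Suc m) i a z - (\<Sum>b\<in>?I. \<integral>z. (Y m b i z)\<^sup>2 \<partial>P) / (real d - 1))\<^sup>2 \<partial>P)
     = (\<integral>z. ((\<Sum>b\<in>?I. sg m b i a z) - (\<Sum>b\<in>?I. \<integral>z. sg m b i a z \<partial>P))\<^sup>2 / (real d - 1)\<^sup>2 \<partial>P)"
  proof (rule Bochner_Integration.integral_cong[OF refl])
    fix z assume z: "z \<in> space P"
    have e: "(\<Sum>b\<in>?I. \<integral>z. (Y m b i z)\<^sup>2 \<partial>P) = (\<Sum>b\<in>?I. \<integral>z. sg m b i a z \<partial>P)"
      by (rule sum.cong[OF refl]) (simp add: esg)
    show "(V2 (Suc m) i a z - (\<Sum>b\<in>?I. \<integral>z. (Y m b i z)\<^sup>2 \<partial>P) / (real d - 1))\<^sup>2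
       = ((\<Sum>b\<in>?I. sg m b i a z) - (\<Sum>b\<in>?I. \<integral>z. sg m b i a z \<partial>P))\<^sup>2 / (real d - 1)\<^sup>2"
      using V2_eq[OF m i z, of a] d by (simp add: e diff_divide_distrib[symmetric] power_divide)
  qed
  also have "\<dots> \<le> (\<Sum>b\<in>?I. \<integral>z. (sg m b i a z)\<^sup>2 \<partial>P) / (real d - 1)\<^sup>2"
  proof (subst integral_divide_zero, rule divide_right_mono)
    show "(\<integral>z. ((\<Sum>b\<in>?I. sg m b i a z) - (\<Sum>b\<in>?I. \<integral>z. sg m b i a z \<partial>P))\<^sup>2 \<partial>P) \<le> (\<Sum>b\<in>?I. \<integral>z. (sg m b i a z)\<^sup>2 \<partial>P)"
      by (rule variance_sum_le[where D = "\<lambda>b. bs m b i"])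
        (use finite_nb psg dsg bs_V disjoint_family_on_mono[OF Diff_subset bs_disjoint[OF m]] in auto)
  qed simp
  also have "\<dots> \<le> (\<Sum>b\<in>?I. \<integral>z. (Y m b i z)^4 \<partial>P) / (real d - 1)\<^sup>2"
    by (intro divide_right_mono sum_mono sq) auto
  finally show ?thesis .
qed

end

subsection \<open>Moment bounds\<close>

lemma abs_add_power_le:
  fixes a b :: real
  shows "\<bar>a + b\<bar> ^ n \<le> 2 ^ n * (\<bar>a\<bar> ^ n + \<bar>b\<bar> ^ n)"
proof -
  have "\<bar>a + b\<bar> ^ n \<le> (2 * max \<bar>a\<bar> \<bar>b\<bar>) ^ n" by (intro power_mono) auto
  also have "\<dots> = 2 ^ n * max \<bar>a\<bar> \<bar>b\<bar> ^ n" by (simp add: power_mult_distrib)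
  also have "max \<bar>a\<bar> \<bar>b\<bar> ^ n \<le> \<bar>a\<bar> ^ n + \<bar>b\<bar> ^ n" by (auto simp: max_def)
  finally show ?thesis by simp
qed

text \<open>In the binomial expansion the term linear in y is kept exactly, because it integrates to
  zero for an independent centred y. The terms of order at least 2 in y are dominated by the two
  extreme ones, according to which of the absolute values of s and y is larger.\<close>

lemma add_power_even_le:
  fixes s y :: real
  shows "(s + y) ^ (2 * k + 2) \<le> s ^ (2 * k + 2) + real (2 * k + 2) * (s ^ (2 * k + 1) * y)
     + 2 ^ (2 * k + 2) * (s ^ (2 * k) * y\<^sup>2 + y ^ (2 * k + 2))"
proof -
  define n where "n = 2 * k + 2"
  define R where "R = s ^ (2 * k) * y\<^sup>2 + y ^ n"
  have R1: "0 \<le> s ^ (2 * k) * y\<^sup>2" "0 \<le> y ^ n"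
    using zero_le_even_power[of "2 * k" s] zero_le_even_power[of n y] by (auto simp: n_def)
  then have R0: "R \<ge> 0" by (simp add: R_def)
  have t: "y ^ j * s ^ (n - j) \<le> R" if j: "j \<in> {2..n}" for j
  proof -
    have "y ^ j * s ^ (n - j) \<le> \<bar>y\<bar> ^ j * \<bar>s\<bar> ^ (n - j)"
      by (metis abs_ge_self abs_mult power_abs)
    also have "\<dots> \<le> R"
    proof (cases "\<bar>y\<bar> \<le> \<bar>s\<bar>")
      case True
      have "\<bar>y\<bar> ^ j * \<bar>s\<bar> ^ (n - j) = \<bar>y\<bar>\<^sup>2 * \<bar>y\<bar> ^ (j - 2) * \<bar>s\<bar> ^ (n - j)"
        using j by (metis atLeastAtMost_iff le_add_diff_inverse power_add)
      also have "\<dots> \<le> \<bar>y\<bar>\<^sup>2 * \<bar>s\<bar> ^ (j - 2) * \<bar>s\<bar> ^ (n - j)"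
        using True by (intro mult_right_mono mult_left_mono power_mono) auto
      also have "\<dots> = \<bar>y\<bar>\<^sup>2 * \<bar>s\<bar> ^ (2 * k)"
      proof -
        have e: "(j - 2) + (n - j) = 2 * k" using j by (auto simp: n_def)
        show ?thesis by (simp only: mult.assoc power_add[symmetric] e)
      qed
      also have "\<dots> = s ^ (2 * k) * y\<^sup>2" by (simp add: power_mult)
      finally show ?thesis using R1 unfolding R_def by linarith
    next
      case False
      have "\<bar>y\<bar> ^ j * \<bar>s\<bar> ^ (n - j) \<le> \<bar>y\<bar> ^ j * \<bar>y\<bar> ^ (n - j)"
        using False by (intro mult_left_mono power_mono) auto
      also have "\<dots> = y ^ n" using j by (simp add: power_add[symmetric] n_def power_even_abs)
      finally show ?thesis using R1 unfolding R_def by linarith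
    qed
    finally show ?thesis .
  qed
  have "(s + y) ^ n = (y + s) ^ n" by (simp add: add.commute)
  also have "\<dots> = (\<Sum>j\<le>n. real (n choose j) * y ^ j * s ^ (n - j))" by (rule binomial_ring)
  also have "{..n} = insert 0 (insert 1 {2..n})" by (auto simp: n_def)
  also have "(\<Sum>j\<in>\<dots>. real (n choose j) * y ^ j * s ^ (n - j))
      = s ^ n + real n * (s ^ (n - 1) * y) + (\<Sum>j\<in>{2..n}. real (n choose j) * (y ^ j * s ^ (n - j)))"
    by (simp add: mult_ac)
  also have "(\<Sum>j\<in>{2..n}. real (n choose j) * (y ^ j * s ^ (n - j))) \<le> (\<Sum>j\<in>{2..n}. real (n choose j) * R)"
    by (intro sum_mono mult_left_mono t) auto
  also have "\<dots> \<le> (\<Sum>j\<le>n. real (n choose j) * R)"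
    using R0 by (intro sum_mono2) auto
  also have "\<dots> = 2 ^ n * R"
    using choose_row_sum[of n] by (simp add: sum_distrib_right[symmetric] flip: of_nat_sum)
  finally show ?thesis by (simp add: n_def R_def)
qed

text \<open>The product is at most the n-th power of its largest factor, which is one of the
  summands on the right.\<close>

lemma prod_le_sum_power:
  fixes a :: "'k \<Rightarrow> real"
  assumes "finite T" "T \<noteq> {}" "card T \<le> n" "\<And>k. k \<in> T \<Longrightarrow> 1 \<le> a k"
  shows "(\<Prod>k\<in>T. a k) \<le> (\<Sum>k\<in>T. a k ^ n)"
proof -
  define m where "m = Max (a ` T)"
  have "m \<in> a ` T" unfolding m_def using assms by (intro Max_in) auto
  then obtain j where j: "j \<in> T" "m = a j" by auto
  have le: "a k \<le> m" if "k \<in> T" for k unfolding m_def using assms that by auto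
  have "(\<Prod>k\<in>T. a k) \<le> (\<Prod>k\<in>T. m)"
    by (intro prod_mono conjI le) (use assms(4) in force)
  also have "\<dots> = m ^ card T" by simp
  also have "\<dots> \<le> m ^ n" using assms j by (intro power_increasing) auto
  also have "\<dots> \<le> (\<Sum>k\<in>T. a k ^ n)"
    unfolding j(2) by (intro member_le_sum j assms) (use assms(4) in force)
  finally show ?thesis .
qed

text \<open>Constants for the moment of order 2k of a sum of independent centred terms; the
  recursion is read off from the remainder in \<open>add_power_even_le\<close>.\<close>

primrec cmom :: "nat \<Rightarrow> real" where
  "cmom 0 = 1"
| "cmom (Suc k) = 2 ^ (2 * k + 2) * (cmom k + 1)"

lemma cmom_nonneg: "0 \<le> cmom k"
  by (induction k) auto

context gauss
begin

lemma expectation_mult_dep: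
  assumes "pg g" "pg h" "dep D g" "dep D' h" "D \<subseteq> V" "D' \<subseteq> V" "D \<inter> D' = {}"
  shows "(\<integral>z. g z * h z \<partial>P) = (\<integral>z. g z \<partial>P) * (\<integral>z. h z \<partial>P)"
proof -
  obtain z where z: "z \<in> space P" using space_nonempty .
  show ?thesis using CE_mult_dep[OF assms z, of V] by (simp add: CE_V[OF z])
qed

text \<open>Outer induction on k, inner induction on the number of summands: one more summand
  increases the moment of order 2k + 2 by an amount governed by the moment of order 2k of the old
  sum, so the growth per step carries one power of the cardinality less.\<close>

lemma moment_sum:
  assumes M: "1 \<le> M"
  shows "finite I \<Longrightarrow> (\<And>b. b \<in> I \<Longrightarrow> pg (h b)) \<Longrightarrow> (\<And>b. b \<in> I \<Longrightarrow> dep (D b) (h b)) \<Longrightarrow>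
    (\<And>b. b \<in> I \<Longrightarrow> D b \<subseteq> V) \<Longrightarrow> disjoint_family_on D I \<Longrightarrow> (\<And>b. b \<in> I \<Longrightarrow> (\<integral>z. h b z \<partial>P) = 0) \<Longrightarrow>
    (\<And>b j. b \<in> I \<Longrightarrow> j \<le> k \<Longrightarrow> (\<integral>z. h b z ^ (2 * j) \<partial>P) \<le> M) \<Longrightarrow>
    (\<integral>z. (\<Sum>b\<in>I. h b z) ^ (2 * k) \<partial>P) \<le> cmom k * M ^ k * real (card I) ^ k"
proof (induction k arbitrary: I)
  case 0
  then show ?case by (simp add: P.prob_space)
next
  case (Suc k)
  note IHk = Suc.IH
  from Suc.prems show ?case
  proof (induction I rule: finite_induct)
    case empty
    then show ?case by simp
  next
    case (insert b I)
    define S where "S z = (\<Sum>b\<in>I. h b z)" for z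
    define c where "c = real (card I)"
    let ?n = "2 * k + 2"
    have pS: "pg S" unfolding S_def[abs_def] using insert.prems(1) by (intro pg_sum) auto
    have ph: "pg (h b)" using insert.prems by auto
    have dS: "dep (\<Union>b\<in>I. D b) S"
      unfolding S_def[abs_def] dep_def
      by (intro allI impI sum.cong refl depD[OF insert.prems(2)]) auto
    have dh: "dep (D b) (h b)" using insert.prems by auto
    have DV: "(\<Union>b\<in>I. D b) \<subseteq> V" "D b \<subseteq> V" using insert.prems(3) by auto
    have dj: "(\<Union>b\<in>I. D b) \<inter> D b = {}" using insert.prems(4) insert.hyps by (fastforce simp: disjoint_family_on_def)
    have dI: "disjoint_family_on D I" by (rule disjoint_family_on_mono[OF _ insert.prems(4)]) auto
    have hm: "(\<integral>z. h b z ^ (2 * j) \<partial>P) \<le> M" if "j \<le> Suc k" for j using insert.prems(6)[of b j] that by simp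
    have IH1: "(\<integral>z. S z ^ (2 * k) \<partial>P) \<le> cmom k * M ^ k * c ^ k"
      unfolding S_def c_def by (rule IHk) (use insert dI in auto)
    have IH2: "(\<integral>z. S z ^ ?n \<partial>P) \<le> cmom (Suc k) * M ^ Suc k * c ^ Suc k"
      using insert.IH insert.prems dI unfolding S_def c_def by simp
    have cross: "(\<integral>z. S z ^ p * h b z ^ q \<partial>P) = (\<integral>z. S z ^ p \<partial>P) * (\<integral>z. h b z ^ q \<partial>P)" for p q
      by (rule expectation_mult_dep[OF pg_power[OF pS] pg_power[OF ph]
            dep_compose[OF dS, where F = "\<lambda>x. x ^ p"] dep_compose[OF dh, where F = "\<lambda>x. x ^ q"] DV dj])
    have z1: "(\<integral>z. S z ^ (2 * k + 1) * h b z \<partial>P) = 0"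
      using cross[of "2 * k + 1" 1] insert.prems(5)[of b] by simp
    have ps: "pg (\<lambda>z. S z ^ ?n)" "pg (\<lambda>z. S z ^ (2 * k + 1) * h b z)" "pg (\<lambda>z. S z ^ (2 * k) * (h b z)\<^sup>2)" "pg (\<lambda>z. h b z ^ ?n)"
      by (intro pg_mult pg_power pS ph)+
    note int = ps[THEN pg_integrable]
    have "(\<integral>z. (\<Sum>b\<in>insert b I. h b z) ^ (2 * Suc k) \<partial>P) = (\<integral>z. (S z + h b z) ^ ?n \<partial>P)"
      using insert.hyps by (simp add: S_def add.commute)
    also have "\<dots> \<le> (\<integral>z. S z ^ ?n + real ?n * (S z ^ (2 * k + 1) * h b z)
         + 2 ^ ?n * (S z ^ (2 * k) * (h b z)\<^sup>2 + h b z ^ ?n) \<partial>P)"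
      by (intro integral_mono add_power_even_le pg_integrable[OF pg_power[OF pg_add[OF pS ph]]]
          Bochner_Integration.integrable_add integrable_mult_right int)
    also have "\<dots> = (\<integral>z. S z ^ ?n \<partial>P) + real ?n * (\<integral>z. S z ^ (2 * k + 1) * h b z \<partial>P)
         + 2 ^ ?n * ((\<integral>z. S z ^ (2 * k) * (h b z)\<^sup>2 \<partial>P) + (\<integral>z. h b z ^ ?n \<partial>P))"
      using int by simp
    also have "\<dots> = (\<integral>z. S z ^ ?n \<partial>P)
         + 2 ^ ?n * ((\<integral>z. S z ^ (2 * k) \<partial>P) * (\<integral>z. (h b z)\<^sup>2 \<partial>P) + (\<integral>z. h b z ^ ?n \<partial>P))"
      unfolding z1 cross by simp
    also have "\<dots> \<le> cmom (Suc k) * M ^ Suc k * c ^ Suc k + 2 ^ ?n * ((cmom k * M ^ k * c ^ k) * M + M)"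
    proof -
      have "(\<integral>z. S z ^ (2 * k) \<partial>P) * (\<integral>z. (h b z)\<^sup>2 \<partial>P) \<le> (cmom k * M ^ k * c ^ k) * M"
        using IH1 hm[of 1] cmom_nonneg[of k] M by (intro mult_mono) (auto simp: c_def)
      moreover have "(\<integral>z. h b z ^ ?n \<partial>P) \<le> M" using hm[of "Suc k"] by simp
      ultimately show ?thesis using IH2 by (intro add_mono mult_left_mono) auto
    qed
    \<comment> \<open>Both remainder terms are relaxed to multiples of
      \<open>M ^ Suc k * (c + 1) ^ k\<close>, so that the recursion of \<open>cmom\<close> collects
      them.\<close>
    also have "\<dots> \<le> cmom (Suc k) * M ^ Suc k * c ^ Suc k + 2 ^ ?n * ((cmom k * M ^ Suc k * (c + 1) ^ k) + M ^ Suc k * (c + 1) ^ k)"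
    proof (intro add_mono mult_left_mono order_refl)
      have c0: "0 \<le> c" by (simp add: c_def)
      have "c ^ k \<le> (c + 1) ^ k" using c0 by (intro power_mono) auto
      then have "cmom k * M ^ Suc k * c ^ k \<le> cmom k * M ^ Suc k * (c + 1) ^ k"
        using cmom_nonneg[of k] M by (intro mult_left_mono) auto
      then show "(cmom k * M ^ k * c ^ k) * M \<le> cmom k * M ^ Suc k * (c + 1) ^ k" by (simp add: mult_ac)
      have "M * 1 \<le> M ^ Suc k * (c + 1) ^ k"
      proof (rule mult_mono)
        show "M \<le> M ^ Suc k" using M one_le_power[OF M, of k] by (simp add: mult_le_cancel_left1)
        show "1 \<le> (c + 1) ^ k" using c0 by (intro one_le_power) simp
      qed (use M in auto)
      then show "M \<le> M ^ Suc k * (c + 1) ^ k" by simp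
    qed (use M cmom_nonneg[of k] in \<open>auto intro!: mult_nonneg_nonneg\<close>)
    also have "\<dots> = cmom (Suc k) * M ^ Suc k * (c * c ^ k + (c + 1) ^ k)"
      by (simp add: algebra_simps)
    also have "\<dots> \<le> cmom (Suc k) * M ^ Suc k * (c + 1) ^ Suc k"
    proof (rule mult_left_mono)
      have "c * c ^ k \<le> c * (c + 1) ^ k" by (intro mult_left_mono power_mono) (auto simp: c_def)
      then show "c * c ^ k + (c + 1) ^ k \<le> (c + 1) ^ Suc k" by (simp add: algebra_simps)
      show "0 \<le> cmom (Suc k) * M ^ Suc k" using cmom_nonneg[of "Suc k"] M by (intro mult_nonneg_nonneg) auto
    qed
    also have "c + 1 = real (card (insert b I))" using insert.hyps by (simp add: c_def)
    finally show ?case .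
  qed
qed

end

context amp
begin

section \<open>Moments of the messages in one hypergraph\<close>

definition "CF = (\<Sum>S\<in>Pow {..<r}. \<bar>fourier r f S\<bar>)"

text \<open>A monomial has fewer than r factors, so its power 2k is controlled by powers 2kr of
  single messages. The loss in the exponent is harmless because moments of all orders are bounded
  together.\<close>

lemma moment_multilinear:
  assumes i: "\<iota> < r" and X: "\<And>\<kappa>. \<kappa> \<in> {..<r} - {\<iota>} \<Longrightarrow> pg (X \<kappa>)"
    and B: "\<And>\<kappa>. \<kappa> \<in> {..<r} - {\<iota>} \<Longrightarrow> (\<integral>z. X \<kappa> z ^ (2 * (k * r)) \<partial>P) \<le> B" and B0: "0 \<le> B"
  shows "(\<integral>z. (\<Sum>S\<in>Fam r \<iota>. fourier r f S * (\<Prod>\<kappa>\<in>S - {\<iota>}. X \<kappa> z)) ^ (2 * k) \<partial>P)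
     \<le> CF ^ (2 * k) * (real r * (2 ^ (2 * (k * r)) * (1 + B)))"
proof -
  let ?T = "{..<r} - {\<iota>}"
  let ?g = "\<lambda>z. \<Sum>S\<in>Fam r \<iota>. fourier r f S * (\<Prod>\<kappa>\<in>S - {\<iota>}. X \<kappa> z)"
  have Tne: "?T \<noteq> {}"
  proof
    assume "?T = {}"
    then have "{..<r} \<subseteq> {\<iota>}" by blast
    then have "card {..<r} \<le> card {\<iota>}" by (intro card_mono) auto
    then show False using r2 by simp
  qed
  have Tc: "finite ?T" "card ?T \<le> r" using i by auto
  have pt: "?g z ^ (2 * k) \<le> CF ^ (2 * k) * (\<Sum>\<kappa>\<in>?T. 2 ^ (2 * (k * r)) * (1 + X \<kappa> z ^ (2 * (k * r))))" for z
  proof -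
    \<comment> \<open>Adding 1 makes every factor at least 1, so the product over any subset is
      below the product over all slots.\<close>
    define a where "a \<kappa> = 1 + \<bar>X \<kappa> z\<bar>" for \<kappa>
    have a1: "1 \<le> a \<kappa>" for \<kappa> by (simp add: a_def)
    have "\<bar>?g z\<bar> \<le> (\<Sum>S\<in>Fam r \<iota>. \<bar>fourier r f S * (\<Prod>\<kappa>\<in>S - {\<iota>}. X \<kappa> z)\<bar>)" by (rule sum_abs)
    also have "\<dots> \<le> (\<Sum>S\<in>Fam r \<iota>. \<bar>fourier r f S\<bar> * (\<Prod>\<kappa>\<in>?T. a \<kappa>))"
    proof (rule sum_mono)
      fix S assume S: "S \<in> Fam r \<iota>"
      have sub: "S - {\<iota>} \<subseteq> ?T" using S by (auto simp: Fam_def)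
      have "\<bar>\<Prod>\<kappa>\<in>S - {\<iota>}. X \<kappa> z\<bar> = (\<Prod>\<kappa>\<in>S - {\<iota>}. \<bar>X \<kappa> z\<bar>)" by (rule abs_prod)
      also have "\<dots> \<le> (\<Prod>\<kappa>\<in>S - {\<iota>}. a \<kappa>)" by (intro prod_mono) (auto simp: a_def)
      also have "\<dots> \<le> (\<Prod>\<kappa>\<in>?T. a \<kappa>)"
        by (rule prod_mono2[OF Tc(1) sub]) (use a1 in \<open>auto intro: order_trans[OF zero_le_one]\<close>)
      finally show "\<bar>fourier r f S * (\<Prod>\<kappa>\<in>S - {\<iota>}. X \<kappa> z)\<bar> \<le> \<bar>fourier r f S\<bar> * (\<Prod>\<kappa>\<in>?T. a \<kappa>)"
        unfolding abs_mult by (rule mult_left_mono) simp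
    qed
    also have "\<dots> = (\<Sum>S\<in>Fam r \<iota>. \<bar>fourier r f S\<bar>) * (\<Prod>\<kappa>\<in>?T. a \<kappa>)" by (rule sum_distrib_right[symmetric])
    also have "\<dots> \<le> CF * (\<Prod>\<kappa>\<in>?T. a \<kappa>)"
      unfolding CF_def
      by (intro mult_right_mono sum_mono2 prod_nonneg) (use a1 in \<open>auto simp: Fam_def intro: order_trans[OF zero_le_one]\<close>)
    finally have "\<bar>?g z\<bar> ^ (2 * k) \<le> (CF * (\<Prod>\<kappa>\<in>?T. a \<kappa>)) ^ (2 * k)" by (rule power_mono) simp
    also have "\<dots> = CF ^ (2 * k) * (\<Prod>\<kappa>\<in>?T. a \<kappa> ^ (2 * k))" by (simp add: power_mult_distrib prod_power_distrib)
    also have "\<dots> \<le> CF ^ (2 * k) * (\<Sum>\<kappa>\<in>?T. (a \<kappa> ^ (2 * k)) ^ r)"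
      by (intro mult_left_mono prod_le_sum_power Tc Tne one_le_power a1) simp
    also have "\<dots> \<le> CF ^ (2 * k) * (\<Sum>\<kappa>\<in>?T. 2 ^ (2 * (k * r)) * (1 + X \<kappa> z ^ (2 * (k * r))))"
    proof (intro mult_left_mono sum_mono)
      fix \<kappa> :: nat
      have "(a \<kappa> ^ (2 * k)) ^ r = \<bar>1 + \<bar>X \<kappa> z\<bar>\<bar> ^ (2 * (k * r))"
        by (simp add: a_def power_mult[symmetric] mult.assoc)
      also have "\<dots> \<le> 2 ^ (2 * (k * r)) * (\<bar>1\<bar> ^ (2 * (k * r)) + \<bar>\<bar>X \<kappa> z\<bar>\<bar> ^ (2 * (k * r)))"
        by (rule abs_add_power_le)
      finally show "(a \<kappa> ^ (2 * k)) ^ r \<le> 2 ^ (2 * (k * r)) * (1 + X \<kappa> z ^ (2 * (k * r)))"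
        by (simp add: power_even_abs)
    qed simp
    finally show ?thesis by (simp add: power_even_abs)
  qed
  have pX: "pg (\<lambda>z. 2 ^ (2 * (k * r)) * (1 + X \<kappa> z ^ (2 * (k * r))))" if "\<kappa> \<in> ?T" for \<kappa>
    by (intro pg_mult pg_add pg_const pg_power X that)
  have pg: "pg ?g" by (rule pg_multilinear) (use X in blast)
  have pR: "pg (\<lambda>z. CF ^ (2 * k) * (\<Sum>\<kappa>\<in>?T. 2 ^ (2 * (k * r)) * (1 + X \<kappa> z ^ (2 * (k * r)))))"
    by (rule pg_mult[OF pg_const pg_sum[OF pX]])
  have "(\<integral>z. ?g z ^ (2 * k) \<partial>P) \<le> (\<integral>z. CF ^ (2 * k) * (\<Sum>\<kappa>\<in>?T. 2 ^ (2 * (k * r)) * (1 + X \<kappa> z ^ (2 * (k * r)))) \<partial>P)"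
    by (rule integral_mono[OF pg_integrable[OF pg_power[OF pg]] pg_integrable[OF pR] pt])
  also have "\<dots> = CF ^ (2 * k) * (\<Sum>\<kappa>\<in>?T. \<integral>z. 2 ^ (2 * (k * r)) * (1 + X \<kappa> z ^ (2 * (k * r))) \<partial>P)"
    by (subst integral_mult_right_zero, subst Bochner_Integration.integral_sum) (use pX[THEN pg_integrable] in auto)
  also have "\<dots> \<le> CF ^ (2 * k) * (\<Sum>\<kappa>\<in>?T. 2 ^ (2 * (k * r)) * (1 + B))"
  proof (intro mult_left_mono sum_mono)
    fix \<kappa> assume k: "\<kappa> \<in> ?T"
    have "(\<integral>z. 2 ^ (2 * (k * r)) * (1 + X \<kappa> z ^ (2 * (k * r))) \<partial>P) = 2 ^ (2 * (k * r)) * (1 + (\<integral>z. X \<kappa> z ^ (2 * (k * r)) \<partial>P))"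
      using pg_integrable[OF pg_power[OF X[OF k], of "2 * (k * r)"]] by (simp add: P.prob_space)
    then show "(\<integral>z. 2 ^ (2 * (k * r)) * (1 + X \<kappa> z ^ (2 * (k * r))) \<partial>P) \<le> 2 ^ (2 * (k * r)) * (1 + B)"
      using B[OF k] by simp
  qed simp
  also have "\<dots> \<le> CF ^ (2 * k) * (real r * (2 ^ (2 * (k * r)) * (1 + B)))"
    using Tc B0 by (intro mult_left_mono) (auto intro!: mult_right_mono)
  finally show ?thesis .
qed

definition "CY k B = 2 ^ (2 * k) * (2 * (CF ^ (2 * k) * (real r * (2 ^ (2 * (k * r)) * (1 + B)))))"

lemma moment_Y:
  assumes m: "m < L" and b: "b \<in> nb i" and B0: "0 \<le> B"
    and B: "\<And>j c. j \<in> V \<Longrightarrow> c \<in> nb j \<Longrightarrow> (\<integral>z. zz m j c z ^ (2 * (k * r)) \<partial>P) \<le> B"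
    and B': "\<And>j c. j \<in> V \<Longrightarrow> c \<in> nb j \<Longrightarrow> (\<integral>z. zp m j c z ^ (2 * (k * r)) \<partial>P) \<le> B"
  shows "(\<integral>z. Y m b i z ^ (2 * k) \<partial>P) \<le> CY k B"
proof -
  have m': "m \<le> L" using m by simp
  have i: "ix b i < r" using idx_props[OF b] by simp
  have 1: "(\<integral>z. dm m b i z ^ (2 * k) \<partial>P) \<le> CF ^ (2 * k) * (real r * (2 ^ (2 * (k * r)) * (1 + B)))"
    unfolding dm_def by (rule moment_multilinear[OF i _ _ B0]) (use branch_props[OF b] m' in \<open>auto intro!: pg_zz B\<close>)
  have 2: "(\<integral>z. dp m b i z ^ (2 * k) \<partial>P) \<le> CF ^ (2 * k) * (real r * (2 ^ (2 * (k * r)) * (1 + B)))"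
    unfolding dp_def by (rule moment_multilinear[OF i _ _ B0]) (use branch_props[OF b] m' in \<open>auto intro!: pg_zp B'\<close>)
  note pgd = pg_power[OF pg_dm[OF m' b], of "2 * k"] pg_power[OF pg_dp[OF m' b], of "2 * k"]
  have "(\<integral>z. Y m b i z ^ (2 * k) \<partial>P) \<le> (\<integral>z. 2 ^ (2 * k) * (dm m b i z ^ (2 * k) + dp m b i z ^ (2 * k)) \<partial>P)"
  proof (rule integral_mono)
    show "integrable P (\<lambda>z. Y m b i z ^ (2 * k))" by (rule pg_integrable[OF pg_power[OF pg_Y[OF m' b]]])
    show "integrable P (\<lambda>z. 2 ^ (2 * k) * (dm m b i z ^ (2 * k) + dp m b i z ^ (2 * k)))"
      by (rule pg_integrable[OF pg_mult[OF pg_const pg_add[OF pgd]]])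
    show "Y m b i z ^ (2 * k) \<le> 2 ^ (2 * k) * (dm m b i z ^ (2 * k) + dp m b i z ^ (2 * k))" for z
      using abs_add_power_le[of "dm m b i z" "- dp m b i z" "2 * k"] by (simp add: Y_def power_even_abs)
  qed
  also have "\<dots> = 2 ^ (2 * k) * ((\<integral>z. dm m b i z ^ (2 * k) \<partial>P) + (\<integral>z. dp m b i z ^ (2 * k) \<partial>P))"
    using pgd[THEN pg_integrable] by simp
  also have "\<dots> \<le> CY k B" unfolding CY_def using 1 2 by (intro mult_left_mono) auto
  finally show ?thesis .
qed

lemma card_nb: "i \<in> V \<Longrightarrow> card (nb i) = d"
  using regular by (auto simp: index_regular_def)

text \<open>After removal of \<open>a\<close> there are d - 1 summands, which exactly cancels the
  normalisation.\<close>

lemma moment_u: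
  assumes m: "m < L" and i: "i \<in> V" and a: "a \<in> nb i" and d: "d \<ge> 2" and M: "1 \<le> M"
    and MY: "\<And>b j. b \<in> nb i \<Longrightarrow> j \<le> k \<Longrightarrow> (\<integral>z. Y m b i z ^ (2 * j) \<partial>P) \<le> M"
  shows "(\<integral>z. u (Suc m) i a z ^ (2 * k) \<partial>P) \<le> cmom k * M ^ k"
proof -
  let ?I = "nb i - {a}"
  have c: "real (card ?I) = real d - 1" using card_nb[OF i] a finite_nb d by (simp add: card_Diff_singleton of_nat_diff)
  have "(\<integral>z. (\<Sum>b\<in>?I. Y m b i z) ^ (2 * k) \<partial>P) \<le> cmom k * M ^ k * real (card ?I) ^ k"
    by (rule moment_sum[OF M, where D = "\<lambda>b. bs m b i"])
      (use m MY finite_nb bs_V disjoint_family_on_mono[OF Diff_subset bs_disjoint[OF m]] in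
        \<open>auto intro!: pg_Y dep_Y mean_Y[where a = a]\<close>)
  moreover have "(\<integral>z. u (Suc m) i a z ^ (2 * k) \<partial>P) = (\<integral>z. (\<Sum>b\<in>?I. Y m b i z) ^ (2 * k) \<partial>P) / (real d - 1) ^ k"
    unfolding u_Suc power_divide using d by (simp add: power_mult)
  ultimately show ?thesis using d by (simp add: c divide_le_eq)
qed

end

subsection \<open>Limiting variances\<close>

text \<open>The second moment of the partial derivative in slot \<iota> at independent centred
  inputs of variance s.\<close>

definition gS :: "nat \<Rightarrow> ((nat \<Rightarrow> real) \<Rightarrow> real) \<Rightarrow> nat \<Rightarrow> real \<Rightarrow> real" where
  "gS r f \<iota> s = (\<Sum>S\<in>Fam r \<iota>. (fourier r f S)\<^sup>2 * s ^ (card S - 1))"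

text \<open>The factor j produced by differentiation counts the slots in S; exchanging the sums
  distributes it over these slots.\<close>

lemma deriv_xi: "deriv (xi r f) s = (\<Sum>\<iota><r. gS r f \<iota> s)"
proof -
  let ?c = "\<lambda>j. \<Sum>S\<in>{S \<in> Pow {..<r}. card S = j}. (fourier r f S)\<^sup>2"
  let ?h = "\<lambda>S. real (card S) * ((fourier r f S)\<^sup>2 * s ^ (card S - 1))"
  have "(xi r f has_field_derivative (\<Sum>j=1..r. ?c j * (real j * s ^ (j - 1)))) (at s)"
    unfolding xi_def[abs_def] by (auto intro!: derivative_eq_intros sum.cong)
  then have "deriv (xi r f) s = (\<Sum>j=1..r. ?c j * (real j * s ^ (j - 1)))" by (rule DERIV_imp_deriv)
  also have "\<dots> = (\<Sum>j=1..r. \<Sum>S\<in>{S \<in> Pow {..<r}. card S = j}. ?h S)"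
    unfolding sum_distrib_right by (intro sum.cong refl) auto
  also have "\<dots> = (\<Sum>j\<in>{0..r}. \<Sum>S\<in>{S \<in> Pow {..<r}. card S = j}. ?h S)"
    by (rule sum.mono_neutral_left) (auto intro!: sum.neutral)
  also have "\<dots> = (\<Sum>S\<in>Pow {..<r}. ?h S)"
  proof (rule sum.group)
    show "card ` Pow {..<r} \<subseteq> {0..r}" using card_mono[of "{..<r}"] by auto
  qed auto
  also have "\<dots> = (\<Sum>S\<in>Pow {..<r}. \<Sum>\<iota><r. if \<iota> \<in> S then (fourier r f S)\<^sup>2 * s ^ (card S - 1) else 0)"
  proof (rule sum.cong[OF refl])
    fix S assume "S \<in> Pow {..<r}"
    then have "{..<r} \<inter> S = S" by auto
    then show "?h S = (\<Sum>\<iota><r. if \<iota> \<in> S then (fourier r f S)\<^sup>2 * s ^ (card S - 1) else 0)"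
      by (simp add: sum.inter_restrict[symmetric])
  qed
  also have "\<dots> = (\<Sum>\<iota><r. \<Sum>S\<in>Pow {..<r}. if \<iota> \<in> S then (fourier r f S)\<^sup>2 * s ^ (card S - 1) else 0)"
    by (rule sum.swap)
  also have "\<dots> = (\<Sum>\<iota><r. gS r f \<iota> s)"
    unfolding gS_def Fam_def by (intro sum.cong refl sum.mono_neutral_cong_right) auto
  finally show ?thesis .
qed

lemma nu_Suc: "nu r f \<delta> (Suc m) = (\<Sum>\<iota><r. gS r f \<iota> (real (Suc m) * \<delta>) - gS r f \<iota> (real m * \<delta>)) / real r"
  unfolding nu_def deriv_xi by (simp add: sum_subtractf)

text \<open>All summands are non-decreasing in s, and a set with at least two elements contributes a
  positive power, which is strictly increasing.\<close>

lemma nu_pos: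
  assumes "S \<subseteq> {..<r}" "fourier r f S \<noteq> 0" "2 \<le> card S" "0 < \<delta>"
  shows "0 < nu r f \<delta> (Suc m)"
proof -
  have mono: "gS r f \<iota> (real m * \<delta>) \<le> gS r f \<iota> (real (Suc m) * \<delta>)" for \<iota>
    unfolding gS_def using assms(4) by (intro sum_mono mult_left_mono power_mono) auto
  have fin: "finite S" using assms(1) finite_subset by blast
  obtain \<iota> where i: "\<iota> \<in> S" using assms(3) by fastforce
  have "gS r f \<iota> (real m * \<delta>) < gS r f \<iota> (real (Suc m) * \<delta>)"
    unfolding gS_def
  proof (rule sum_strict_mono_ex1)
    show "\<forall>T\<in>Fam r \<iota>. (fourier r f T)\<^sup>2 * (real m * \<delta>) ^ (card T - 1) \<le> (fourier r f T)\<^sup>2 * (real (Suc m) * \<delta>) ^ (card T - 1)"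
      using assms(4) by (intro ballI mult_left_mono power_mono) auto
    have "(real m * \<delta>) ^ (card S - 1) < (real (Suc m) * \<delta>) ^ (card S - 1)"
      using assms(3,4) by (intro power_strict_mono) auto
    then show "\<exists>T\<in>Fam r \<iota>. (fourier r f T)\<^sup>2 * (real m * \<delta>) ^ (card T - 1) < (fourier r f T)\<^sup>2 * (real (Suc m) * \<delta>) ^ (card T - 1)"
      using assms i by (intro bexI[of _ S]) (auto simp: Fam_def)
  qed (rule finite_Fam)
  then have "0 < (\<Sum>\<iota><r. gS r f \<iota> (real (Suc m) * \<delta>) - gS r f \<iota> (real m * \<delta>))"
    using i assms(1) mono by (intro sum_pos2[of _ \<iota>]) auto
  moreover have "0 < r" using i assms(1) by auto
  ultimately show ?thesis unfolding nu_Suc by simp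
qed

text \<open>One factor is exchanged at a time; \<open>\<epsilon> \<le> 1\<close> keeps each factor
  below s + 1 in absolute value.\<close>

lemma prod_close:
  fixes s \<epsilon> :: real
  assumes "finite T" "0 \<le> s" "\<epsilon> \<le> 1" "\<And>k. k \<in> T \<Longrightarrow> \<bar>a k - s\<bar> \<le> \<epsilon>" "0 \<le> \<epsilon>"
  shows "\<bar>(\<Prod>k\<in>T. a k) - s ^ card T\<bar> \<le> real (card T) * (s + 1) ^ card T * \<epsilon>"
  using assms(1,4)
proof (induction T rule: finite_induct)
  case (insert k T)
  define n where "n = card T"
  define p where "p = (\<Prod>k\<in>T. a k)"
  have IH: "\<bar>p - s ^ n\<bar> \<le> real n * (s + 1) ^ n * \<epsilon>" using insert by (simp add: p_def n_def)
  have ak: "\<bar>a k - s\<bar> \<le> \<epsilon>" using insert by simp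
  then have ak': "\<bar>a k\<bar> \<le> s + 1" using assms by linarith
  have "\<bar>a k * p - s * s ^ n\<bar> = \<bar>a k * (p - s ^ n) + (a k - s) * s ^ n\<bar>" by (simp add: algebra_simps)
  also have "\<dots> \<le> \<bar>a k\<bar> * \<bar>p - s ^ n\<bar> + \<bar>a k - s\<bar> * s ^ n"
    using assms(2) by (intro order_trans[OF abs_triangle_ineq]) (simp add: abs_mult power_abs)
  also have "\<dots> \<le> (s + 1) * (real n * (s + 1) ^ n * \<epsilon>) + \<epsilon> * (s + 1) ^ Suc n"
  proof (intro add_mono mult_mono ak ak' IH)
    have "s ^ n \<le> (s + 1) ^ n" using assms(2) by (intro power_mono) auto
    also have "\<dots> \<le> (s + 1) ^ Suc n" using assms(2) by (intro power_increasing) auto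
    finally show "s ^ n \<le> (s + 1) ^ Suc n" .
  qed (use assms in auto)
  also have "\<dots> = real (Suc n) * (s + 1) ^ Suc n * \<epsilon>" by (simp add: algebra_simps)
  finally show ?case using insert.hyps by (simp add: p_def n_def)
qed simp

context amp
begin

text \<open>Index regularity: each slot occurs in d / r of the factors at \<open>i\<close>, so
  averaging over factors is averaging uniformly over slots. The division by r in \<open>nu\<close>
  reflects this.\<close>

lemma sum_nb_idx:
  assumes i: "i \<in> V"
  shows "(\<Sum>b\<in>nb i. h (ix b i)) = real d / real r * (\<Sum>\<iota><r. h \<iota>)"
proof -
  have "(\<Sum>b\<in>nb i. h (ix b i)) = (\<Sum>\<iota><r. \<Sum>b\<in>{b \<in> nb i. ix b i = \<iota>}. h (ix b i))"
    by (rule sum.group[symmetric]) (use finite_nb idx_props in auto)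
  also have "\<dots> = (\<Sum>\<iota><r. real (card {b \<in> Fs. vf b \<iota> = i}) * h \<iota>)"
  proof (rule sum.cong[OF refl])
    fix \<iota> assume "\<iota> \<in> {..<r}"
    then have e: "{b \<in> nb i. ix b i = \<iota>} = {b \<in> Fs. vf b \<iota> = i}"
      using idx_props(2) idx_eq by (fastforce simp: nbhd_def fvars_def)
    have "(\<Sum>b\<in>{b \<in> nb i. ix b i = \<iota>}. h (ix b i)) = (\<Sum>b\<in>{b \<in> nb i. ix b i = \<iota>}. h \<iota>)"
      by (rule sum.cong) auto
    then show "(\<Sum>b\<in>{b \<in> nb i. ix b i = \<iota>}. h (ix b i)) = real (card {b \<in> Fs. vf b \<iota> = i}) * h \<iota>"
      by (simp add: e)
  qed
  also have "\<dots> = (\<Sum>\<iota><r. real d / real r * h \<iota>)"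
    using regular i by (intro sum.cong refl) (auto simp: index_regular_def)
  finally show ?thesis by (simp add: sum_distrib_left)
qed

definition "CG s = (\<Sum>S\<in>Pow {..<r}. (fourier r f S)\<^sup>2 * (real r * (s + 1) ^ r))"

lemma form_close:
  assumes s: "0 \<le> s" and e: "\<epsilon> \<le> 1" "0 \<le> \<epsilon>" and "\<iota> < r"
    and a: "\<And>\<kappa>. \<kappa> \<in> {..<r} - {\<iota>} \<Longrightarrow> \<bar>a \<kappa> - s\<bar> \<le> \<epsilon>"
  shows "\<bar>(\<Sum>S\<in>Fam r \<iota>. (fourier r f S)\<^sup>2 * (\<Prod>\<kappa>\<in>S - {\<iota>}. a \<kappa>)) - gS r f \<iota> s\<bar> \<le> CG s * \<epsilon>"
proof -
  have "\<bar>(\<Sum>S\<in>Fam r \<iota>. (fourier r f S)\<^sup>2 * (\<Prod>\<kappa>\<in>S - {\<iota>}. a \<kappa>)) - gS r f \<iota> s\<bar>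
     = \<bar>\<Sum>S\<in>Fam r \<iota>. (fourier r f S)\<^sup>2 * ((\<Prod>\<kappa>\<in>S - {\<iota>}. a \<kappa>) - s ^ (card S - 1))\<bar>"
    unfolding gS_def by (simp add: sum_subtractf[symmetric] right_diff_distrib)
  also have "\<dots> \<le> (\<Sum>S\<in>Fam r \<iota>. \<bar>(fourier r f S)\<^sup>2 * ((\<Prod>\<kappa>\<in>S - {\<iota>}. a \<kappa>) - s ^ (card S - 1))\<bar>)" by (rule sum_abs)
  also have "\<dots> \<le> (\<Sum>S\<in>Fam r \<iota>. (fourier r f S)\<^sup>2 * (real r * (s + 1) ^ r) * \<epsilon>)"
  proof (rule sum_mono)
    fix S assume S: "S \<in> Fam r \<iota>"
    have fin: "finite (S - {\<iota>})" using S by (auto simp: Fam_def intro: finite_subset)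
    have cS: "card (S - {\<iota>}) = card S - 1" using S by (simp add: Fam_def)
    have "card S \<le> card {..<r}" using S by (intro card_mono) (auto simp: Fam_def)
    then have cr: "card S - 1 \<le> r" by simp
    have "\<bar>(\<Prod>\<kappa>\<in>S - {\<iota>}. a \<kappa>) - s ^ card (S - {\<iota>})\<bar> \<le> real (card (S - {\<iota>})) * (s + 1) ^ card (S - {\<iota>}) * \<epsilon>"
      by (rule prod_close[OF fin s e(1) a e(2)]) (use S in \<open>auto simp: Fam_def\<close>)
    also have "\<dots> \<le> real r * (s + 1) ^ r * \<epsilon>"
      unfolding cS using cr s e by (intro mult_right_mono mult_mono power_increasing) auto
    finally have "\<bar>(\<Prod>\<kappa>\<in>S - {\<iota>}. a \<kappa>) - s ^ (card S - 1)\<bar> \<le> real r * (s + 1) ^ r * \<epsilon>" by (simp only: cS)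
    then have "(fourier r f S)\<^sup>2 * \<bar>(\<Prod>\<kappa>\<in>S - {\<iota>}. a \<kappa>) - s ^ (card S - 1)\<bar> \<le> (fourier r f S)\<^sup>2 * (real r * (s + 1) ^ r * \<epsilon>)"
      by (rule mult_left_mono) simp
    then show "\<bar>(fourier r f S)\<^sup>2 * ((\<Prod>\<kappa>\<in>S - {\<iota>}. a \<kappa>) - s ^ (card S - 1))\<bar> \<le> (fourier r f S)\<^sup>2 * (real r * (s + 1) ^ r) * \<epsilon>"
      by (simp add: abs_mult mult_ac)
  qed
  also have "\<dots> = (\<Sum>S\<in>Fam r \<iota>. (fourier r f S)\<^sup>2 * (real r * (s + 1) ^ r)) * \<epsilon>" by (rule sum_distrib_right[symmetric])
  also have "\<dots> \<le> CG s * \<epsilon>"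
    unfolding CG_def using s e by (intro mult_right_mono sum_mono2) (auto simp: Fam_def)
  finally show ?thesis .
qed

text \<open>Bounds \<nu> as well as the contribution of each slot, and so the error made by leaving
  out the single factor \<open>a\<close>.\<close>

definition "H m = (\<Sum>\<iota><r. \<bar>gS r f \<iota> (real (Suc m) * \<delta>) - gS r f \<iota> (real m * \<delta>)\<bar>)"

text \<open>Three errors are combined: the fluctuation of \<open>V2\<close> about its mean, the
  deviation of the input variances from their targets, and the omitted factor \<open>a\<close>,
  worth at most \<open>2 * H m / (real d - 1)\<close>.\<close>

lemma V2_err:
  assumes m: "m < L" and i: "i \<in> V" and a: "a \<in> nb i" and d: "d \<ge> 2" and e: "\<epsilon> \<le> 1" "0 \<le> \<epsilon>"
    and z1: "\<And>j c. j \<in> V \<Longrightarrow> c \<in> nb j \<Longrightarrow> \<bar>(\<integral>z. (zz m j c z)\<^sup>2 \<partial>P) - real (Suc m) * \<delta>\<bar> \<le> \<epsilon>"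
    and z2: "\<And>j c. j \<in> V \<Longrightarrow> c \<in> nb j \<Longrightarrow> \<bar>(\<integral>z. (zp m j c z)\<^sup>2 \<partial>P) - real m * \<delta>\<bar> \<le> \<epsilon>"
    and B: "\<And>b. b \<in> nb i \<Longrightarrow> (\<integral>z. Y m b i z ^ 4 \<partial>P) \<le> B"
  shows "(\<integral>z. (V2 (Suc m) i a z - nu r f \<delta> (Suc m))\<^sup>2 \<partial>P)
     \<le> 2 * B / (real d - 1) + 2 * ((CG (real (Suc m) * \<delta>) + CG (real m * \<delta>)) * \<epsilon> + 2 * H m / (real d - 1))\<^sup>2"
proof -
  let ?I = "nb i - {a}"
  define \<nu> where "\<nu> = nu r f \<delta> (Suc m)"
  define D where "D = real d - 1"
  have D1: "D \<ge> 1" using d by (simp add: D_def)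
  have cI: "real (card ?I) = D" unfolding D_def using card_nb[OF i] a finite_nb d
    by (simp add: card_Diff_singleton of_nat_diff)
  define hh where "hh \<iota> = gS r f \<iota> (real (Suc m) * \<delta>) - gS r f \<iota> (real m * \<delta>)" for \<iota>
  define C where "C = CG (real (Suc m) * \<delta>) + CG (real m * \<delta>)"
  define c where "c = (\<Sum>b\<in>?I. \<integral>z. (Y m b i z)\<^sup>2 \<partial>P) / D"
  have r0: "real r > 0" using r2 by simp
  have Hge: "\<bar>hh \<iota>\<bar> \<le> H m" if "\<iota> < r" for \<iota>
    unfolding H_def hh_def by (rule member_le_sum[where f = "\<lambda>\<iota>. \<bar>gS r f \<iota> (real (Suc m) * \<delta>) - gS r f \<iota> (real m * \<delta>)\<bar>"]) (use that in auto)
  have nuH: "\<bar>\<nu>\<bar> \<le> H m"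
  proof -
    have "\<bar>\<nu>\<bar> \<le> H m / real r" unfolding \<nu>_def nu_Suc H_def using r0 sum_abs[of hh "{..<r}"]
      by (simp add: hh_def divide_right_mono)
    also have "\<dots> \<le> H m"
    proof -
      have "0 \<le> H m" by (simp add: H_def sum_nonneg)
      then have "H m * 1 \<le> H m * real r" using r2 by (intro mult_left_mono) auto
      then show ?thesis using r0 by (simp add: divide_le_eq)
    qed
    finally show ?thesis .
  qed
  have EY: "\<bar>(\<integral>z. (Y m b i z)\<^sup>2 \<partial>P) - hh (ix b i)\<bar> \<le> C * \<epsilon>" if b: "b \<in> ?I" for b
  proof -
    have b': "b \<in> nb i" using b by simp
    have ib: "ix b i < r" using idx_props[OF b'] by simp
    have "\<bar>(\<integral>z. (dm m b i z)\<^sup>2 \<partial>P) - gS r f (ix b i) (real (Suc m) * \<delta>)\<bar> \<le> CG (real (Suc m) * \<delta>) * \<epsilon>"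
      unfolding second_moment_dm[OF m b'] using dpos
      by (intro form_close e ib z1 branch_props[OF b']) auto
    moreover have "\<bar>(\<integral>z. (dp m b i z)\<^sup>2 \<partial>P) - gS r f (ix b i) (real m * \<delta>)\<bar> \<le> CG (real m * \<delta>) * \<epsilon>"
      unfolding second_moment_dp[OF m b'] using dpos
      by (intro form_close e ib z2 branch_props[OF b']) auto
    ultimately show ?thesis
      unfolding second_moment_Y[OF m b] hh_def C_def by (simp add: distrib_right abs_le_iff)
  qed
  have "(\<Sum>b\<in>nb i. hh (ix b i)) = real d * \<nu>"
    unfolding sum_nb_idx[OF i, of hh] \<nu>_def nu_Suc hh_def[symmetric] by simp
  moreover have "(\<Sum>b\<in>nb i. hh (ix b i)) = hh (ix a i) + (\<Sum>b\<in>?I. hh (ix b i))"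
    by (rule sum.remove[OF finite_nb a])
  ultimately have sI: "(\<Sum>b\<in>?I. hh (ix b i)) = D * \<nu> + (\<nu> - hh (ix a i))" by (simp add: D_def algebra_simps)
  have "\<bar>c - \<nu>\<bar> = \<bar>(\<Sum>b\<in>?I. (\<integral>z. (Y m b i z)\<^sup>2 \<partial>P) - hh (ix b i)) + (\<nu> - hh (ix a i))\<bar> / D"
    using D1 unfolding c_def sum_subtractf sI by (simp add: field_simps abs_divide)
  also have "\<dots> \<le> (\<Sum>b\<in>?I. C * \<epsilon>) / D + 2 * H m / D"
  proof -
    have "\<bar>\<Sum>b\<in>?I. (\<integral>z. (Y m b i z)\<^sup>2 \<partial>P) - hh (ix b i)\<bar> \<le> (\<Sum>b\<in>?I. C * \<epsilon>)"
      by (rule order_trans[OF sum_abs]) (rule sum_mono[OF EY])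
    moreover have "\<bar>\<nu> - hh (ix a i)\<bar> \<le> 2 * H m" using nuH Hge[of "ix a i"] idx_props[OF a] by linarith
    ultimately show ?thesis using D1 unfolding add_divide_distrib[symmetric] by (intro divide_right_mono) linarith+
  qed
  also have "(\<Sum>b\<in>?I. C * \<epsilon>) / D = C * \<epsilon>" using D1 by (simp only: sum_constant cI) simp
  finally have cnu: "\<bar>c - \<nu>\<bar> \<le> C * \<epsilon> + 2 * H m / D" .
  have pV: "pg (\<lambda>z. (V2 (Suc m) i a z - x)\<^sup>2)" for x using m i by (intro pg_power pg_diff pg_V2 pg_const) auto
  have "(\<integral>z. (V2 (Suc m) i a z - \<nu>)\<^sup>2 \<partial>P) \<le> (\<integral>z. 2 * (V2 (Suc m) i a z - c)\<^sup>2 + 2 * (c - \<nu>)\<^sup>2 \<partial>P)"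
  proof (rule integral_mono)
    show "integrable P (\<lambda>z. (V2 (Suc m) i a z - \<nu>)\<^sup>2)" by (rule pg_integrable[OF pV])
    show "integrable P (\<lambda>z. 2 * (V2 (Suc m) i a z - c)\<^sup>2 + 2 * (c - \<nu>)\<^sup>2)"
      by (rule pg_integrable[OF pg_add[OF pg_mult[OF pg_const pV] pg_const]])
    fix z
    have "0 \<le> ((V2 (Suc m) i a z - c) - (c - \<nu>))\<^sup>2" by simp
    then show "(V2 (Suc m) i a z - \<nu>)\<^sup>2 \<le> 2 * (V2 (Suc m) i a z - c)\<^sup>2 + 2 * (c - \<nu>)\<^sup>2"
      by (simp add: power2_eq_square algebra_simps)
  qed
  also have "\<dots> = 2 * (\<integral>z. (V2 (Suc m) i a z - c)\<^sup>2 \<partial>P) + 2 * (c - \<nu>)\<^sup>2"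
    using pg_integrable[OF pV[of c]] by (simp add: P.prob_space)
  also have "\<dots> \<le> 2 * ((\<Sum>b\<in>?I. B) / D\<^sup>2) + 2 * (C * \<epsilon> + 2 * H m / D)\<^sup>2"
  proof (intro add_mono mult_left_mono)
    show "(\<integral>z. (V2 (Suc m) i a z - c)\<^sup>2 \<partial>P) \<le> (\<Sum>b\<in>?I. B) / D\<^sup>2"
    proof -
      have "(\<integral>z. (V2 (Suc m) i a z - c)\<^sup>2 \<partial>P) \<le> (\<Sum>b\<in>?I. \<integral>z. Y m b i z ^ 4 \<partial>P) / D\<^sup>2"
        using V2_LLN[OF m i d, of a] unfolding c_def D_def .
      also have "\<dots> \<le> (\<Sum>b\<in>?I. B) / D\<^sup>2" by (intro divide_right_mono sum_mono B) auto
      finally show ?thesis .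
    qed
    have "\<bar>c - \<nu>\<bar> \<le> \<bar>C * \<epsilon> + 2 * H m / D\<bar>" using cnu by (rule order_trans[OF _ abs_ge_self])
    then show "(c - \<nu>)\<^sup>2 \<le> (C * \<epsilon> + 2 * H m / D)\<^sup>2" by (rule abs_le_square_iff[THEN iffD1])
  qed auto
  also have "(\<Sum>b\<in>?I. B) / D\<^sup>2 = B / D" using D1 by (simp only: sum_constant cI) (simp add: power2_eq_square)
  finally show ?thesis by (simp add: \<nu>_def C_def D_def)
qed

text \<open>Replacing \<open>V2\<close> by a constant in the variance increment costs its L1 error
  times the bound on the square of \<open>A\<close>. With the constant in place, only the second
  moment of \<open>A\<close> matters, which is what property (P2) prescribes.\<close>

lemma second_moment_zz_diff:
  assumes m: "m < L" and i: "i \<in> V"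
  shows "\<bar>(\<integral>z. (zz (Suc m) i a z)\<^sup>2 \<partial>P) - (\<integral>z. (zz m i a z)\<^sup>2 \<partial>P) - \<nu> * (\<integral>z. (A m i a z)\<^sup>2 \<partial>P)\<bar>
     \<le> K\<^sup>2 * (\<integral>z. \<bar>V2 (Suc m) i a z - \<nu>\<bar> \<partial>P)"
proof -
  have pA: "pg (\<lambda>z. (A m i a z)\<^sup>2)" and pV: "pg (V2 (Suc m) i a)" using m i by (auto intro: pg_power pg_A pg_V2)
  have pd: "pg (\<lambda>z. V2 (Suc m) i a z - \<nu>)" by (rule pg_diff[OF pV pg_const])
  have "(\<integral>z. (zz (Suc m) i a z)\<^sup>2 \<partial>P) - (\<integral>z. (zz m i a z)\<^sup>2 \<partial>P) - \<nu> * (\<integral>z. (A m i a z)\<^sup>2 \<partial>P)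
     = (\<integral>z. (A m i a z)\<^sup>2 * V2 (Suc m) i a z \<partial>P) - (\<integral>z. \<nu> * (A m i a z)\<^sup>2 \<partial>P)"
    unfolding second_moment_zz_Suc[OF m i] by simp
  also have "\<dots> = (\<integral>z. (A m i a z)\<^sup>2 * (V2 (Suc m) i a z - \<nu>) \<partial>P)"
  proof -
    have "(\<integral>z. (A m i a z)\<^sup>2 * (V2 (Suc m) i a z - \<nu>) \<partial>P) = (\<integral>z. (A m i a z)\<^sup>2 * V2 (Suc m) i a z - \<nu> * (A m i a z)\<^sup>2 \<partial>P)"
      by (rule Bochner_Integration.integral_cong[OF refl]) (simp add: right_diff_distrib mult.commute)
    also have "\<dots> = (\<integral>z. (A m i a z)\<^sup>2 * V2 (Suc m) i a z \<partial>P) - (\<integral>z. \<nu> * (A m i a z)\<^sup>2 \<partial>P)"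
      by (rule Bochner_Integration.integral_diff[OF pg_integrable[OF pg_mult[OF pA pV]] pg_integrable[OF pg_mult[OF pg_const pA]]])
    finally show ?thesis by simp
  qed
  finally have eq: "(\<integral>z. (zz (Suc m) i a z)\<^sup>2 \<partial>P) - (\<integral>z. (zz m i a z)\<^sup>2 \<partial>P) - \<nu> * (\<integral>z. (A m i a z)\<^sup>2 \<partial>P)
     = (\<integral>z. (A m i a z)\<^sup>2 * (V2 (Suc m) i a z - \<nu>) \<partial>P)" .
  have "\<bar>\<integral>z. (A m i a z)\<^sup>2 * (V2 (Suc m) i a z - \<nu>) \<partial>P\<bar> \<le> (\<integral>z. \<bar>(A m i a z)\<^sup>2 * (V2 (Suc m) i a z - \<nu>)\<bar> \<partial>P)"
    by (rule integral_abs_bound)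
  also have "\<dots> \<le> (\<integral>z. K\<^sup>2 * \<bar>V2 (Suc m) i a z - \<nu>\<bar> \<partial>P)"
  proof (rule integral_mono)
    show "integrable P (\<lambda>z. \<bar>(A m i a z)\<^sup>2 * (V2 (Suc m) i a z - \<nu>)\<bar>)" by (rule pg_integrable[OF pg_abs[OF pg_mult[OF pA pd]]])
    show "integrable P (\<lambda>z. K\<^sup>2 * \<bar>V2 (Suc m) i a z - \<nu>\<bar>)" by (rule pg_integrable[OF pg_mult[OF pg_const pg_abs[OF pd]]])
    fix z
    have "(A m i a z)\<^sup>2 \<le> K\<^sup>2" using abs_A_le[OF m, of i a z] Kpos by (simp add: abs_le_square_iff[symmetric])
    then show "\<bar>(A m i a z)\<^sup>2 * (V2 (Suc m) i a z - \<nu>)\<bar> \<le> K\<^sup>2 * \<bar>V2 (Suc m) i a z - \<nu>\<bar>"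
      by (simp add: abs_mult mult_right_mono)
  qed
  finally show ?thesis using eq by simp
qed

lemma L1_le_L2: assumes "pg h" shows "(\<integral>z. \<bar>h z\<bar> \<partial>P) \<le> sqrt (\<integral>z. (h z)\<^sup>2 \<partial>P)"
proof -
  obtain z where z: "z \<in> space P" using space_nonempty .
  have "(\<integral>z. \<bar>h z\<bar> \<partial>P)\<^sup>2 \<le> (\<integral>z. (h z)\<^sup>2 \<partial>P)"
    using CE_jensen_sq[OF pg_abs[OF assms] z, of V] by (simp add: CE_V[OF z])
  then show ?thesis by (rule real_le_rsqrt)
qed

end

subsection \<open>Limits along the sequence of hypergraphs\<close>

lemma (in gauss) coord_moment: "j \<in> V \<Longrightarrow> (\<integral>z. z j ^ k \<partial>P) = (\<integral>x. x ^ k \<partial>N)"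
proof -
  assume j: "j \<in> V"
  have m: "(\<lambda>y. y j) \<in> measurable P N"
    using measurable_coord[OF j] by (simp cong: measurable_cong_sets)
  have "(\<integral>x. x ^ k \<partial>distr P N (\<lambda>z. z j)) = (\<integral>z. z j ^ k \<partial>P)" by (rule integral_distr[OF m]) simp
  then show ?thesis by (simp only: distr_coord[OF j])
qed

locale ampseq =
  fixes V :: "nat \<Rightarrow> 'v set" and \<delta> :: real and r :: nat and f :: "(nat \<Rightarrow> real) \<Rightarrow> real" and K :: real and L :: nat
    and Fs :: "nat \<Rightarrow> 'f set" and vf :: "nat \<Rightarrow> 'f \<Rightarrow> nat \<Rightarrow> 'v" and d :: "nat \<Rightarrow> nat"
    and Fm :: "nat \<Rightarrow> nat \<Rightarrow> (nat \<Rightarrow> real) \<Rightarrow> real"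
  assumes amp: "\<And>n. amp (V n) \<delta> r f K L (Fs n) (vf n) (d n) (Fm n)"
    and d_lim: "filterlim d at_top sequentially"
begin

sublocale G: amp "V n" \<delta> r f K L "Fs n" "vf n" "d n" "Fm n" for n
  by (rule amp)

lemma ev_d: "\<forall>\<^sub>F n in sequentially. 2 \<le> d n"
  using d_lim by (simp add: filterlim_at_top)

lemma ev_small: "0 < e \<Longrightarrow> \<forall>\<^sub>F n in sequentially. C / (real (d n) - 1) \<le> e"
proof -
  assume e: "0 < e"
  have "\<forall>\<^sub>F n in sequentially. nat \<lceil>\<bar>C\<bar> / e\<rceil> + 2 \<le> d n"
    using d_lim by (simp add: filterlim_at_top)
  then show ?thesis
  proof eventually_elim
    case (elim n)
    have "\<bar>C\<bar> / e \<le> real (d n) - 1" using elim by linarith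
    then have "\<bar>C\<bar> \<le> e * (real (d n) - 1)" using e by (simp add: divide_le_eq mult.commute)
    then show ?case using elim by (simp add: divide_le_eq mult.commute)
  qed
qed

lemma moment_zz_Suc_uniform:
  assumes m: "m < L"
    and z: "\<And>k. \<exists>B\<ge>0. \<forall>n. 2 \<le> d n \<longrightarrow> (\<forall>j\<in>V n. \<forall>c\<in>G.nb n j. (\<integral>z. G.zz n m j c z ^ (2 * k) \<partial>G.P n) \<le> B)"
    and u: "\<And>k. \<exists>B\<ge>0. \<forall>n. 2 \<le> d n \<longrightarrow> (\<forall>j\<in>V n. \<forall>c\<in>G.nb n j. (\<integral>z. G.u n (Suc m) j c z ^ (2 * k) \<partial>G.P n) \<le> B)"
  shows "\<exists>B\<ge>0. \<forall>n. 2 \<le> d n \<longrightarrow> (\<forall>j\<in>V n. \<forall>c\<in>G.nb n j. (\<integral>z. G.zz n (Suc m) j c z ^ (2 * k) \<partial>G.P n) \<le> B)"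
proof -
  obtain B1 where B1: "B1 \<ge> 0" "\<And>n j c. 2 \<le> d n \<Longrightarrow> j \<in> V n \<Longrightarrow> c \<in> G.nb n j \<Longrightarrow> (\<integral>z. G.zz n m j c z ^ (2 * k) \<partial>G.P n) \<le> B1"
    using z[of k] by blast
  obtain B2 where B2: "B2 \<ge> 0" "\<And>n j c. 2 \<le> d n \<Longrightarrow> j \<in> V n \<Longrightarrow> c \<in> G.nb n j \<Longrightarrow> (\<integral>z. G.u n (Suc m) j c z ^ (2 * k) \<partial>G.P n) \<le> B2"
    using u[of k] by blast
  have "(\<integral>z. G.zz n (Suc m) j c z ^ (2 * k) \<partial>G.P n) \<le> 2 ^ (2 * k) * (B1 + K ^ (2 * k) * B2)"
    if n: "2 \<le> d n" and j: "j \<in> V n" and c: "c \<in> G.nb n j" for n j c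
  proof -
    have pz: "G.pg n (\<lambda>z. G.zz n m j c z ^ (2 * k))" and pu: "G.pg n (\<lambda>z. G.u n (Suc m) j c z ^ (2 * k))"
      and pz': "G.pg n (\<lambda>z. G.zz n (Suc m) j c z ^ (2 * k))"
      using m j by (auto intro!: G.pg_power G.pg_zz G.pg_u)
    have "(\<integral>z. G.zz n (Suc m) j c z ^ (2 * k) \<partial>G.P n)
        \<le> (\<integral>z. 2 ^ (2 * k) * (G.zz n m j c z ^ (2 * k) + K ^ (2 * k) * G.u n (Suc m) j c z ^ (2 * k)) \<partial>G.P n)"
    proof (rule integral_mono)
      show "integrable (G.P n) (\<lambda>z. G.zz n (Suc m) j c z ^ (2 * k))" by (rule G.pg_integrable[OF pz'])
      show "integrable (G.P n) (\<lambda>z. 2 ^ (2 * k) * (G.zz n m j c z ^ (2 * k) + K ^ (2 * k) * G.u n (Suc m) j c z ^ (2 * k)))"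
        by (rule G.pg_integrable[OF G.pg_mult[OF G.pg_const G.pg_add[OF pz G.pg_mult[OF G.pg_const pu]]]])
      fix z
      have "\<bar>G.A n m j c z * G.u n (Suc m) j c z\<bar> ^ (2 * k) \<le> K ^ (2 * k) * G.u n (Suc m) j c z ^ (2 * k)"
      proof -
        have "\<bar>G.A n m j c z\<bar> ^ (2 * k) \<le> K ^ (2 * k)"
          using G.abs_A_le[OF m] by (intro power_mono) auto
        then have "\<bar>G.A n m j c z\<bar> ^ (2 * k) * \<bar>G.u n (Suc m) j c z\<bar> ^ (2 * k) \<le> K ^ (2 * k) * \<bar>G.u n (Suc m) j c z\<bar> ^ (2 * k)"
          by (rule mult_right_mono) simp
        then show ?thesis by (simp add: abs_mult power_mult_distrib power_even_abs)
      qed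
      moreover have "\<bar>G.zz n m j c z + G.A n m j c z * G.u n (Suc m) j c z\<bar> ^ (2 * k)
          \<le> 2 ^ (2 * k) * (\<bar>G.zz n m j c z\<bar> ^ (2 * k) + \<bar>G.A n m j c z * G.u n (Suc m) j c z\<bar> ^ (2 * k))"
        by (rule abs_add_power_le)
      moreover have "2 ^ (2 * k) * (\<bar>G.zz n m j c z\<bar> ^ (2 * k) + \<bar>G.A n m j c z * G.u n (Suc m) j c z\<bar> ^ (2 * k))
          \<le> 2 ^ (2 * k) * (\<bar>G.zz n m j c z\<bar> ^ (2 * k) + K ^ (2 * k) * G.u n (Suc m) j c z ^ (2 * k))"
        using calculation(1) by (intro mult_left_mono add_left_mono) auto
      ultimately show "G.zz n (Suc m) j c z ^ (2 * k) \<le> 2 ^ (2 * k) * (G.zz n m j c z ^ (2 * k) + K ^ (2 * k) * G.u n (Suc m) j c z ^ (2 * k))"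
        unfolding G.zz_Suc by (simp only: power_even_abs even_mult_iff even_numeral simp_thms)
    qed
    also have "\<dots> = 2 ^ (2 * k) * ((\<integral>z. G.zz n m j c z ^ (2 * k) \<partial>G.P n) + K ^ (2 * k) * (\<integral>z. G.u n (Suc m) j c z ^ (2 * k) \<partial>G.P n))"
      using G.pg_integrable[OF pz] G.pg_integrable[OF pu] by simp
    also have "\<dots> \<le> 2 ^ (2 * k) * (B1 + K ^ (2 * k) * B2)"
      using B1(2)[OF n j c] B2(2)[OF n j c] by (intro mult_left_mono add_mono) auto
    finally show ?thesis .
  qed
  moreover have "0 \<le> 2 ^ (2 * k) * (B1 + K ^ (2 * k) * B2)" using B1 B2 by simp
  ultimately show ?thesis by blast
qed

lemma moment_Y_uniform:
  assumes m: "m < L"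
    and z: "\<And>s k. s \<le> m \<Longrightarrow> \<exists>B\<ge>0. \<forall>n. 2 \<le> d n \<longrightarrow> (\<forall>j\<in>V n. \<forall>c\<in>G.nb n j. (\<integral>z. G.zz n s j c z ^ (2 * k) \<partial>G.P n) \<le> B)"
  shows "\<exists>B\<ge>0. \<forall>n. 2 \<le> d n \<longrightarrow> (\<forall>i\<in>V n. \<forall>b\<in>G.nb n i. (\<integral>z. G.Y n m b i z ^ (2 * k) \<partial>G.P n) \<le> B)"
proof -
  obtain B1 where B1: "B1 \<ge> 0" "\<And>n j c. 2 \<le> d n \<Longrightarrow> j \<in> V n \<Longrightarrow> c \<in> G.nb n j \<Longrightarrow> (\<integral>z. G.zz n m j c z ^ (2 * (k * r)) \<partial>G.P n) \<le> B1"
    using z[of m "k * r"] by blast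
  obtain B2 where B2: "B2 \<ge> 0" "\<And>n j c. 2 \<le> d n \<Longrightarrow> j \<in> V n \<Longrightarrow> c \<in> G.nb n j \<Longrightarrow> (\<integral>z. G.zp n m j c z ^ (2 * (k * r)) \<partial>G.P n) \<le> B2"
  proof (cases m)
    case 0
    \<comment> \<open>For k = 0 the integrand is 0^0 = 1, hence the bound 1 and not 0.\<close>
    have "(\<integral>z. G.zp n m j c z ^ (2 * (k * r)) \<partial>G.P n) \<le> 1" for n j c
      by (cases "k * r = 0") (simp_all add: 0 G.zp_0 G.P.prob_space power_0_left)
    then show ?thesis using that[of 1] by simp
  next
    case (Suc s)
    then obtain B2 where "B2 \<ge> 0" "\<And>n j c. 2 \<le> d n \<Longrightarrow> j \<in> V n \<Longrightarrow> c \<in> G.nb n j \<Longrightarrow> (\<integral>z. G.zz n s j c z ^ (2 * (k * r)) \<partial>G.P n) \<le> B2"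
      using z[of s "k * r"] by auto
    then show ?thesis using that[of B2] by (simp add: Suc G.zp_Suc)
  qed
  define B where "B = B1 + B2"
  have B0: "0 \<le> B" using B1 B2 by (simp add: B_def)
  have "(\<integral>z. G.Y n m b i z ^ (2 * k) \<partial>G.P n) \<le> G.CY k B" if n: "2 \<le> d n" and b: "b \<in> G.nb n i" for n i b
  proof (rule G.moment_Y[OF m b B0])
    show "(\<integral>z. G.zz n m j c z ^ (2 * (k * r)) \<partial>G.P n) \<le> B" if "j \<in> V n" "c \<in> G.nb n j" for j c
      using B1(2)[OF n that] B2(1) by (simp add: B_def)
    show "(\<integral>z. G.zp n m j c z ^ (2 * (k * r)) \<partial>G.P n) \<le> B" if "j \<in> V n" "c \<in> G.nb n j" for j c
      using B2(2)[OF n that] B1(1) by (simp add: B_def)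
  qed
  moreover have "0 \<le> G.CY k B" unfolding G.CY_def using B0 by (intro mult_nonneg_nonneg) auto
  ultimately show ?thesis by blast
qed

lemma moment_u_uniform:
  assumes m: "m < L"
    and y: "\<And>k. \<exists>B\<ge>0. \<forall>n. 2 \<le> d n \<longrightarrow> (\<forall>i\<in>V n. \<forall>b\<in>G.nb n i. (\<integral>z. G.Y n m b i z ^ (2 * k) \<partial>G.P n) \<le> B)"
  shows "\<exists>B\<ge>0. \<forall>n. 2 \<le> d n \<longrightarrow> (\<forall>j\<in>V n. \<forall>c\<in>G.nb n j. (\<integral>z. G.u n (Suc m) j c z ^ (2 * k) \<partial>G.P n) \<le> B)"
proof -
  from y have "\<forall>k. \<exists>B. B \<ge> 0 \<and> (\<forall>n. 2 \<le> d n \<longrightarrow> (\<forall>i\<in>V n. \<forall>b\<in>G.nb n i. (\<integral>z. G.Y n m b i z ^ (2 * k) \<partial>G.P n) \<le> B))" by blast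
  then obtain B where B: "\<And>k. B k \<ge> 0"
    "\<And>k n i b. 2 \<le> d n \<Longrightarrow> i \<in> V n \<Longrightarrow> b \<in> G.nb n i \<Longrightarrow> (\<integral>z. G.Y n m b i z ^ (2 * k) \<partial>G.P n) \<le> B k"
    by metis
  define M where "M = 1 + (\<Sum>j\<le>k. B j)"
  have M1: "1 \<le> M" using B(1) by (simp add: M_def sum_nonneg)
  have BM: "B j \<le> M" if "j \<le> k" for j
  proof -
    have "B j \<le> (\<Sum>j\<le>k. B j)" using that B(1) by (intro member_le_sum) auto
    then show ?thesis by (simp add: M_def)
  qed
  have "(\<integral>z. G.u n (Suc m) j c z ^ (2 * k) \<partial>G.P n) \<le> cmom k * M ^ k"
    if n: "2 \<le> d n" and j: "j \<in> V n" "c \<in> G.nb n j" for n j c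
    by (rule G.moment_u[OF m j n M1]) (use B(2)[OF n j(1)] BM in \<open>blast intro: order_trans\<close>)
  moreover have "0 \<le> cmom k * M ^ k" using cmom_nonneg M1 by (intro mult_nonneg_nonneg) auto
  ultimately show ?thesis by blast
qed

text \<open>The order k varies in the induction because the passage from zz to \<open>Y\<close>
  multiplies the order by r.\<close>

lemma moment_zz_uniform:
  "m \<le> L \<Longrightarrow> \<exists>B\<ge>0. \<forall>n. 2 \<le> d n \<longrightarrow> (\<forall>j\<in>V n. \<forall>c\<in>G.nb n j. (\<integral>z. G.zz n m j c z ^ (2 * k) \<partial>G.P n) \<le> B)"
proof (induction m arbitrary: k rule: less_induct)
  case (less m)
  show ?case
  proof (cases m)
    case 0
    let ?B = "\<integral>x. x ^ (2 * k) \<partial>density lborel (normal_density 0 (sqrt \<delta>))"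
    have "0 \<le> ?B" by (rule Bochner_Integration.integral_nonneg) (simp add: zero_le_even_power)
    moreover have "(\<integral>z. G.zz n m j c z ^ (2 * k) \<partial>G.P n) \<le> ?B" if "j \<in> V n" for n j c
      using G.coord_moment[OF that, of "2 * k"] by (simp add: 0 G.zz_0)
    ultimately show ?thesis by blast
  next
    case (Suc s)
    have s: "s < L" using less.prems Suc by simp
    have z: "\<exists>B\<ge>0. \<forall>n. 2 \<le> d n \<longrightarrow> (\<forall>j\<in>V n. \<forall>c\<in>G.nb n j. (\<integral>z. G.zz n t j c z ^ (2 * k) \<partial>G.P n) \<le> B)" if "t \<le> s" for t k
      using less.IH[of t k] that Suc less.prems by simp
    show ?thesis unfolding Suc
      by (rule moment_zz_Suc_uniform[OF s z[OF order_refl] moment_u_uniform[OF s moment_Y_uniform[OF s z]]])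
  qed
qed

lemma moment_Y_bound:
  "m < L \<Longrightarrow> \<exists>B\<ge>0. \<forall>n. 2 \<le> d n \<longrightarrow> (\<forall>i\<in>V n. \<forall>b\<in>G.nb n i. (\<integral>z. G.Y n m b i z ^ (2 * k) \<partial>G.P n) \<le> B)"
  by (rule moment_Y_uniform) (auto intro: moment_zz_uniform)

lemma moment_u_bound:
  "m < L \<Longrightarrow> \<exists>B\<ge>0. \<forall>n. 2 \<le> d n \<longrightarrow> (\<forall>j\<in>V n. \<forall>c\<in>G.nb n j. (\<integral>z. G.u n (Suc m) j c z ^ (2 * k) \<partial>G.P n) \<le> B)"
  by (rule moment_u_uniform) (auto intro: moment_Y_bound)

lemma V2_lim:
  assumes m: "m < L"
    and z1: "\<And>\<epsilon>. 0 < \<epsilon> \<Longrightarrow> \<forall>\<^sub>F n in sequentially. \<forall>j\<in>V n. \<forall>c\<in>G.nb n j. \<bar>(\<integral>z. (G.zz n m j c z)\<^sup>2 \<partial>G.P n) - real (Suc m) * \<delta>\<bar> \<le> \<epsilon>"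
    and z2: "\<And>\<epsilon>. 0 < \<epsilon> \<Longrightarrow> \<forall>\<^sub>F n in sequentially. \<forall>j\<in>V n. \<forall>c\<in>G.nb n j. \<bar>(\<integral>z. (G.zp n m j c z)\<^sup>2 \<partial>G.P n) - real m * \<delta>\<bar> \<le> \<epsilon>"
    and \<eta>: "0 < \<eta>"
  shows "\<forall>\<^sub>F n in sequentially. \<forall>i\<in>V n. \<forall>a\<in>G.nb n i. (\<integral>z. (G.V2 n (Suc m) i a z - nu r f \<delta> (Suc m))\<^sup>2 \<partial>G.P n) \<le> \<eta>"
proof -
  obtain B where B: "B \<ge> 0" "\<And>n i b. 2 \<le> d n \<Longrightarrow> i \<in> V n \<Longrightarrow> b \<in> G.nb n i \<Longrightarrow> (\<integral>z. G.Y n m b i z ^ (2 * 2) \<partial>G.P n) \<le> B"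
    using moment_Y_bound[OF m, of 2] by blast
  define C where "C = \<bar>G.CG (real (Suc m) * \<delta>) + G.CG (real m * \<delta>)\<bar>"
  \<comment> \<open>The budget \<eta> is spent as 2 t on the fluctuation and 2 t on the squared
    bias, whence \<eta> / 4; as t is at most 1, a bias below t has a square below t.\<close>
  define t where "t = min 1 (\<eta> / 4)"
  have t: "0 < t" "t \<le> 1" "4 * t \<le> \<eta>" using \<eta> by (auto simp: t_def)
  \<comment> \<open>Half of the bias t is reserved for the input variances, the other half for the
    omitted factor.\<close>
  define \<epsilon> where "\<epsilon> = min 1 (t / (2 * (C + 1)))"
  have C0: "C \<ge> 0" by (simp add: C_def)
  have e: "0 < \<epsilon>" "\<epsilon> \<le> 1" "0 \<le> \<epsilon>" using t C0 by (auto simp: \<epsilon>_def)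
  have "C * \<epsilon> \<le> (C + 1) * (t / (2 * (C + 1)))" using C0 t e by (intro mult_mono) (auto simp: \<epsilon>_def)
  also have "(C + 1) * (t / (2 * (C + 1))) = t / 2" using C0 by (simp add: field_simps)
  finally have Ce: "C * \<epsilon> \<le> t / 2" .
  show ?thesis
    using ev_d z1[OF e(1)] z2[OF e(1)] ev_small[OF t(1), of B] ev_small[OF half_gt_zero[OF t(1)], of "2 * G.H m"]
  proof (eventually_elim, intro ballI)
    fix n i a
    assume n: "2 \<le> d n" and zz: "\<forall>j\<in>V n. \<forall>c\<in>G.nb n j. \<bar>(\<integral>z. (G.zz n m j c z)\<^sup>2 \<partial>G.P n) - real (Suc m) * \<delta>\<bar> \<le> \<epsilon>"
      "\<forall>j\<in>V n. \<forall>c\<in>G.nb n j. \<bar>(\<integral>z. (G.zp n m j c z)\<^sup>2 \<partial>G.P n) - real m * \<delta>\<bar> \<le> \<epsilon>"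
      and s: "B / (real (d n) - 1) \<le> t" "2 * G.H m / (real (d n) - 1) \<le> t / 2" and i: "i \<in> V n" "a \<in> G.nb n i"
    define X where "X = (G.CG (real (Suc m) * \<delta>) + G.CG (real m * \<delta>)) * \<epsilon> + 2 * G.H m / (real (d n) - 1)"
    have H0: "0 \<le> G.H m" by (simp add: G.H_def sum_nonneg)
    have CG0: "0 \<le> G.CG (real k * \<delta>)" for k
      unfolding G.CG_def using G.dpos by (intro sum_nonneg) auto
    have X0: "0 \<le> X" unfolding X_def using H0 CG0[of "Suc m"] CG0[of m] e n by (intro add_nonneg_nonneg mult_nonneg_nonneg divide_nonneg_nonneg) auto
    have "(G.CG (real (Suc m) * \<delta>) + G.CG (real m * \<delta>)) * \<epsilon> \<le> C * \<epsilon>" using e by (intro mult_right_mono) (auto simp: C_def)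
    then have "X \<le> t" unfolding X_def using Ce s by linarith
    then have "X\<^sup>2 \<le> t * 1" using X0 t unfolding power2_eq_square by (intro mult_mono) auto
    moreover have "(\<integral>z. (G.V2 n (Suc m) i a z - nu r f \<delta> (Suc m))\<^sup>2 \<partial>G.P n) \<le> 2 * B / (real (d n) - 1) + 2 * X\<^sup>2"
      unfolding X_def by (rule G.V2_err[OF m i n e(2,3)]) (use zz B(2)[OF n i(1)] in auto)
    ultimately show "(\<integral>z. (G.V2 n (Suc m) i a z - nu r f \<delta> (Suc m))\<^sup>2 \<partial>G.P n) \<le> \<eta>"
      using s t by simp
  qed
qed

end

text \<open>The non-degenerate case: positivity of \<open>nu\<close> gives the quotient in property
  (P2) its intended meaning, since division by zero yields zero.\<close>

locale ampseq_pos = ampseq +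
  assumes nupos: "\<And>m. 0 < nu r f \<delta> (Suc m)"
    and A2: "\<And>n k j b. k < L \<Longrightarrow> j \<in> V n \<Longrightarrow> b \<in> G.nb n j \<Longrightarrow>
      (\<integral>z. (G.A n k j b z)\<^sup>2 \<partial>G.P n) = \<delta> / nu r f \<delta> (Suc k)"
begin

text \<open>Each level adds approximately \<nu> times the second moment of \<open>A\<close>, which
  is exactly \<delta>, to the initial variance \<delta>. The induction is strong because
  \<open>V2_lim\<close> at one level uses that level and the one before.\<close>

lemma zz_lim:
  "m \<le> L \<Longrightarrow> 0 < \<epsilon> \<Longrightarrow> \<forall>\<^sub>F n in sequentially. \<forall>j\<in>V n. \<forall>c\<in>G.nb n j. \<bar>(\<integral>z. (G.zz n m j c z)\<^sup>2 \<partial>G.P n) - real (Suc m) * \<delta>\<bar> \<le> \<epsilon>"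
proof (induction m arbitrary: \<epsilon> rule: less_induct)
  case (less m)
  show ?case
  proof (cases m)
    case 0
    then show ?thesis using less.prems G.second_moment_zz_0 by simp
  next
    case (Suc s)
    have s: "s < L" using less.prems Suc by simp
    define \<nu> where "\<nu> = nu r f \<delta> (Suc s)"
    have nu0: "\<nu> > 0" unfolding \<nu>_def by (rule nupos)
    have z2: "\<forall>\<^sub>F n in sequentially. \<forall>j\<in>V n. \<forall>c\<in>G.nb n j. \<bar>(\<integral>z. (G.zp n s j c z)\<^sup>2 \<partial>G.P n) - real s * \<delta>\<bar> \<le> \<epsilon>'"
      if "0 < \<epsilon>'" for \<epsilon>'
    proof (cases s)
      case 0
      then show ?thesis using that by (simp add: G.zp_0)
    next
      case (Suc q)
      then show ?thesis using less.IH[of q \<epsilon>'] \<open>m = Suc s\<close> less.prems that by (simp add: G.zp_Suc)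
    qed
    have z1: "\<forall>\<^sub>F n in sequentially. \<forall>j\<in>V n. \<forall>c\<in>G.nb n j. \<bar>(\<integral>z. (G.zz n s j c z)\<^sup>2 \<partial>G.P n) - real (Suc s) * \<delta>\<bar> \<le> \<epsilon>'"
      if "0 < \<epsilon>'" for \<epsilon>' using less.IH[of s \<epsilon>'] Suc less.prems that by simp
    \<comment> \<open>An L2 error q of \<open>V2\<close> becomes \<epsilon> / 2 after multiplication
      by the bound K^2 on the square of \<open>A\<close>.\<close>
    define q where "q = \<epsilon> / (2 * K\<^sup>2)"
    have K0: "K > 0" by (rule G.Kpos)
    have q0: "q > 0" using less.prems K0 by (simp add: q_def)
    have e2: "0 < \<epsilon> / 2" and q2: "0 < q\<^sup>2" using less.prems q0 by auto
    have Vl: "\<forall>\<^sub>F n in sequentially. \<forall>i\<in>V n. \<forall>a\<in>G.nb n i. (\<integral>z. (G.V2 n (Suc s) i a z - nu r f \<delta> (Suc s))\<^sup>2 \<partial>G.P n) \<le> q\<^sup>2"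
      by (rule V2_lim[OF s z1 z2 q2])
    show ?thesis
      using z1[OF e2] Vl
    proof eventually_elim
      case (elim n)
      show ?case
      proof (intro ballI)
        fix j c assume j: "j \<in> V n" "c \<in> G.nb n j"
        have pd: "G.pg n (\<lambda>z. G.V2 n (Suc s) j c z - \<nu>)" using s j by (intro G.pg_diff G.pg_V2 G.pg_const) auto
        have "(\<integral>z. \<bar>G.V2 n (Suc s) j c z - \<nu>\<bar> \<partial>G.P n) \<le> sqrt (\<integral>z. (G.V2 n (Suc s) j c z - \<nu>)\<^sup>2 \<partial>G.P n)"
          by (rule G.L1_le_L2[OF pd])
        also have "\<dots> \<le> sqrt (q\<^sup>2)" using elim j by (intro real_sqrt_le_mono) (auto simp: \<nu>_def)
        also have "\<dots> = q" using q0 by simp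
        finally have "K\<^sup>2 * (\<integral>z. \<bar>G.V2 n (Suc s) j c z - \<nu>\<bar> \<partial>G.P n) \<le> K\<^sup>2 * q" by (rule mult_left_mono) simp
        also have "\<dots> = \<epsilon> / 2" using K0 by (simp add: q_def)
        finally have 1: "\<bar>(\<integral>z. (G.zz n (Suc s) j c z)\<^sup>2 \<partial>G.P n) - (\<integral>z. (G.zz n s j c z)\<^sup>2 \<partial>G.P n) - \<nu> * (\<integral>z. (G.A n s j c z)\<^sup>2 \<partial>G.P n)\<bar> \<le> \<epsilon> / 2"
          using G.second_moment_zz_diff[OF s j(1), of c \<nu>] by linarith
        have 2: "\<nu> * (\<integral>z. (G.A n s j c z)\<^sup>2 \<partial>G.P n) = \<delta>" using A2[OF s j] nu0 by (simp add: \<nu>_def)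
        have 3: "\<bar>(\<integral>z. (G.zz n s j c z)\<^sup>2 \<partial>G.P n) - real (Suc s) * \<delta>\<bar> \<le> \<epsilon> / 2" using elim j by blast
        have 4: "real (Suc m) * \<delta> = real (Suc s) * \<delta> + \<delta>" by (simp add: Suc algebra_simps)
        show "\<bar>(\<integral>z. (G.zz n m j c z)\<^sup>2 \<partial>G.P n) - real (Suc m) * \<delta>\<bar> \<le> \<epsilon>"
          unfolding 4 unfolding Suc using 1 2 3 by linarith
      qed
    qed
  qed
qed

lemma V2_limit:
  assumes m: "m < L" and \<eta>: "0 < \<eta>"
  shows "\<forall>\<^sub>F n in sequentially. \<forall>i\<in>V n. \<forall>a\<in>G.nb n i. (\<integral>z. (G.V2 n (Suc m) i a z - nu r f \<delta> (Suc m))\<^sup>2 \<partial>G.P n) \<le> \<eta>"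
proof (rule V2_lim[OF m _ _ \<eta>])
  show "\<forall>\<^sub>F n in sequentially. \<forall>j\<in>V n. \<forall>c\<in>G.nb n j. \<bar>(\<integral>z. (G.zz n m j c z)\<^sup>2 \<partial>G.P n) - real (Suc m) * \<delta>\<bar> \<le> \<epsilon>"
    if "0 < \<epsilon>" for \<epsilon> using zz_lim[of m \<epsilon>] m that by simp
  show "\<forall>\<^sub>F n in sequentially. \<forall>j\<in>V n. \<forall>c\<in>G.nb n j. \<bar>(\<integral>z. (G.zp n m j c z)\<^sup>2 \<partial>G.P n) - real m * \<delta>\<bar> \<le> \<epsilon>"
    if "0 < \<epsilon>" for \<epsilon>
  proof (cases m)
    case 0
    then show ?thesis using that by (simp add: G.zp_0)
  next
    case (Suc q)
    then show ?thesis using zz_lim[of q \<epsilon>] m that by (simp add: G.zp_Suc)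
  qed
qed

end

subsection \<open>Characteristic functions of sums of independent variables\<close>

text \<open>For the upper bound on exp (-x): the product of 1 - x + x^2/2 and 1 + x + x^2/2 is 1 +
  x^4/4, so the first polynomial exceeds the reciprocal of the second, which in turn is at least exp
  (-x).\<close>

lemma exp_minus_quadratic:
  fixes x :: real
  assumes "0 \<le> x"
  shows "\<bar>1 - x - exp (- x)\<bar> \<le> x\<^sup>2 / 2"
proof -
  have 1: "1 - x \<le> exp (- x)" using exp_ge_add_one_self[of "- x"] by simp
  have q: "1 + x + x\<^sup>2 / 2 \<le> exp x" using exp_lower_Taylor_quadratic[OF assms] .
  have "(1 - x + x\<^sup>2 / 2) * (1 + x + x\<^sup>2 / 2) = 1 + (x\<^sup>2)\<^sup>2 / 4"
    by (simp add: algebra_simps power2_eq_square)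
  then have "1 \<le> (1 - x + x\<^sup>2 / 2) * (1 + x + x\<^sup>2 / 2)" by simp
  also have "\<dots> \<le> (1 - x + x\<^sup>2 / 2) * exp x"
  proof (rule mult_left_mono[OF q])
    have "0 \<le> (x - 1)\<^sup>2 + 1" by simp
    then show "0 \<le> 1 - x + x\<^sup>2 / 2" by (simp add: power2_eq_square algebra_simps)
  qed
  finally have "exp (- x) \<le> 1 - x + x\<^sup>2 / 2" by (simp add: exp_minus field_simps)
  then show ?thesis using 1 by simp
qed

lemma exp_minus_lipschitz:
  fixes a b :: real
  assumes "0 \<le> a" "0 \<le> b"
  shows "\<bar>exp (- a) - exp (- b)\<bar> \<le> \<bar>a - b\<bar>"
proof -
  have *: "exp (- a) - exp (- b) \<le> b - a" if "0 \<le> a" "a \<le> b" for a b :: real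
  proof -
    have "exp (- a) - exp (- b) = exp (- a) * (1 - exp (a - b))"
      by (simp add: right_diff_distrib exp_add[symmetric])
    also have "\<dots> \<le> 1 * (b - a)"
    proof (rule mult_mono)
      show "1 - exp (a - b) \<le> b - a" using exp_ge_add_one_self[of "a - b"] by linarith
    qed (use that in auto)
    finally show ?thesis by simp
  qed
  show ?thesis
  proof (cases "a \<le> b")
    case True
    then show ?thesis using *[of a b] assms by simp
  next
    case False
    then show ?thesis using *[of b a] assms by simp
  qed
qed

text \<open>Lindeberg's comparison: each factor is compared with a Gaussian one through the common
  Taylor polynomial, the product is exchanged factor by factor, and the resulting Gaussian is
  compared with the target. All errors are put under one polynomial in t, so that a single scalar
  measures the distance.\<close>

lemma (in prob_space) char_sum_close:
  assumes I: "finite I" and ind: "indep_vars (\<lambda>_. borel) X I"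
    and int: "\<And>b. b \<in> I \<Longrightarrow> integrable M (X b)" "\<And>b. b \<in> I \<Longrightarrow> integrable M (\<lambda>\<omega>. (X b \<omega>)\<^sup>2)"
      "\<And>b. b \<in> I \<Longrightarrow> integrable M (\<lambda>\<omega>. \<bar>X b \<omega>\<bar> ^ 3)"
    and mean: "\<And>b. b \<in> I \<Longrightarrow> expectation (X b) = 0" and \<nu>: "0 \<le> \<nu>"
  defines "s \<equiv> \<lambda>b. expectation (\<lambda>\<omega>. (X b \<omega>)\<^sup>2)"
  shows "cmod (char (distr M borel (\<lambda>\<omega>. \<Sum>b\<in>I. X b \<omega>)) t - of_real (exp (- (\<nu> * t\<^sup>2) / 2)))
     \<le> (t\<^sup>2 + \<bar>t\<bar> ^ 3 + t ^ 4) * (\<bar>(\<Sum>b\<in>I. s b) - \<nu>\<bar> + (\<Sum>b\<in>I. expectation (\<lambda>\<omega>. \<bar>X b \<omega>\<bar> ^ 3)) + (\<Sum>b\<in>I. (s b)\<^sup>2))"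
proof -
  have rv: "random_variable borel (X b)" if "b \<in> I" for b using int(1)[OF that] by simp
  have s0: "0 \<le> s b" for b unfolding s_def by (rule Bochner_Integration.integral_nonneg) simp
  define \<phi> where "\<phi> b = char (distr M borel (X b)) t" for b
  define g where "g b = complex_of_real (exp (- (t\<^sup>2 * s b / 2)))" for b
  have \<phi>1: "cmod (\<phi> b) \<le> 1" if "b \<in> I" for b
  proof -
    interpret D: real_distribution "distr M borel (X b)" using rv[OF that] by (rule real_distribution_distr)
    show ?thesis unfolding \<phi>_def by (rule D.cmod_char_le_1)
  qed
  have g1: "cmod (g b) \<le> 1" for b unfolding g_def using s0[of b] by simp
  have \<phi>g: "cmod (\<phi> b - g b) \<le> \<bar>t\<bar> ^ 3 * expectation (\<lambda>\<omega>. \<bar>X b \<omega>\<bar> ^ 3) + t ^ 4 * (s b)\<^sup>2" if b: "b \<in> I" for b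
  proof -
    have var: "variance (X b) = s b" by (simp add: mean[OF b] s_def)
    have "cmod (\<phi> b - (1 - t\<^sup>2 * s b / 2)) \<le> t\<^sup>2 / 6 * expectation (\<lambda>\<omega>. min (6 * (X b \<omega>)\<^sup>2) (\<bar>t\<bar> * \<bar>X b \<omega>\<bar> ^ 3))"
      unfolding \<phi>_def by (rule char_approx3'[OF rv[OF b] int(1,2)[OF b] mean[OF b] var refl])
    also have "\<dots> \<le> t\<^sup>2 / 6 * expectation (\<lambda>\<omega>. \<bar>t\<bar> * \<bar>X b \<omega>\<bar> ^ 3)"
    proof (intro mult_left_mono integral_mono)
      have [measurable]: "random_variable borel (X b)" by (rule rv[OF b])
      show i: "integrable M (\<lambda>\<omega>. \<bar>t\<bar> * \<bar>X b \<omega>\<bar> ^ 3)" using int(3)[OF b] by simp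
      show "integrable M (\<lambda>\<omega>. min (6 * (X b \<omega>)\<^sup>2) (\<bar>t\<bar> * \<bar>X b \<omega>\<bar> ^ 3))"
        by (rule Bochner_Integration.integrable_bound[OF i]) auto
    qed auto
    also have "\<dots> = \<bar>t\<bar> ^ 3 / 6 * expectation (\<lambda>\<omega>. \<bar>X b \<omega>\<bar> ^ 3)"
      by (simp add: power3_eq_cube power2_eq_square abs_mult[symmetric])
    also have "\<dots> \<le> \<bar>t\<bar> ^ 3 * expectation (\<lambda>\<omega>. \<bar>X b \<omega>\<bar> ^ 3)"
      by (intro mult_right_mono Bochner_Integration.integral_nonneg) auto
    finally have a: "cmod (\<phi> b - (1 - t\<^sup>2 * s b / 2)) \<le> \<bar>t\<bar> ^ 3 * expectation (\<lambda>\<omega>. \<bar>X b \<omega>\<bar> ^ 3)" .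
    have "cmod ((1 - t\<^sup>2 * s b / 2) - g b) = \<bar>1 - t\<^sup>2 * s b / 2 - exp (- (t\<^sup>2 * s b / 2))\<bar>"
      unfolding g_def by (metis norm_of_real of_real_1 of_real_diff)
    also have "\<dots> \<le> (t\<^sup>2 * s b / 2)\<^sup>2 / 2" using s0[of b] by (intro exp_minus_quadratic) simp
    also have "\<dots> \<le> t ^ 4 * (s b)\<^sup>2" by (simp add: power_mult_distrib power_divide flip: power_mult)
    finally have "cmod ((1 - t\<^sup>2 * s b / 2) - g b) \<le> t ^ 4 * (s b)\<^sup>2" .
    then show ?thesis using a norm_triangle_ineq[of "\<phi> b - (1 - t\<^sup>2 * s b / 2)" "(1 - t\<^sup>2 * s b / 2) - g b"] by simp
  qed
  have "char (distr M borel (\<lambda>\<omega>. \<Sum>b\<in>I. X b \<omega>)) t = (\<Prod>b\<in>I. \<phi> b)"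
    unfolding \<phi>_def by (rule char_distr_sum[OF ind])
  then have "cmod (char (distr M borel (\<lambda>\<omega>. \<Sum>b\<in>I. X b \<omega>)) t - (\<Prod>b\<in>I. g b)) \<le> (\<Sum>b\<in>I. cmod (\<phi> b - g b))"
    using norm_prod_diff[of I \<phi> g] \<phi>1 g1 by simp
  also have "\<dots> \<le> (\<Sum>b\<in>I. \<bar>t\<bar> ^ 3 * expectation (\<lambda>\<omega>. \<bar>X b \<omega>\<bar> ^ 3) + t ^ 4 * (s b)\<^sup>2)"
    by (rule sum_mono[OF \<phi>g])
  also have "\<dots> = \<bar>t\<bar> ^ 3 * (\<Sum>b\<in>I. expectation (\<lambda>\<omega>. \<bar>X b \<omega>\<bar> ^ 3)) + t ^ 4 * (\<Sum>b\<in>I. (s b)\<^sup>2)"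
    by (simp add: sum.distrib sum_distrib_left)
  finally have 1: "cmod (char (distr M borel (\<lambda>\<omega>. \<Sum>b\<in>I. X b \<omega>)) t - (\<Prod>b\<in>I. g b))
      \<le> \<bar>t\<bar> ^ 3 * (\<Sum>b\<in>I. expectation (\<lambda>\<omega>. \<bar>X b \<omega>\<bar> ^ 3)) + t ^ 4 * (\<Sum>b\<in>I. (s b)\<^sup>2)" .
  have "(\<Prod>b\<in>I. g b) = of_real (exp (- (t\<^sup>2 * (\<Sum>b\<in>I. s b) / 2)))"
    unfolding g_def using I by (simp add: exp_sum[symmetric] sum_negf sum_divide_distrib sum_distrib_left flip: of_real_prod)
  then have "cmod ((\<Prod>b\<in>I. g b) - of_real (exp (- (\<nu> * t\<^sup>2) / 2))) = \<bar>exp (- (t\<^sup>2 * (\<Sum>b\<in>I. s b) / 2)) - exp (- (\<nu> * t\<^sup>2 / 2))\<bar>"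
    by (simp flip: of_real_diff)
  also have "\<dots> \<le> \<bar>t\<^sup>2 * (\<Sum>b\<in>I. s b) / 2 - \<nu> * t\<^sup>2 / 2\<bar>"
    using \<nu> s0 by (intro exp_minus_lipschitz) (auto intro!: mult_nonneg_nonneg sum_nonneg)
  also have "\<dots> = t\<^sup>2 / 2 * \<bar>(\<Sum>b\<in>I. s b) - \<nu>\<bar>"
  proof -
    have "t\<^sup>2 * (\<Sum>b\<in>I. s b) / 2 - \<nu> * t\<^sup>2 / 2 = t\<^sup>2 / 2 * ((\<Sum>b\<in>I. s b) - \<nu>)" by (simp add: field_simps)
    then show ?thesis by (simp only: abs_mult) simp
  qed
  also have "\<dots> \<le> t\<^sup>2 * \<bar>(\<Sum>b\<in>I. s b) - \<nu>\<bar>" by (intro mult_right_mono) auto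
  finally have 2: "cmod ((\<Prod>b\<in>I. g b) - of_real (exp (- (\<nu> * t\<^sup>2) / 2))) \<le> t\<^sup>2 * \<bar>(\<Sum>b\<in>I. s b) - \<nu>\<bar>" .
  define T where "T = t\<^sup>2 + \<bar>t\<bar> ^ 3 + t ^ 4"
  have t4: "0 \<le> t ^ 4" by (rule zero_le_even_power) simp
  have T: "t\<^sup>2 \<le> T" "\<bar>t\<bar> ^ 3 \<le> T" "t ^ 4 \<le> T" unfolding T_def using t4 by auto
  have m3: "0 \<le> (\<Sum>b\<in>I. expectation (\<lambda>\<omega>. \<bar>X b \<omega>\<bar> ^ 3))" by (intro sum_nonneg Bochner_Integration.integral_nonneg) simp
  have "cmod (char (distr M borel (\<lambda>\<omega>. \<Sum>b\<in>I. X b \<omega>)) t - of_real (exp (- (\<nu> * t\<^sup>2) / 2)))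
     \<le> t\<^sup>2 * \<bar>(\<Sum>b\<in>I. s b) - \<nu>\<bar> + \<bar>t\<bar> ^ 3 * (\<Sum>b\<in>I. expectation (\<lambda>\<omega>. \<bar>X b \<omega>\<bar> ^ 3)) + t ^ 4 * (\<Sum>b\<in>I. (s b)\<^sup>2)"
    using 1 2 norm_triangle_ineq[of "char (distr M borel (\<lambda>\<omega>. \<Sum>b\<in>I. X b \<omega>)) t - (\<Prod>b\<in>I. g b)" "(\<Prod>b\<in>I. g b) - of_real (exp (- (\<nu> * t\<^sup>2) / 2))"]
    by simp
  also have "\<dots> \<le> T * \<bar>(\<Sum>b\<in>I. s b) - \<nu>\<bar> + T * (\<Sum>b\<in>I. expectation (\<lambda>\<omega>. \<bar>X b \<omega>\<bar> ^ 3)) + T * (\<Sum>b\<in>I. (s b)\<^sup>2)"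
    using T m3 by (intro add_mono mult_right_mono) (auto intro: sum_nonneg)
  finally show ?thesis by (simp add: T_def distrib_left)
qed

context amp
begin

text \<open>The scalar error of \<open>char_sum_close\<close> for the conditional law, with the
  normalisation inserted: third moments are divided by the cube of sqrt (d - 1), squared variances
  by its fourth power.\<close>

definition "Qerr m i a z = \<bar>V2 (Suc m) i a z - nu r f \<delta> (Suc m)\<bar>
   + (\<Sum>b\<in>nb i - {a}. CE (lf (Suc m) i a) (\<lambda>z. \<bar>Y m b i z\<bar> ^ 3) z) / sqrt (real d - 1) ^ 3
   + (\<Sum>b\<in>nb i - {a}. (sg m b i a z)\<^sup>2) / (real d - 1)\<^sup>2"

text \<open>With z frozen outside the leaves, the summands become independent centred functions of
  the resampled coordinates, and their second moments add up to \<open>V2\<close>.\<close>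

lemma cond_char_close:
  assumes m: "m < L" and i: "i \<in> V" and z: "z \<in> space P" and d: "d \<ge> 2" and \<nu>: "0 \<le> nu r f \<delta> (Suc m)"
  shows "cmod (char (distr P borel (\<lambda>y. u (Suc m) i a (rs (lf (Suc m) i a) z y))) t - of_real (exp (- (nu r f \<delta> (Suc m) * t\<^sup>2) / 2)))
     \<le> (t\<^sup>2 + \<bar>t\<bar> ^ 3 + t ^ 4) * Qerr m i a z"
proof -
  let ?I = "nb i - {a}" and ?\<Lambda> = "lf (Suc m) i a"
  define D where "D = real d - 1"
  have D1: "D \<ge> 1" using d by (simp add: D_def)
  define X where "X b y = Y m b i (rs ?\<Lambda> z y) / sqrt D" for b y
  have pY: "pg (Y m b i)" if "b \<in> ?I" for b using m that by (intro pg_Y) auto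
  have pX: "pg (X b)" if "b \<in> ?I" for b unfolding X_def[abs_def] by (rule pg_divide[OF pg_rs[OF pY[OF that] z]])
  have I: "finite ?I" using finite_nb by simp
  have dX: "dep (bs m b i) (X b)" for b
    unfolding X_def[abs_def] using m by (intro dep_compose[where F = "\<lambda>x. x / sqrt D", OF dep_rs[OF dep_Y]]) simp
  have ind: "P.indep_vars (\<lambda>_. borel) X ?I"
    by (rule indep_dep[where D = "\<lambda>b. bs m b i"])
      (use pX dX bs_V disjoint_family_on_mono[OF Diff_subset bs_disjoint[OF m]] in \<open>auto dest: pg_measurable\<close>)
  have mean: "(\<integral>y. X b y \<partial>P) = 0" if "b \<in> ?I" for b
    using CE_Y[OF m that z] unfolding X_def CE_def by simp
  have sq: "(\<integral>y. (X b y)\<^sup>2 \<partial>P) = sg m b i a z / D" for b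
    unfolding X_def sg_def CE_def power_divide using D1 by simp
  have cub: "(\<integral>y. \<bar>X b y\<bar> ^ 3 \<partial>P) = CE ?\<Lambda> (\<lambda>z. \<bar>Y m b i z\<bar> ^ 3) z / sqrt D ^ 3" for b
    unfolding X_def CE_def using D1 by (simp add: abs_divide power_divide)
  have u: "(\<lambda>y. u (Suc m) i a (rs ?\<Lambda> z y)) = (\<lambda>y. \<Sum>b\<in>?I. X b y)"
    by (simp add: u_Suc X_def D_def sum_divide_distrib)
  have V: "(\<Sum>b\<in>?I. sg m b i a z / D) = V2 (Suc m) i a z"
    using V2_eq[OF m i z, of a] d by (simp add: D_def sum_divide_distrib)
  have "cmod (char (distr P borel (\<lambda>y. \<Sum>b\<in>?I. X b y)) t - of_real (exp (- (nu r f \<delta> (Suc m) * t\<^sup>2) / 2)))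
     \<le> (t\<^sup>2 + \<bar>t\<bar> ^ 3 + t ^ 4) * (\<bar>(\<Sum>b\<in>?I. \<integral>y. (X b y)\<^sup>2 \<partial>P) - nu r f \<delta> (Suc m)\<bar>
        + (\<Sum>b\<in>?I. \<integral>y. \<bar>X b y\<bar> ^ 3 \<partial>P) + (\<Sum>b\<in>?I. (\<integral>y. (X b y)\<^sup>2 \<partial>P)\<^sup>2))"
    by (rule P.char_sum_close[OF I ind _ _ _ mean \<nu>])
      (auto intro!: pg_integrable[OF pX] pg_integrable[OF pg_power[OF pX]] pg_integrable[OF pg_power[OF pg_abs[OF pX]]])
  then show ?thesis
    unfolding u sq cub V Qerr_def by (simp add: D_def sum_divide_distrib power_divide)
qed

lemma pg_Qerr: assumes "m < L" "i \<in> V" shows "pg (Qerr m i a)"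
proof -
  have pY: "pg (Y m b i)" if "b \<in> nb i - {a}" for b using assms that by (intro pg_Y) auto
  have 1: "pg (\<lambda>z. \<bar>V2 (Suc m) i a z - nu r f \<delta> (Suc m)\<bar>)" using assms by (intro pg_abs pg_diff pg_V2 pg_const) auto
  have 2: "pg (\<lambda>z. (\<Sum>b\<in>nb i - {a}. CE (lf (Suc m) i a) (\<lambda>z. \<bar>Y m b i z\<bar> ^ 3) z) / sqrt (real d - 1) ^ 3)"
    by (intro pg_divide pg_sum pg_CE[OF pg_power[OF pg_abs[OF pY]]])
  have 3: "pg (\<lambda>z. (\<Sum>b\<in>nb i - {a}. (sg m b i a z)\<^sup>2) / (real d - 1)\<^sup>2)"
    unfolding sg_def by (intro pg_divide pg_sum pg_power[OF pg_CE[OF pg_power[OF pY]]])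
  show ?thesis unfolding Qerr_def[abs_def] by (rule pg_add[OF pg_add[OF 1 2] 3])
qed

text \<open>Both sums have d - 1 terms of bounded expectation, which leaves the inverse square root
  of d - 1 and the inverse of d - 1. The third absolute moment is at most 1 plus the fourth
  moment.\<close>

lemma expectation_Qerr:
  assumes m: "m < L" and i: "i \<in> V" and a: "a \<in> nb i" and d: "d \<ge> 2" and B0: "0 \<le> B"
    and B: "\<And>b. b \<in> nb i \<Longrightarrow> (\<integral>z. Y m b i z ^ 4 \<partial>P) \<le> B"
  shows "(\<integral>z. Qerr m i a z \<partial>P) \<le> sqrt (\<integral>z. (V2 (Suc m) i a z - nu r f \<delta> (Suc m))\<^sup>2 \<partial>P)
     + (1 + B) / sqrt (real d - 1) + B / (real d - 1)"
proof -
  let ?I = "nb i - {a}" and ?\<Lambda> = "lf (Suc m) i a"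
  define D where "D = real d - 1"
  have D1: "D \<ge> 1" using d by (simp add: D_def)
  have cI: "real (card ?I) = D" unfolding D_def using card_nb[OF i] a finite_nb d
    by (simp add: card_Diff_singleton of_nat_diff)
  have pY: "pg (Y m b i)" if "b \<in> ?I" for b using m that by (intro pg_Y) auto
  have pd: "pg (\<lambda>z. V2 (Suc m) i a z - nu r f \<delta> (Suc m))" using m i by (intro pg_diff pg_V2 pg_const) auto
  have p3: "pg (\<lambda>z. \<bar>Y m b i z\<bar> ^ 3)" if "b \<in> ?I" for b by (rule pg_power[OF pg_abs[OF pY[OF that]]])
  have ps: "pg (sg m b i a)" if "b \<in> ?I" for b unfolding sg_def by (rule pg_CE[OF pg_power[OF pY[OF that]]])
  have i1: "integrable P (\<lambda>z. \<bar>V2 (Suc m) i a z - nu r f \<delta> (Suc m)\<bar>)" by (rule pg_integrable[OF pg_abs[OF pd]])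
  have i2: "integrable P (CE ?\<Lambda> (\<lambda>z. \<bar>Y m b i z\<bar> ^ 3))" if "b \<in> ?I" for b by (rule pg_integrable[OF pg_CE[OF p3[OF that]]])
  have i3: "integrable P (\<lambda>z. (sg m b i a z)\<^sup>2)" if "b \<in> ?I" for b by (rule pg_integrable[OF pg_power[OF ps[OF that]]])
  have eq: "(\<integral>z. Qerr m i a z \<partial>P) = (\<integral>z. \<bar>V2 (Suc m) i a z - nu r f \<delta> (Suc m)\<bar> \<partial>P)
     + (\<Sum>b\<in>?I. \<integral>z. CE ?\<Lambda> (\<lambda>z. \<bar>Y m b i z\<bar> ^ 3) z \<partial>P) / sqrt D ^ 3 + (\<Sum>b\<in>?I. \<integral>z. (sg m b i a z)\<^sup>2 \<partial>P) / D\<^sup>2"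
  proof -
    have j2: "integrable P (\<lambda>z. (\<Sum>b\<in>?I. CE ?\<Lambda> (\<lambda>z. \<bar>Y m b i z\<bar> ^ 3) z) / sqrt D ^ 3)"
      by (intro integrable_divide Bochner_Integration.integrable_sum i2)
    have s2: "(\<integral>z. (\<Sum>b\<in>?I. CE ?\<Lambda> (\<lambda>z. \<bar>Y m b i z\<bar> ^ 3) z) \<partial>P) = (\<Sum>b\<in>?I. \<integral>z. CE ?\<Lambda> (\<lambda>z. \<bar>Y m b i z\<bar> ^ 3) z \<partial>P)"
      by (rule Bochner_Integration.integral_sum[OF i2])
    have s3: "(\<integral>z. (\<Sum>b\<in>?I. (sg m b i a z)\<^sup>2) \<partial>P) = (\<Sum>b\<in>?I. \<integral>z. (sg m b i a z)\<^sup>2 \<partial>P)"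
      by (rule Bochner_Integration.integral_sum[OF i3])
    have j3: "integrable P (\<lambda>z. (\<Sum>b\<in>?I. (sg m b i a z)\<^sup>2) / D\<^sup>2)"
      by (intro integrable_divide Bochner_Integration.integrable_sum i3)
    show ?thesis
      unfolding Qerr_def D_def[symmetric] Bochner_Integration.integral_add[OF Bochner_Integration.integrable_add[OF i1 j2] j3]
        Bochner_Integration.integral_add[OF i1 j2] integral_divide_zero s2 s3 by (rule refl)
  qed
  have c: "(\<integral>z. CE ?\<Lambda> (\<lambda>z. \<bar>Y m b i z\<bar> ^ 3) z \<partial>P) \<le> 1 + B" if b: "b \<in> ?I" for b
  proof -
    have "(\<integral>z. CE ?\<Lambda> (\<lambda>z. \<bar>Y m b i z\<bar> ^ 3) z \<partial>P) = (\<integral>z. \<bar>Y m b i z\<bar> ^ 3 \<partial>P)" by (rule expectation_CE[OF p3[OF b]])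
    also have "\<dots> \<le> (\<integral>z. 1 + Y m b i z ^ 4 \<partial>P)"
    proof (rule integral_mono[OF pg_integrable[OF p3[OF b]] pg_integrable[OF pg_add[OF pg_const pg_power[OF pY[OF b]]]]])
      fix z
      show "\<bar>Y m b i z\<bar> ^ 3 \<le> 1 + Y m b i z ^ 4"
      proof (cases "\<bar>Y m b i z\<bar> \<le> 1")
        case True
        then have "\<bar>Y m b i z\<bar> ^ 3 \<le> 1" by (intro power_le_one) auto
        moreover have "0 \<le> Y m b i z ^ 4" by (rule zero_le_even_power) simp
        ultimately show ?thesis by linarith
      next
        case False
        then have "\<bar>Y m b i z\<bar> ^ 3 \<le> \<bar>Y m b i z\<bar> ^ 4" by (intro power_increasing) auto
        then show ?thesis by (simp add: power_even_abs)
      qed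
    qed
    also have "\<dots> = 1 + (\<integral>z. Y m b i z ^ 4 \<partial>P)" using pg_integrable[OF pg_power[OF pY[OF b]], of 4] by (simp add: P.prob_space)
    also have "\<dots> \<le> 1 + B" using B[of b] b by simp
    finally show ?thesis .
  qed
  have s: "(\<integral>z. (sg m b i a z)\<^sup>2 \<partial>P) \<le> B" if b: "b \<in> ?I" for b
    using second_moment_sg[OF m, of b i a] B[of b] b by simp
  have "(\<Sum>b\<in>?I. \<integral>z. CE ?\<Lambda> (\<lambda>z. \<bar>Y m b i z\<bar> ^ 3) z \<partial>P) \<le> (\<Sum>b\<in>?I. 1 + B)" by (rule sum_mono[OF c])
  also have "\<dots> = D * (1 + B)" by (simp only: sum_constant cI)
  finally have "(\<Sum>b\<in>?I. \<integral>z. CE ?\<Lambda> (\<lambda>z. \<bar>Y m b i z\<bar> ^ 3) z \<partial>P) / sqrt D ^ 3 \<le> D * (1 + B) / sqrt D ^ 3"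
    using D1 by (intro divide_right_mono) auto
  also have "\<dots> = (1 + B) / sqrt D"
  proof -
    have "sqrt D ^ 3 = D * sqrt D" using D1 by (simp add: power3_eq_cube)
    then show ?thesis using D1 by simp
  qed
  finally have c': "(\<Sum>b\<in>?I. \<integral>z. CE ?\<Lambda> (\<lambda>z. \<bar>Y m b i z\<bar> ^ 3) z \<partial>P) / sqrt D ^ 3 \<le> (1 + B) / sqrt D" .
  have "(\<Sum>b\<in>?I. \<integral>z. (sg m b i a z)\<^sup>2 \<partial>P) \<le> (\<Sum>b\<in>?I. B)" by (rule sum_mono[OF s])
  also have "\<dots> = D * B" by (simp only: sum_constant cI)
  finally have "(\<Sum>b\<in>?I. \<integral>z. (sg m b i a z)\<^sup>2 \<partial>P) / D\<^sup>2 \<le> D * B / D\<^sup>2" by (intro divide_right_mono) auto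
  also have "\<dots> = B / D" using D1 by (simp add: power2_eq_square)
  finally show ?thesis unfolding eq using c' L1_le_L2[OF pd] by (simp add: D_def)
qed

end

subsection \<open>The Gaussian coupling\<close>

text \<open>The noise \<open>e * h\<close> makes the conditional law of \<open>u + e * h\<close> given the coordinates outside
  \<open>\<Lambda>\<close> atomless, so that the monotone transport of that law to the Gaussian is a function of
  \<open>u + e * h\<close> and no further randomisation is needed.\<close>

locale coupling = gauss V \<delta> for V :: "'v set" and \<delta> :: real +
  fixes u :: "('v \<Rightarrow> real) \<Rightarrow> real" and \<Lambda> :: "'v set" and e \<nu> :: real
  assumes pgu: "pg u" and e0: "0 < e" and nu0: "0 < \<nu>"
begin

abbreviation "N1 \<equiv> std_normal_distribution"
definition "M = P \<Otimes>\<^sub>M N1"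
text \<open>The conditional law of the smoothed increment; it and the transport \<open>T z\<close>
  depend on \<open>z\<close> only through the coordinates outside \<Lambda> (\<open>law_rs\<close>,
  \<open>T_rs\<close>).\<close>

definition "law z = distr M borel (\<lambda>x. u (rs \<Lambda> z (fst x)) + e * snd x)"
definition "T z t = quant \<nu> (cdf (law z) t)"
definition "U \<omega> = T (fst \<omega>) (u (fst \<omega>) + e * snd \<omega>)"

sublocale N1: real_distribution N1 by (rule real_dist_normal_dist)

sublocale PN: pair_prob_space P N1
  by (simp add: pair_prob_space_def pair_sigma_finite_def prob_P prob_space_imp_sigma_finite N1.prob_space_axioms)

lemma prob_M: "prob_space M"
  unfolding M_def by (rule PN.prob_space_axioms)

lemma space_M: "\<omega> \<in> space M \<longleftrightarrow> fst \<omega> \<in> space P"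
  by (cases \<omega>) (simp add: M_def space_pair_measure)

lemma measurable_u: "u \<in> borel_measurable P"
  using pgu by (rule pg_measurable)

lemma measurable_u_rs:
  assumes [measurable]: "f \<in> measurable X P" "g \<in> measurable X P" "h \<in> borel_measurable X"
  shows "(\<lambda>x. u (rs \<Lambda> (f x) (g x)) + e * h x) \<in> borel_measurable X"
proof -
  have [measurable]: "(\<lambda>x. u (rs \<Lambda> (f x) (g x))) \<in> borel_measurable X"
    by (rule measurable_compose[OF measurable_rs2[OF assms(1,2)] measurable_u])
  show ?thesis by measurable
qed

lemma measurable_fst_M: "fst \<in> measurable M P" and measurable_snd_M: "snd \<in> borel_measurable M"
  unfolding M_def by (auto intro: measurable_fst simp: measurable_snd'' cong: measurable_cong_sets)

lemma measurable_shift: "z \<in> space P \<Longrightarrow> (\<lambda>x. u (rs \<Lambda> z (fst x)) + e * snd x) \<in> borel_measurable M"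
  by (rule measurable_u_rs[OF measurable_const measurable_fst_M measurable_snd_M])

lemma real_distribution_law: "z \<in> space P \<Longrightarrow> real_distribution (law z)"
  unfolding law_def by (rule prob_space.real_distribution_distr[OF prob_M measurable_shift])

text \<open>For a fixed sample y at most one value of the noise hits t, and the Gaussian does not
  charge single points.\<close>

lemma law_null: assumes z: "z \<in> space P" shows "measure (law z) {t} = 0"
proof -
  let ?A = "(\<lambda>x. u (rs \<Lambda> z (fst x)) + e * snd x) -` {t} \<inter> space M"
  have A: "?A \<in> sets M" by (rule measurable_sets[OF measurable_shift[OF z]]) simp
  have "emeasure (law z) {t} = emeasure M ?A"
    unfolding law_def by (rule emeasure_distr[OF measurable_shift[OF z]]) simp
  also have "\<dots> = (\<integral>\<^sup>+y. emeasure N1 (Pair y -` ?A) \<partial>P)"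
    using A unfolding M_def by (rule N1.emeasure_pair_measure_alt)
  also have "\<dots> = (\<integral>\<^sup>+y. 0 \<partial>P)"
  proof (rule nn_integral_cong)
    fix y
    have "Pair y -` ?A \<subseteq> {(t - u (rs \<Lambda> z y)) / e}" using e0 by (auto simp: field_simps)
    then have "emeasure N1 (Pair y -` ?A) \<le> emeasure N1 {(t - u (rs \<Lambda> z y)) / e}" by (intro emeasure_mono) auto
    also have "\<dots> = 0" using emeasure_gv_singleton[of 1] by (simp add: gv_def)
    finally show "emeasure N1 (Pair y -` ?A) = 0" by simp
  qed
  finally show ?thesis by (simp add: measure_def)
qed

lemma law_rs: "law (rs \<Lambda> z y) = law z"
  unfolding law_def rs_rs ..

lemma T_rs: "T (rs \<Lambda> z y) t = T z t"
  unfolding T_def law_rs ..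

text \<open>The transport is evaluated at a random point with a random law, so joint measurability
  is needed; writing the distribution function as an integral of an indicator provides it.\<close>

lemma measurable_cdf_law: "(\<lambda>x. cdf (law (fst x)) (snd x)) \<in> borel_measurable (P \<Otimes>\<^sub>M borel)"
proof -
  have 1: "(\<lambda>x. u (rs \<Lambda> (fst (fst x)) (fst (snd x))) + e * snd (snd x)) \<in> borel_measurable ((P \<Otimes>\<^sub>M borel) \<Otimes>\<^sub>M M)"
    by (rule measurable_u_rs[OF measurable_compose[OF measurable_fst measurable_fst]
          measurable_compose[OF measurable_snd measurable_fst_M] measurable_compose[OF measurable_snd measurable_snd_M]])
  have 2: "(\<lambda>x. snd (fst x)) \<in> borel_measurable ((P \<Otimes>\<^sub>M borel) \<Otimes>\<^sub>M M)"
    by (rule measurable_compose[OF measurable_fst measurable_snd])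
  have "(\<lambda>x. if u (rs \<Lambda> (fst (fst x)) (fst (snd x))) + e * snd (snd x) \<le> snd (fst x) then 1 else 0 :: real)
      \<in> borel_measurable ((P \<Otimes>\<^sub>M borel) \<Otimes>\<^sub>M M)"
    by (intro measurable_If borel_measurable_le 1 2) simp_all
  then have m: "(\<lambda>x. \<integral>y. (if u (rs \<Lambda> (fst x) (fst y)) + e * snd y \<le> snd x then 1 else 0 :: real) \<partial>M) \<in> borel_measurable (P \<Otimes>\<^sub>M borel)"
    by (intro sigma_finite_measure.borel_measurable_lebesgue_integral prob_space_imp_sigma_finite prob_M) (simp add: split_beta')
  show ?thesis
  proof (rule measurable_cong[THEN iffD2, OF _ m])
    fix x assume "x \<in> space (P \<Otimes>\<^sub>M (borel :: real measure))"
    then have z: "fst x \<in> space P" by (auto simp: space_pair_measure)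
    let ?g = "\<lambda>y. u (rs \<Lambda> (fst x) (fst y)) + e * snd y"
    have s: "?g -` {..snd x} \<inter> space M \<in> sets M" by (rule measurable_sets[OF measurable_shift[OF z]]) simp
    have "cdf (law (fst x)) (snd x) = measure M (?g -` {..snd x} \<inter> space M)"
      unfolding cdf_def law_def by (rule measure_distr[OF measurable_shift[OF z]]) simp
    also have "\<dots> = (\<integral>y. indicat_real (?g -` {..snd x} \<inter> space M) y \<partial>M)"
      using sets.sets_into_space[OF s] by (simp add: Int_absorb2 Int_commute)
    also have "\<dots> = (\<integral>y. (if ?g y \<le> snd x then 1 else 0 :: real) \<partial>M)"
      by (rule Bochner_Integration.integral_cong[OF refl]) (auto simp: indicator_def)
    finally show "cdf (law (fst x)) (snd x) = (\<integral>y. (if ?g y \<le> snd x then 1 else 0 :: real) \<partial>M)" .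
  qed
qed

lemma measurable_T: "(\<lambda>x. T (fst x) (snd x)) \<in> borel_measurable (P \<Otimes>\<^sub>M borel)"
  unfolding T_def by (rule measurable_compose[OF measurable_cdf_law measurable_quant[OF nu0]])

lemma measurable_T1: "z \<in> space P \<Longrightarrow> T z \<in> borel_measurable borel"
  using measurable_compose[OF measurable_Pair1'[of z P borel] measurable_T] by simp

lemma measurable_shift_M: "(\<lambda>\<omega>. u (fst \<omega>) + e * snd \<omega>) \<in> borel_measurable M"
  by (intro borel_measurable_add borel_measurable_times borel_measurable_const measurable_snd_M
      measurable_compose[OF measurable_fst_M measurable_u])

lemma measurable_U: "U \<in> borel_measurable M"
  unfolding U_def[abs_def]
  using measurable_compose[OF measurable_Pair[OF measurable_fst_M measurable_shift_M] measurable_T] by simp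

text \<open>This holds because resampling the coordinates in \<open>\<Lambda>\<close> does not change the law of \<open>z\<close>.\<close>

lemma nn_integral_disintegrate:
  assumes F: "(\<lambda>x. F (fst x) (snd x)) \<in> borel_measurable (P \<Otimes>\<^sub>M borel)"
    and inv: "\<And>z y t. z \<in> space P \<Longrightarrow> y \<in> space P \<Longrightarrow> F (rs \<Lambda> z y) t = F z t"
  shows "(\<integral>\<^sup>+\<omega>. F (fst \<omega>) (u (fst \<omega>) + e * snd \<omega>) \<partial>M) = (\<integral>\<^sup>+z. (\<integral>\<^sup>+t. F z t \<partial>law z) \<partial>P)"
proof -
  have mF: "(\<lambda>\<omega>. F (fst \<omega>) (u (fst \<omega>) + e * snd \<omega>)) \<in> borel_measurable (P \<Otimes>\<^sub>M N1)"
    using measurable_compose[OF measurable_Pair[OF measurable_fst_M measurable_shift_M] F] by (simp add: M_def)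
  have m3: "(\<lambda>x. u (rs \<Lambda> (fst (fst x)) (snd x)) + e * snd (fst x)) \<in> borel_measurable ((P \<Otimes>\<^sub>M N1) \<Otimes>\<^sub>M P)"
    by (rule measurable_u_rs[OF measurable_compose[OF measurable_fst measurable_fst] measurable_snd])
      (use measurable_compose[OF measurable_fst measurable_snd_M, of P] in \<open>simp add: M_def\<close>)
  have mF3: "(\<lambda>x. F (fst (fst x)) (u (rs \<Lambda> (fst (fst x)) (snd x)) + e * snd (fst x))) \<in> borel_measurable ((P \<Otimes>\<^sub>M N1) \<Otimes>\<^sub>M P)"
    using measurable_compose[OF measurable_Pair[OF measurable_compose[OF measurable_fst measurable_fst] m3] F] by simp
  then have mF2: "(\<lambda>x. \<integral>\<^sup>+y. F (fst x) (u (rs \<Lambda> (fst x) y) + e * snd x) \<partial>P) \<in> borel_measurable (P \<Otimes>\<^sub>M N1)"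
    by (intro P.borel_measurable_nn_integral) (simp add: split_beta')
  have "(\<integral>\<^sup>+\<omega>. F (fst \<omega>) (u (fst \<omega>) + e * snd \<omega>) \<partial>M) = (\<integral>\<^sup>+h. \<integral>\<^sup>+z. F z (u z + e * h) \<partial>P \<partial>N1)"
    unfolding M_def using PN.nn_integral_snd[OF mF] by simp
  \<comment> \<open>The sample z is replaced by a resampled one, and invariance of \<open>F\<close>
    restores z in the first argument; integrating over y and h is then integration against
    \<open>law z\<close>.\<close>
  also have "\<dots> = (\<integral>\<^sup>+h. \<integral>\<^sup>+z. \<integral>\<^sup>+y. F z (u (rs \<Lambda> z y) + e * h) \<partial>P \<partial>P \<partial>N1)"
  proof (rule nn_integral_cong)
    fix h :: real
    have mh: "(\<lambda>z. F z (u z + e * h)) \<in> borel_measurable P"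
      using measurable_compose[OF measurable_Pair2'[of h N1 P] mF] by simp
    have "(\<integral>\<^sup>+z. F z (u z + e * h) \<partial>P) = (\<integral>\<^sup>+z. F z (u z + e * h) \<partial>distr (P \<Otimes>\<^sub>M P) P (\<lambda>(z, y). rs \<Lambda> z y))"
      by (simp add: rs_push)
    also have "\<dots> = (\<integral>\<^sup>+x. F (rs \<Lambda> (fst x) (snd x)) (u (rs \<Lambda> (fst x) (snd x)) + e * h) \<partial>(P \<Otimes>\<^sub>M P))"
      by (subst nn_integral_distr[OF measurable_rs]) (simp_all add: mh split_beta')
    also have "\<dots> = (\<integral>\<^sup>+z. \<integral>\<^sup>+y. F (rs \<Lambda> z y) (u (rs \<Lambda> z y) + e * h) \<partial>P \<partial>P)"
      using P.nn_integral_fst[OF measurable_compose[OF measurable_rs mh]] by (simp add: split_beta')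
    also have "\<dots> = (\<integral>\<^sup>+z. \<integral>\<^sup>+y. F z (u (rs \<Lambda> z y) + e * h) \<partial>P \<partial>P)"
      by (intro nn_integral_cong) (simp add: inv)
    finally show "(\<integral>\<^sup>+z. F z (u z + e * h) \<partial>P) = (\<integral>\<^sup>+z. \<integral>\<^sup>+y. F z (u (rs \<Lambda> z y) + e * h) \<partial>P \<partial>P)" .
  qed
  also have "\<dots> = (\<integral>\<^sup>+z. \<integral>\<^sup>+h. \<integral>\<^sup>+y. F z (u (rs \<Lambda> z y) + e * h) \<partial>P \<partial>N1 \<partial>P)"
    using mF2 by (intro PN.Fubini') (simp add: split_beta')
  also have "\<dots> = (\<integral>\<^sup>+z. \<integral>\<^sup>+t. F z t \<partial>law z \<partial>P)"
  proof (rule nn_integral_cong)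
    fix z assume z: "z \<in> space P"
    have mz: "F z \<in> borel_measurable borel"
      using measurable_compose[OF measurable_Pair1'[OF z] F] by simp
    have "(\<integral>\<^sup>+t. F z t \<partial>law z) = (\<integral>\<^sup>+x. F z (u (rs \<Lambda> z (fst x)) + e * snd x) \<partial>M)"
      unfolding law_def by (rule nn_integral_distr[OF measurable_shift[OF z]]) (simp add: mz)
    also have "\<dots> = (\<integral>\<^sup>+h. \<integral>\<^sup>+y. F z (u (rs \<Lambda> z y) + e * h) \<partial>P \<partial>N1)"
      using PN.nn_integral_snd[OF measurable_compose[OF measurable_shift[OF z, unfolded M_def] mz]]
      by (simp add: M_def)
    finally show "(\<integral>\<^sup>+h. \<integral>\<^sup>+y. F z (u (rs \<Lambda> z y) + e * h) \<partial>P \<partial>N1) = (\<integral>\<^sup>+t. F z t \<partial>law z)" ..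
  qed
  finally show ?thesis .
qed

lemma emeasure_law_T:
  assumes "z \<in> space P" "B \<in> sets borel"
  shows "(\<integral>\<^sup>+t. indicator B (T z t) \<partial>law z) = emeasure (gv \<nu>) B"
proof -
  have m: "T z \<in> measurable (law z) borel" using measurable_T1[OF assms(1)] by (simp add: law_def)
  have "(\<integral>\<^sup>+t. indicator B (T z t) \<partial>law z) = (\<integral>\<^sup>+x. indicator B x \<partial>distr (law z) borel (T z))"
    by (rule nn_integral_distr[OF m, symmetric]) (use assms in simp)
  also have "\<dots> = emeasure (distr (law z) borel (T z)) B" using assms by simp
  also have "distr (law z) borel (T z) = gv \<nu>"
    unfolding T_def[abs_def] by (rule quant_transform[OF nu0 real_distribution_law law_null]) (rule assms(1))+
  finally show ?thesis .
qed

text \<open>For every fixed z the transport sends \<open>law z\<close> to the same Gaussian. This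
  one factorisation yields both the law of \<open>U\<close> and its independence from the events
  outside \<Lambda>.\<close>

lemma emeasure_U:
  assumes a: "{z \<in> space P. a z} \<in> sets P" and inv: "\<And>z y. z \<in> space P \<Longrightarrow> y \<in> space P \<Longrightarrow> a (rs \<Lambda> z y) \<longleftrightarrow> a z"
    and B: "B \<in> sets borel"
  shows "emeasure M {\<omega> \<in> space M. a (fst \<omega>) \<and> U \<omega> \<in> B} = emeasure P {z \<in> space P. a z} * emeasure (gv \<nu>) B"
proof -
  define A where "A = {z \<in> space P. a z}"
  define F where "F z t = indicator A z * (indicator B (T z t) :: ennreal)" for z t
  have iA: "indicator A (rs \<Lambda> z y) = (indicator A z :: ennreal)" if "z \<in> space P" "y \<in> space P" for z y
    using inv[OF that] rs_in_space[OF that] that by (simp add: A_def indicator_def)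
  have mA: "indicator A \<in> borel_measurable P" using a by (simp add: A_def)
  have mB: "(\<lambda>x. indicator B (T (fst x) (snd x)) :: ennreal) \<in> borel_measurable (P \<Otimes>\<^sub>M borel)"
    by (rule measurable_compose[OF measurable_T]) (use B in simp)
  have mF: "(\<lambda>x. F (fst x) (snd x)) \<in> borel_measurable (P \<Otimes>\<^sub>M borel)"
    unfolding F_def by (intro borel_measurable_times_ennreal mB measurable_compose[OF measurable_fst mA])
  have s: "{\<omega> \<in> space M. a (fst \<omega>) \<and> U \<omega> \<in> B} \<in> sets M"
  proof -
    have "{\<omega> \<in> space M. a (fst \<omega>) \<and> U \<omega> \<in> B} = (fst -` A \<inter> space M) \<inter> (U -` B \<inter> space M)"
      by (auto simp: A_def space_M)
    then show ?thesis
      using measurable_sets[OF measurable_fst_M a] measurable_sets[OF measurable_U B] by (simp add: A_def)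
  qed
  have "emeasure M {\<omega> \<in> space M. a (fst \<omega>) \<and> U \<omega> \<in> B} = (\<integral>\<^sup>+\<omega>. indicator {\<omega> \<in> space M. a (fst \<omega>) \<and> U \<omega> \<in> B} \<omega> \<partial>M)"
    using s by simp
  also have "\<dots> = (\<integral>\<^sup>+\<omega>. F (fst \<omega>) (u (fst \<omega>) + e * snd \<omega>) \<partial>M)"
    by (rule nn_integral_cong) (auto simp: F_def A_def U_def indicator_def space_M)
  also have "\<dots> = (\<integral>\<^sup>+z. (\<integral>\<^sup>+t. F z t \<partial>law z) \<partial>P)"
    by (rule nn_integral_disintegrate[OF mF]) (simp add: F_def iA T_rs)
  also have "\<dots> = (\<integral>\<^sup>+z. indicator A z * emeasure (gv \<nu>) B \<partial>P)"
  proof (rule nn_integral_cong)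
    fix z assume z: "z \<in> space P"
    have "(\<integral>\<^sup>+t. F z t \<partial>law z) = indicator A z * (\<integral>\<^sup>+t. indicator B (T z t) \<partial>law z)"
      unfolding F_def
      by (rule nn_integral_cmult)
        (use measurable_compose[OF measurable_T1[OF z], of "indicator B" borel] B in \<open>simp add: law_def\<close>)
    then show "(\<integral>\<^sup>+t. F z t \<partial>law z) = indicator A z * emeasure (gv \<nu>) B"
      using emeasure_law_T[OF z B] by simp
  qed
  also have "\<dots> = emeasure P A * emeasure (gv \<nu>) B"
    using a by (simp add: nn_integral_multc A_def)
  finally show ?thesis by (simp add: A_def)
qed

lemma distr_U: "distr M borel U = gv \<nu>"
proof (rule measure_eqI)
  show "sets (distr M borel U) = sets (gv \<nu>)" by (simp add: gv_def)
  fix B assume "B \<in> sets (distr M borel U)"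
  then have B: "B \<in> sets borel" by simp
  have "emeasure (distr M borel U) B = emeasure M {\<omega> \<in> space M. True \<and> U \<omega> \<in> B}"
    by (subst emeasure_distr[OF measurable_U B]) (auto intro!: arg_cong[where f = "emeasure M"])
  also have "\<dots> = emeasure P {z \<in> space P. True} * emeasure (gv \<nu>) B"
    by (rule emeasure_U[OF _ _ B]) auto
  finally show "emeasure (distr M borel U) B = emeasure (gv \<nu>) B" by (simp add: P.emeasure_space_1)
qed

lemma char_law:
  assumes z: "z \<in> space P"
  shows "char (law z) t = char (distr P borel (\<lambda>y. u (rs \<Lambda> z y))) t * of_real (exp (- ((e * t)\<^sup>2) / 2))"
proof -
  have mu: "(\<lambda>y. u (rs \<Lambda> z y)) \<in> borel_measurable P" using pg_rs[OF pgu z] by (rule pg_measurable)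
  have m: "(\<lambda>x. iexp (t * (u (rs \<Lambda> z (fst x)) + e * snd x))) \<in> borel_measurable M"
    by (rule measurable_compose[OF measurable_shift[OF z]]) simp
  have int: "integrable (P \<Otimes>\<^sub>M N1) (\<lambda>x. iexp (t * (u (rs \<Lambda> z (fst x)) + e * snd x)))"
    by (rule PN.integrable_const_bound[where B = 1]) (use m in \<open>auto simp: M_def\<close>)
  have ie: "iexp (t * (a + e * h)) = iexp (t * a) * iexp (e * t * h)" for a h
    by (simp add: exp_add[symmetric] algebra_simps)
  have "char (law z) t = (CLINT x|M. iexp (t * (u (rs \<Lambda> z (fst x)) + e * snd x)))"
    unfolding char_def law_def by (rule integral_distr[OF measurable_shift[OF z]]) simp
  also have "\<dots> = (CLINT y|P. (CLINT h|N1. iexp (t * (u (rs \<Lambda> z y) + e * h))))"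
    unfolding M_def using PN.integral_fst'[OF int] by simp
  also have "\<dots> = (CLINT y|P. iexp (t * u (rs \<Lambda> z y)) * (CLINT h|N1. iexp (e * t * h)))"
    unfolding ie integral_mult_right_zero by (rule refl)
  also have "\<dots> = (CLINT y|P. iexp (t * u (rs \<Lambda> z y))) * char N1 (e * t)"
    unfolding char_def integral_mult_left_zero by (rule refl)
  also have "(CLINT y|P. iexp (t * u (rs \<Lambda> z y))) = char (distr P borel (\<lambda>y. u (rs \<Lambda> z y))) t"
    unfolding char_def by (rule integral_distr[OF mu, symmetric]) simp
  also have "char N1 (e * t) = of_real (exp (- ((e * t)\<^sup>2) / 2))" by (simp add: char_std_normal_distribution)
  finally show ?thesis .
qed

text \<open>The noise multiplies the characteristic function by a factor within e^2 t^2 / 2 of 1,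
  hence the additional e^2 in the error.\<close>

lemma char_law_close:
  assumes z: "z \<in> space P"
    and c: "cmod (char (distr P borel (\<lambda>y. u (rs \<Lambda> z y))) t - of_real (exp (- (\<nu> * t\<^sup>2) / 2))) \<le> (t\<^sup>2 + \<bar>t\<bar> ^ 3 + t ^ 4) * q"
  shows "cmod (char (law z) t - of_real (exp (- (\<nu> * t\<^sup>2) / 2))) \<le> (t\<^sup>2 + \<bar>t\<bar> ^ 3 + t ^ 4) * (q + e\<^sup>2)"
proof -
  define \<phi> where "\<phi> = char (distr P borel (\<lambda>y. u (rs \<Lambda> z y))) t"
  define g where "g = complex_of_real (exp (- (\<nu> * t\<^sup>2) / 2))"
  define x where "x = (e * t)\<^sup>2 / 2"
  have x0: "0 \<le> x" by (simp add: x_def)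
  define h where "h = complex_of_real (exp (- x))"
  have g1: "cmod g \<le> 1" unfolding g_def using nu0 by simp
  have h1: "cmod h \<le> 1" unfolding h_def using x0 by simp
  have "h - 1 = complex_of_real (exp (- x) - exp (- 0))" by (simp add: h_def)
  then have "cmod (h - 1) = \<bar>exp (- x) - exp (- 0)\<bar>" by (simp only: norm_of_real)
  also have "\<dots> \<le> \<bar>x - 0\<bar>" using x0 by (intro exp_minus_lipschitz) auto
  finally have hx: "cmod (h - 1) \<le> x" using x0 by simp
  have "char (law z) t - g = (\<phi> - g) * h + g * (h - 1)"
  proof -
    have "char (law z) t = \<phi> * h" unfolding char_law[OF z] \<phi>_def h_def x_def by simp
    then show ?thesis by (simp add: right_diff_distrib left_diff_distrib)
  qed
  then have "cmod (char (law z) t - g) \<le> cmod (\<phi> - g) * cmod h + cmod g * cmod (h - 1)"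
    by (metis norm_mult norm_triangle_ineq)
  also have "\<dots> \<le> cmod (\<phi> - g) * 1 + 1 * x"
    by (intro add_mono mult_mono g1 h1 hx order_refl) auto
  also have "\<dots> \<le> (t\<^sup>2 + \<bar>t\<bar> ^ 3 + t ^ 4) * q + (t\<^sup>2 + \<bar>t\<bar> ^ 3 + t ^ 4) * e\<^sup>2"
  proof (intro add_mono)
    show "cmod (\<phi> - g) * 1 \<le> (t\<^sup>2 + \<bar>t\<bar> ^ 3 + t ^ 4) * q" using c by (simp add: \<phi>_def g_def)
    have "0 \<le> t ^ 4" by (rule zero_le_even_power) simp
    then have "t\<^sup>2 \<le> t\<^sup>2 + \<bar>t\<bar> ^ 3 + t ^ 4" by simp
    then have "t\<^sup>2 * e\<^sup>2 \<le> (t\<^sup>2 + \<bar>t\<bar> ^ 3 + t ^ 4) * e\<^sup>2" by (rule mult_right_mono) simp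
    moreover have "x = t\<^sup>2 * e\<^sup>2 / 2" by (simp add: x_def power_mult_distrib mult.commute)
    moreover have "0 \<le> t\<^sup>2 * e\<^sup>2" by simp
    ultimately show "1 * x \<le> (t\<^sup>2 + \<bar>t\<bar> ^ 3 + t ^ 4) * e\<^sup>2" by linarith
  qed
  finally show ?thesis by (simp add: g_def distrib_left)
qed

text \<open>Where \<open>Q z \<le> \<eta>\<close> the transport estimate applies; elsewhere the
  trivial bound 1 is at most \<open>Q z / \<eta>\<close>. The sum of the two bounds is integrated
  over z.\<close>

lemma U_close:
  assumes Q: "pg Q" "\<And>z. z \<in> space P \<Longrightarrow> 0 \<le> Q z" and \<epsilon>: "0 < \<epsilon>" and \<eta>: "0 < \<eta>"
    and tr: "\<And>M. real_distribution M \<Longrightarrow> (\<And>x. measure M {x} = 0) \<Longrightarrow>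
      (\<And>t. cmod (char M t - of_real (exp (- (\<nu> * t\<^sup>2) / 2))) \<le> (t\<^sup>2 + \<bar>t\<bar> ^ 3 + t ^ 4) * \<eta>) \<Longrightarrow>
      measure M {t. \<epsilon> < \<bar>quant \<nu> (cdf M t) - t\<bar>} \<le> \<epsilon>"
    and ch: "\<And>z t. z \<in> space P \<Longrightarrow> cmod (char (law z) t - of_real (exp (- (\<nu> * t\<^sup>2) / 2))) \<le> (t\<^sup>2 + \<bar>t\<bar> ^ 3 + t ^ 4) * Q z"
  shows "measure M {\<omega> \<in> space M. \<epsilon> < \<bar>U \<omega> - (u (fst \<omega>) + e * snd \<omega>)\<bar>} \<le> \<epsilon> + (\<integral>z. Q z \<partial>P) / \<eta>"
proof -
  define F where "F z t = (if \<epsilon> < \<bar>T z t - t\<bar> then 1 else 0 :: ennreal)" for z t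
  have mF: "(\<lambda>x. F (fst x) (snd x)) \<in> borel_measurable (P \<Otimes>\<^sub>M borel)"
    unfolding F_def
    by (intro measurable_If borel_measurable_less borel_measurable_const borel_measurable_abs
        borel_measurable_diff measurable_T measurable_snd)
  have pt: "(\<integral>\<^sup>+t. F z t \<partial>law z) \<le> ennreal (\<epsilon> + Q z / \<eta>)" if z: "z \<in> space P" for z
  proof -
    interpret L: real_distribution "law z" by (rule real_distribution_law[OF z])
    have s: "{t. \<epsilon> < \<bar>T z t - t\<bar>} \<in> sets borel"
      using borel_measurable_less[OF borel_measurable_const borel_measurable_abs[OF borel_measurable_diff[OF measurable_T1[OF z] measurable_ident]]]
      by (simp add: id_def)
    have "(\<integral>\<^sup>+t. F z t \<partial>law z) = (\<integral>\<^sup>+t. indicator {t. \<epsilon> < \<bar>T z t - t\<bar>} t \<partial>law z)"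
      by (rule nn_integral_cong) (simp add: F_def indicator_def)
    also have "\<dots> = emeasure (law z) {t. \<epsilon> < \<bar>T z t - t\<bar>}" using s by simp
    also have "\<dots> = ennreal (measure (law z) {t. \<epsilon> < \<bar>T z t - t\<bar>})" by (rule L.emeasure_eq_measure)
    also have "\<dots> \<le> ennreal (\<epsilon> + Q z / \<eta>)"
    proof (rule ennreal_leI)
      have Q0: "0 \<le> Q z" by (rule Q(2)[OF z])
      show "measure (law z) {t. \<epsilon> < \<bar>T z t - t\<bar>} \<le> \<epsilon> + Q z / \<eta>"
      proof (cases "Q z \<le> \<eta>")
        case True
        have "measure (law z) {t. \<epsilon> < \<bar>quant \<nu> (cdf (law z) t) - t\<bar>} \<le> \<epsilon>"
        proof (rule tr[OF real_distribution_law[OF z] law_null[OF z]])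
          fix t :: real
          have "0 \<le> t ^ 4" by (rule zero_le_even_power) simp
          then have "(t\<^sup>2 + \<bar>t\<bar> ^ 3 + t ^ 4) * Q z \<le> (t\<^sup>2 + \<bar>t\<bar> ^ 3 + t ^ 4) * \<eta>"
            using True by (intro mult_left_mono) auto
          then show "cmod (char (law z) t - of_real (exp (- (\<nu> * t\<^sup>2) / 2))) \<le> (t\<^sup>2 + \<bar>t\<bar> ^ 3 + t ^ 4) * \<eta>"
            using ch[OF z, of t] by simp
        qed
        then show ?thesis using Q0 \<eta> by (simp add: T_def add_increasing2)
      next
        case False
        have "measure (law z) {t. \<epsilon> < \<bar>T z t - t\<bar>} \<le> 1" by (rule L.prob_le_1)
        also have "1 \<le> Q z / \<eta>" using False \<eta> by simp
        finally show ?thesis using \<epsilon> by simp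
      qed
    qed
    finally show ?thesis .
  qed
  interpret M: prob_space M by (rule prob_M)
  have iQ: "integrable P Q" by (rule pg_integrable[OF Q(1)])
  have s: "{\<omega> \<in> space M. \<epsilon> < \<bar>U \<omega> - (u (fst \<omega>) + e * snd \<omega>)\<bar>} \<in> sets M"
    by (intro borel_measurable_less borel_measurable_const borel_measurable_abs borel_measurable_diff measurable_U measurable_shift_M)
  have "emeasure M {\<omega> \<in> space M. \<epsilon> < \<bar>U \<omega> - (u (fst \<omega>) + e * snd \<omega>)\<bar>}
      = (\<integral>\<^sup>+\<omega>. indicator {\<omega> \<in> space M. \<epsilon> < \<bar>U \<omega> - (u (fst \<omega>) + e * snd \<omega>)\<bar>} \<omega> \<partial>M)" using s by simp
  also have "\<dots> = (\<integral>\<^sup>+\<omega>. F (fst \<omega>) (u (fst \<omega>) + e * snd \<omega>) \<partial>M)"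
    by (rule nn_integral_cong) (simp add: F_def U_def indicator_def)
  also have "\<dots> = (\<integral>\<^sup>+z. (\<integral>\<^sup>+t. F z t \<partial>law z) \<partial>P)"
    by (rule nn_integral_disintegrate[OF mF]) (simp add: F_def T_rs)
  also have "\<dots> \<le> (\<integral>\<^sup>+z. ennreal (\<epsilon> + Q z / \<eta>) \<partial>P)" by (rule nn_integral_mono[OF pt])
  also have "\<dots> = ennreal (\<integral>z. \<epsilon> + Q z / \<eta> \<partial>P)"
    by (rule nn_integral_eq_integral) (use iQ Q(2) \<epsilon> \<eta> in \<open>auto intro!: AE_I2 add_nonneg_nonneg divide_nonneg_pos\<close>)
  also have "(\<integral>z. \<epsilon> + Q z / \<eta> \<partial>P) = \<epsilon> + (\<integral>z. Q z \<partial>P) / \<eta>" using iQ by (simp add: P.prob_space)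
  finally have "ennreal (measure M {\<omega> \<in> space M. \<epsilon> < \<bar>U \<omega> - (u (fst \<omega>) + e * snd \<omega>)\<bar>}) \<le> ennreal (\<epsilon> + (\<integral>z. Q z \<partial>P) / \<eta>)"
    by (simp add: M.emeasure_eq_measure)
  moreover have "0 \<le> \<epsilon> + (\<integral>z. Q z \<partial>P) / \<eta>"
    using \<epsilon> \<eta> Q(2) by (intro add_nonneg_nonneg divide_nonneg_pos integral_nonneg_AE AE_I2) auto
  ultimately show ?thesis by (simp add: ennreal_le_iff)
qed

end

subsection \<open>Conditioning on the coordinates of a ball\<close>

lemma cond_exp_tail:
  assumes M: "prob_space M" and F: "subalgebra M F" and g: "g \<in> borel_measurable M"
    and c: "(\<integral>\<^sup>+\<omega>. g \<omega> \<partial>M) \<le> ennreal c" "0 \<le> c" and \<epsilon>: "0 < \<epsilon>"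
  shows "measure M {\<omega> \<in> space M. ennreal \<epsilon> < nn_cond_exp M F g \<omega>} \<le> c / \<epsilon>"
proof -
  interpret prob_space M by (rule M)
  interpret finite_measure_subalgebra M F
    by (simp add: finite_measure_subalgebra_def finite_measure_subalgebra_axioms_def F finite_measure_axioms)
  let ?A = "{\<omega> \<in> space M. ennreal \<epsilon> < nn_cond_exp M F g \<omega>}"
  have mc: "nn_cond_exp M F g \<in> borel_measurable M" by (rule borel_measurable_nn_cond_exp2)
  have A: "?A \<in> sets M" by (rule borel_measurable_less[OF borel_measurable_const mc])
  have "ennreal (\<epsilon> * measure M ?A) = ennreal \<epsilon> * emeasure M ?A"
    using \<epsilon> by (simp add: emeasure_eq_measure ennreal_mult)
  also have "\<dots> = (\<integral>\<^sup>+\<omega>. ennreal \<epsilon> * indicator ?A \<omega> \<partial>M)" using A by (simp add: nn_integral_cmult_indicator)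
  also have "\<dots> \<le> (\<integral>\<^sup>+\<omega>. nn_cond_exp M F g \<omega> \<partial>M)"
    by (rule nn_integral_mono) (auto simp: indicator_def)
  also have "\<dots> = (\<integral>\<^sup>+\<omega>. g \<omega> \<partial>M)"
    using nn_cond_exp_intg[of "\<lambda>_. 1" g] g by simp
  also have "\<dots> \<le> ennreal c" by (rule c(1))
  finally have "\<epsilon> * measure M ?A \<le> c" using c(2) by (simp add: ennreal_le_iff)
  then show ?thesis using \<epsilon> by (simp add: le_divide_eq mult.commute)
qed

context gauss
begin

abbreviation "PN \<equiv> P \<Otimes>\<^sub>M std_normal_distribution"

lemma prob_PN: "prob_space PN"
proof -
  interpret N1: real_distribution std_normal_distribution by (rule real_dist_normal_dist)
  interpret PN: pair_prob_space P std_normal_distribution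
    by (simp add: pair_prob_space_def pair_sigma_finite_def prob_P prob_space_imp_sigma_finite N1.prob_space_axioms)
  show ?thesis by (rule PN.prob_space_axioms)
qed

lemma sets_PN: "sets PN = sets (P \<Otimes>\<^sub>M lborel)"
  by (rule sets_pair_measure_cong) auto

lemma space_PN: "space PN = space P \<times> UNIV"
  by (simp add: space_pair_measure)

lemma distr_PN_fst: "distr PN P fst = P"
  by (rule prob_space.distr_pair_fst) (use real_dist_normal_dist in \<open>simp add: real_distribution_def\<close>)

definition "coords J = {(\<lambda>\<omega>. fst \<omega> j) -` A \<inter> space PN | j A. j \<in> J \<and> A \<in> sets (borel :: real measure)}"

lemma coords_Pow: "coords J \<subseteq> Pow (space PN)"
  unfolding coords_def by blast

lemma sets_gen_sigma: "sets (gen_sigma PN (\<lambda>j \<omega>. fst \<omega> j) J) = sigma_sets (space PN) (coords J)"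
  unfolding gen_sigma_def coords_def[symmetric] by (rule sets_measure_of[OF coords_Pow])

lemma coords_measurable: assumes "J \<subseteq> V" shows "coords J \<subseteq> sets PN"
proof
  fix a assume "a \<in> coords J"
  then obtain j A where a: "a = (\<lambda>\<omega>. fst \<omega> j) -` A \<inter> space PN" "j \<in> J" "A \<in> sets borel" unfolding coords_def by blast
  have "(\<lambda>\<omega>. fst \<omega> j) \<in> borel_measurable PN"
    using measurable_compose[OF measurable_fst measurable_coord[of j]] a(2) assms by blast
  then show "a \<in> sets PN" unfolding a(1) by (rule measurable_sets) (rule a(3))
qed

lemma gen_sigma_subalgebra: assumes "J \<subseteq> V" shows "subalgebra PN (gen_sigma PN (\<lambda>j \<omega>. fst \<omega> j) J)"
  unfolding subalgebra_def
proof
  show "space (gen_sigma PN (\<lambda>j \<omega>. fst \<omega> j) J) = space PN"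
    unfolding gen_sigma_def by (rule space_measure_of[OF coords_Pow[unfolded coords_def]])
  show "sets (gen_sigma PN (\<lambda>j \<omega>. fst \<omega> j) J) \<subseteq> sets PN"
    unfolding sets_gen_sigma by (rule sets.sigma_sets_subset[OF coords_measurable[OF assms]])
qed

text \<open>The sets that do not separate points with equal coordinates in J include the generators
  and are closed under complements and countable unions.\<close>

lemma gen_sigma_local:
  assumes "a \<in> sets (gen_sigma PN (\<lambda>j \<omega>. fst \<omega> j) J)"
  shows "\<omega> \<in> space PN \<Longrightarrow> \<omega>' \<in> space PN \<Longrightarrow> (\<And>j. j \<in> J \<Longrightarrow> fst \<omega> j = fst \<omega>' j) \<Longrightarrow> \<omega> \<in> a \<longleftrightarrow> \<omega>' \<in> a"
proof -
  have "\<forall>\<omega>\<in>space PN. \<forall>\<omega>'\<in>space PN. (\<forall>j\<in>J. fst \<omega> j = fst \<omega>' j) \<longrightarrow> (\<omega> \<in> a \<longleftrightarrow> \<omega>' \<in> a)"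
    using assms unfolding sets_gen_sigma
  proof (induction a rule: sigma_sets.induct)
    case (Basic a)
    then obtain j A where a: "a = (\<lambda>\<omega>. fst \<omega> j) -` A \<inter> space PN" "j \<in> J" unfolding coords_def by blast
    show ?case
    proof (intro ballI impI)
      fix \<omega> \<omega>' assume w: "\<omega> \<in> space PN" "\<omega>' \<in> space PN" "\<forall>j\<in>J. fst \<omega> j = fst \<omega>' j"
      then have "fst \<omega> j = fst \<omega>' j" using a(2) by blast
      then show "\<omega> \<in> a \<longleftrightarrow> \<omega>' \<in> a" unfolding a(1) using w(1,2) by simp
    qed
  next
    case Empty
    then show ?case by simp
  next
    case (Compl a)
    then show ?case by blast
  next
    case (Union a)
    then show ?case by blast
  qed
  then show "\<omega> \<in> space PN \<Longrightarrow> \<omega>' \<in> space PN \<Longrightarrow> (\<And>j. j \<in> J \<Longrightarrow> fst \<omega> j = fst \<omega>' j) \<Longrightarrow> \<omega> \<in> a \<longleftrightarrow> \<omega>' \<in> a"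
    by blast
qed

end

text \<open>Truncation at \<tau>. Above it, 2 \<theta> x \<le> \<theta>^2 x^2 + 1 with x = w^p
  trades the power for a small multiple of a high moment plus a large multiple of an indicator;
  w^(2p) is at most 1 + w^(2k) since p \<le> k.\<close>

lemma abs_powr_le:
  fixes w \<tau> \<theta> p :: real
  assumes w: "0 \<le> w" and \<tau>: "0 < \<tau>" and \<theta>: "0 < \<theta>" and p: "0 < p" "p \<le> real k"
  shows "w powr p \<le> \<tau> powr p + \<theta> * (1 + w ^ (2 * k)) + (if \<tau> < w then 1 else 0) / \<theta>"
proof (cases "\<tau> < w")
  case False
  then have "w powr p \<le> \<tau> powr p" using w p by (intro powr_mono2) auto
  moreover have "0 \<le> \<theta> * (1 + w ^ (2 * k))" using \<theta> w by simp
  ultimately show ?thesis using False by simp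
next
  case True
  define x where "x = w powr p"
  have w0: "0 < w" using True \<tau> by simp
  have "x\<^sup>2 = w powr (2 * p)" unfolding x_def power2_eq_square by (simp add: powr_add[symmetric])
  also have "\<dots> \<le> 1 + w ^ (2 * k)"
  proof (cases "w \<le> 1")
    case True
    then have "w powr (2 * p) \<le> 1" using w0 p by (intro powr_le1) auto
    then show ?thesis using w by (simp add: add_increasing2)
  next
    case False
    then have "w powr (2 * p) \<le> w powr real (2 * k)" using p by (intro powr_mono) auto
    then show ?thesis using w0 by (simp only: powr_realpow)
  qed
  finally have x2: "x\<^sup>2 \<le> 1 + w ^ (2 * k)" .
  have "0 \<le> (\<theta> * x - 1)\<^sup>2" by simp
  then have "2 * (\<theta> * x) \<le> \<theta> * (\<theta> * x\<^sup>2) + 1" by (simp add: power2_eq_square algebra_simps)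
  moreover have "0 \<le> \<theta> * x" using \<theta> by (simp add: x_def)
  ultimately have "\<theta> * x \<le> \<theta> * (\<theta> * x\<^sup>2 + 1 / \<theta>)" using \<theta> by (simp add: distrib_left)
  then have "x \<le> \<theta> * x\<^sup>2 + 1 / \<theta>" using \<theta> by (rule mult_left_le_imp_le)
  also have "\<dots> \<le> \<theta> * (1 + w ^ (2 * k)) + 1 / \<theta>" using x2 \<theta> by (intro add_right_mono mult_left_mono) auto
  finally have "w powr p \<le> \<theta> * (1 + w ^ (2 * k)) + 1 / \<theta>" by (simp only: x_def)
  moreover have "0 \<le> \<tau> powr p" by (rule powr_ge_zero)
  ultimately have "w powr p \<le> \<tau> powr p + \<theta> * (1 + w ^ (2 * k)) + 1 / \<theta>" by linarith
  then show ?thesis using True by simp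
qed

context coupling
begin

lemma M_PN: "M = PN"
  by (simp add: M_def)

lemma prob_U:
  assumes B: "B \<in> sets borel"
  shows "measure M (U -` B \<inter> space M) = measure (gv \<nu>) B"
  using measure_distr[OF measurable_U B] by (simp add: distr_U)

lemma indep_U:
  assumes J: "J \<subseteq> V" "J \<inter> \<Lambda> = {}"
  shows "prob_space.indep_set M (sets (gen_sigma M (\<lambda>j \<omega>. fst \<omega> j) J)) (sets (vimage_algebra (space M) U borel))"
proof -
  interpret M: prob_space M by (rule prob_M)
  interpret Gv: real_distribution "gv \<nu>" by (rule real_distribution_gv[OF nu0])
  have sv: "sets (vimage_algebra (space M) U borel) = {U -` B \<inter> space M | B. B \<in> sets borel}"
    by (rule sets_vimage_algebra2) simp
  show ?thesis
  proof (rule M.indep_setI)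
    show sub: "sets (gen_sigma M (\<lambda>j \<omega>. fst \<omega> j) J) \<subseteq> M.events"
      using gen_sigma_subalgebra[OF J(1)] unfolding M_PN subalgebra_def by blast
    show "sets (vimage_algebra (space M) U borel) \<subseteq> M.events"
      unfolding sv by (auto intro: measurable_sets[OF measurable_U])
    fix a b assume a: "a \<in> sets (gen_sigma M (\<lambda>j \<omega>. fst \<omega> j) J)" and "b \<in> sets (vimage_algebra (space M) U borel)"
    then obtain B where b: "b = U -` B \<inter> space M" and B: "B \<in> sets borel" unfolding sv by blast
    have aM: "a \<in> sets M" using a sub by blast
    \<comment> \<open>Events of this sigma-algebra ignore the noise coordinate, so their slice at
      noise value 0 determines them.\<close>
    define \<alpha> where "\<alpha> z \<longleftrightarrow> (z, 0) \<in> a" for z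
    have a\<alpha>: "\<omega> \<in> a \<longleftrightarrow> \<alpha> (fst \<omega>)" if "\<omega> \<in> space M" for \<omega>
      unfolding \<alpha>_def by (rule gen_sigma_local[OF a[unfolded M_PN]]) (use that in \<open>auto simp: M_PN space_PN mem_Times_iff\<close>)
    have m\<alpha>: "{z \<in> space P. \<alpha> z} \<in> sets P"
    proof -
      have "(\<lambda>z. (z, 0)) -` a \<inter> space P \<in> sets P"
        by (rule measurable_sets[OF measurable_Pair2' aM[unfolded M_PN]]) simp
      moreover have "(\<lambda>z. (z, 0)) -` a \<inter> space P = {z \<in> space P. \<alpha> z}" by (auto simp: \<alpha>_def)
      ultimately show ?thesis by simp
    qed
    have inv: "\<alpha> (rs \<Lambda> z y) \<longleftrightarrow> \<alpha> z" if "z \<in> space P" "y \<in> space P" for z y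
      unfolding \<alpha>_def
    proof (rule gen_sigma_local[OF a[unfolded M_PN]])
      fix j assume "j \<in> J"
      then have "j \<notin> \<Lambda>" using J(2) by blast
      then show "fst (rs \<Lambda> z y, 0 :: real) j = fst (z, 0 :: real) j" by (simp add: rs_def)
    qed (use that rs_in_space[OF that, of \<Lambda>] in \<open>simp_all add: space_PN\<close>)
    have UNIV_borel: "(UNIV :: real set) \<in> sets borel" by simp
    have asub: "a \<subseteq> space M" using aM by (rule sets.sets_into_space)
    have aeq: "a = {\<omega> \<in> space M. \<alpha> (fst \<omega>)}"
    proof (intro set_eqI iffI)
      fix \<omega> assume w: "\<omega> \<in> a"
      then have "\<omega> \<in> space M" using asub by (rule rev_subsetD)
      then show "\<omega> \<in> {\<omega> \<in> space M. \<alpha> (fst \<omega>)}" using a\<alpha>[of \<omega>] w by simp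
    next
      fix \<omega> assume "\<omega> \<in> {\<omega> \<in> space M. \<alpha> (fst \<omega>)}"
      then show "\<omega> \<in> a" using a\<alpha>[of \<omega>] by simp
    qed
    have 0: "emeasure M {\<omega> \<in> space M. \<alpha> (fst \<omega>) \<and> U \<omega> \<in> B'} = emeasure P {z \<in> space P. \<alpha> z} * emeasure (gv \<nu>) B'"
      if "B' \<in> sets borel" for B'
      by (rule emeasure_U[where a = \<alpha> and B = B', OF m\<alpha> _ that]) (rule inv)
    have "a \<inter> b = {\<omega> \<in> space M. \<alpha> (fst \<omega>)} \<inter> (U -` B \<inter> space M)" by (simp only: b aeq[symmetric])
    also have "\<dots> = {\<omega> \<in> space M. \<alpha> (fst \<omega>) \<and> U \<omega> \<in> B}" by blast
    finally have 1: "emeasure M (a \<inter> b) = emeasure P {z \<in> space P. \<alpha> z} * emeasure (gv \<nu>) B"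
      by (simp only: 0[OF B])
    have "a = {\<omega> \<in> space M. \<alpha> (fst \<omega>) \<and> U \<omega> \<in> UNIV}" by (simp only: aeq[symmetric] UNIV_I simp_thms)
    then have 2: "emeasure M a = emeasure P {z \<in> space P. \<alpha> z} * emeasure (gv \<nu>) UNIV"
      using 0[OF UNIV_borel] by metis
    have u1: "emeasure (gv \<nu>) UNIV = 1" using Gv.emeasure_space_1 by simp
    have "emeasure M (a \<inter> b) = emeasure M a * emeasure (gv \<nu>) B" using 1 2 u1 by simp
    then have "M.prob (a \<inter> b) = M.prob a * measure (gv \<nu>) B" unfolding measure_def by (simp only: enn2real_mult)
    then show "M.prob (a \<inter> b) = M.prob a * M.prob b" using prob_U[OF B] by (simp only: b)
  qed
qed

lemma integrable_U_power: "integrable M (\<lambda>\<omega>. U \<omega> ^ k)"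
  and integral_U_power: "(\<integral>\<omega>. U \<omega> ^ k \<partial>M) = (\<integral>x. x ^ k \<partial>gv \<nu>)"
proof -
  have "integrable (gv \<nu>) (\<lambda>x. x ^ k)"
    using integrable_normal_moment[of "sqrt \<nu>" 0 k] nu0 unfolding gv_def by (subst integrable_density) auto
  then show "integrable M (\<lambda>\<omega>. U \<omega> ^ k)"
    unfolding distr_U[symmetric] by (subst (asm) integrable_distr_eq[OF measurable_U]) auto
  show "(\<integral>\<omega>. U \<omega> ^ k \<partial>M) = (\<integral>x. x ^ k \<partial>gv \<nu>)"
    unfolding distr_U[symmetric] by (rule integral_distr[OF measurable_U, symmetric]) simp
qed

lemma integrable_fst_M: assumes "pg h" shows "integrable M (\<lambda>\<omega>. h (fst \<omega>))"
  and integral_fst_M: "(\<integral>\<omega>. h (fst \<omega>) \<partial>M) = (\<integral>z. h z \<partial>P)"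
proof -
  have d: "distr M P fst = P" using distr_PN_fst by (simp add: M_PN)
  have mh: "h \<in> borel_measurable P" using assms by (rule pg_measurable)
  have "integrable (distr M P fst) h" using pg_integrable[OF assms] by (simp add: d)
  then show "integrable M (\<lambda>\<omega>. h (fst \<omega>))" by (subst (asm) integrable_distr_eq[OF measurable_fst_M mh])
  show "(\<integral>\<omega>. h (fst \<omega>) \<partial>M) = (\<integral>z. h z \<partial>P)"
    using integral_distr[OF measurable_fst_M mh] by (simp add: d)
qed

lemma noise_tail: assumes "0 < c" shows "measure M {\<omega> \<in> space M. c < \<bar>e * snd \<omega>\<bar>} \<le> e\<^sup>2 / c\<^sup>2"
proof -
  interpret M: prob_space M by (rule prob_M)
  have d: "distr M N1 snd = N1"
  proof -
    have "distr M N1 snd = distr (distr (N1 \<Otimes>\<^sub>M P) (P \<Otimes>\<^sub>M N1) (\<lambda>(x, y). (y, x))) N1 snd"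
      unfolding M_def by (subst PN.distr_pair_swap) simp
    also have "\<dots> = distr (N1 \<Otimes>\<^sub>M P) N1 fst"
      by (subst distr_distr[OF measurable_snd measurable_pair_swap']) (simp add: comp_def split_beta')
    also have "\<dots> = N1" by (rule P.distr_pair_fst)
    finally show ?thesis .
  qed
  have ms: "snd \<in> measurable M N1" unfolding M_def by (rule measurable_snd)
  have "integrable N1 (\<lambda>x. x ^ 2)" by (rule integrable_std_normal_distribution_moment)
  then have i: "integrable M (\<lambda>\<omega>. (snd \<omega>)\<^sup>2)"
    by (subst (asm) d[symmetric], subst (asm) integrable_distr_eq[OF ms]) auto
  have s: "(\<integral>\<omega>. (snd \<omega>)\<^sup>2 \<partial>M) = 1"
  proof -
    have "(\<integral>\<omega>. (snd \<omega>)\<^sup>2 \<partial>M) = (\<integral>x. x\<^sup>2 \<partial>distr M N1 snd)" by (rule integral_distr[OF ms, symmetric]) simp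
    also have "\<dots> = 1" unfolding d using std_normal_distribution_even_moments[of 1] by simp
    finally show ?thesis .
  qed
  let ?A = "{\<omega> \<in> space M. c < \<bar>e * snd \<omega>\<bar>}"
  have A: "?A \<in> sets M"
    by (intro borel_measurable_less borel_measurable_const borel_measurable_abs borel_measurable_times measurable_snd_M)
  have "c\<^sup>2 * measure M ?A = (\<integral>\<omega>. c\<^sup>2 * indicat_real ?A \<omega> \<partial>M)" using A by (simp add: Int_absorb1 Collect_mono_iff subset_eq)
  also have "\<dots> \<le> (\<integral>\<omega>. e\<^sup>2 * (snd \<omega>)\<^sup>2 \<partial>M)"
  proof (rule integral_mono)
    show "integrable M (\<lambda>\<omega>. c\<^sup>2 * indicat_real ?A \<omega>)"
      using A by (intro integrable_mult_right) (simp add: M.emeasure_eq_measure)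
    show "integrable M (\<lambda>\<omega>. e\<^sup>2 * (snd \<omega>)\<^sup>2)" using i by simp
    fix \<omega>
    show "c\<^sup>2 * indicat_real ?A \<omega> \<le> e\<^sup>2 * (snd \<omega>)\<^sup>2"
    proof (cases "\<omega> \<in> ?A")
      case True
      then have "c\<^sup>2 \<le> (\<bar>e * snd \<omega>\<bar>)\<^sup>2" using assms by (intro power_mono) auto
      then show ?thesis using True by (simp add: power_mult_distrib)
    next
      case False
      then have "indicat_real ?A \<omega> = 0" by (rule indicator_simps(2))
      then show ?thesis by simp
    qed
  qed
  also have "\<dots> = e\<^sup>2" by (simp add: s)
  finally show ?thesis using assms by (simp add: le_divide_eq mult.commute)
qed

text \<open>The integrated form of \<open>abs_powr_le\<close>, with the high moment of the
  difference bounded by those of u and of the Gaussian.\<close>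

lemma Lp_bound:
  assumes \<tau>: "0 < \<tau>" and \<theta>: "0 < \<theta>" and p: "0 < p" "p \<le> real k"
    and B: "(\<integral>z. u z ^ (2 * k) \<partial>P) \<le> B"
  shows "(\<integral>\<^sup>+\<omega>. ennreal (\<bar>u (fst \<omega>) - U \<omega>\<bar> powr p) \<partial>M) \<le> ennreal (\<tau> powr p
     + \<theta> * (1 + 2 ^ (2 * k) * (B + (\<integral>x. x ^ (2 * k) \<partial>gv \<nu>)))
     + measure M {\<omega> \<in> space M. \<tau> < \<bar>u (fst \<omega>) - U \<omega>\<bar>} / \<theta>)"
proof -
  interpret M: prob_space M by (rule prob_M)
  let ?A = "{\<omega> \<in> space M. \<tau> < \<bar>u (fst \<omega>) - U \<omega>\<bar>}"
  have mu: "(\<lambda>\<omega>. u (fst \<omega>)) \<in> borel_measurable M" by (rule measurable_compose[OF measurable_fst_M measurable_u])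
  have A: "?A \<in> sets M"
    by (intro borel_measurable_less borel_measurable_const borel_measurable_abs borel_measurable_diff mu measurable_U)
  define R where "R \<omega> = \<tau> powr p + \<theta> * (1 + 2 ^ (2 * k) * (u (fst \<omega>) ^ (2 * k) + U \<omega> ^ (2 * k))) + indicat_real ?A \<omega> / \<theta>" for \<omega>
  have pu: "pg (\<lambda>z. u z ^ (2 * k))" by (rule pg_power[OF pgu])
  note iu = integrable_fst_M[OF pu] and iU = integrable_U_power[of "2 * k"]
  have iA: "integrable M (indicat_real ?A)" using A by (simp add: M.emeasure_eq_measure)
  have pos: "0 \<le> R \<omega>" for \<omega>
    unfolding R_def using \<theta> by (intro add_nonneg_nonneg mult_nonneg_nonneg divide_nonneg_pos) (auto simp: zero_le_even_power)
  have iR: "integrable M R" unfolding R_def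
    by (intro Bochner_Integration.integrable_add integrable_mult_right integrable_divide iu iU iA M.integrable_const)
  have "(\<integral>\<^sup>+\<omega>. ennreal (\<bar>u (fst \<omega>) - U \<omega>\<bar> powr p) \<partial>M) \<le> (\<integral>\<^sup>+\<omega>. ennreal (R \<omega>) \<partial>M)"
  proof (intro nn_integral_mono ennreal_leI)
    fix \<omega> assume w: "\<omega> \<in> space M"
    let ?w = "\<bar>u (fst \<omega>) - U \<omega>\<bar>"
    have "?w ^ (2 * k) \<le> 2 ^ (2 * k) * (u (fst \<omega>) ^ (2 * k) + U \<omega> ^ (2 * k))"
      using abs_add_power_le[of "u (fst \<omega>)" "- U \<omega>" "2 * k"] by (simp add: power_even_abs)
    then have "\<theta> * (1 + ?w ^ (2 * k)) \<le> \<theta> * (1 + 2 ^ (2 * k) * (u (fst \<omega>) ^ (2 * k) + U \<omega> ^ (2 * k)))"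
      using \<theta> by (intro mult_left_mono add_left_mono) auto
    moreover have "?w powr p \<le> \<tau> powr p + \<theta> * (1 + ?w ^ (2 * k)) + (if \<tau> < ?w then 1 else 0) / \<theta>"
      by (rule abs_powr_le[OF _ \<tau> \<theta> p]) simp
    moreover have "(if \<tau> < ?w then 1 else 0) = indicat_real ?A \<omega>" using w by (simp add: indicator_def)
    then have "(if \<tau> < ?w then 1 else 0) / \<theta> = indicat_real ?A \<omega> / \<theta>" by (rule arg_cong)
    ultimately show "?w powr p \<le> R \<omega>" unfolding R_def by linarith
  qed
  also have "\<dots> = ennreal (\<integral>\<omega>. R \<omega> \<partial>M)" by (rule nn_integral_eq_integral[OF iR]) (simp add: pos)
  also have "(\<integral>\<omega>. R \<omega> \<partial>M) = \<tau> powr p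
     + \<theta> * (1 + 2 ^ (2 * k) * ((\<integral>\<omega>. u (fst \<omega>) ^ (2 * k) \<partial>M) + (\<integral>\<omega>. U \<omega> ^ (2 * k) \<partial>M))) + (\<integral>\<omega>. indicat_real ?A \<omega> \<partial>M) / \<theta>"
    unfolding R_def using iu iU iA by (simp add: M.prob_space)
  also have "(\<integral>\<omega>. indicat_real ?A \<omega> \<partial>M) = measure M ?A" using sets.sets_into_space[OF A] by (simp add: Int_absorb2)
  also have "(\<integral>\<omega>. u (fst \<omega>) ^ (2 * k) \<partial>M) = (\<integral>z. u z ^ (2 * k) \<partial>P)" by (rule integral_fst_M[OF pu])
  also have "(\<integral>\<omega>. U \<omega> ^ (2 * k) \<partial>M) = (\<integral>x. x ^ (2 * k) \<partial>gv \<nu>)" by (rule integral_U_power)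
  finally have "(\<integral>\<^sup>+\<omega>. ennreal (\<bar>u (fst \<omega>) - U \<omega>\<bar> powr p) \<partial>M) \<le> ennreal (\<tau> powr p
     + \<theta> * (1 + 2 ^ (2 * k) * ((\<integral>z. u z ^ (2 * k) \<partial>P) + (\<integral>x. x ^ (2 * k) \<partial>gv \<nu>))) + measure M ?A / \<theta>)" .
  also have "\<dots> \<le> ennreal (\<tau> powr p + \<theta> * (1 + 2 ^ (2 * k) * (B + (\<integral>x. x ^ (2 * k) \<partial>gv \<nu>))) + measure M ?A / \<theta>)"
    using B \<theta> by (intro ennreal_leI add_mono order_refl mult_left_mono) auto
  finally show ?thesis .
qed

end

subsection \<open>Convergence of the messages\<close>

locale ampseq_pt = ampseq_pos +
  fixes m :: nat and i :: "nat \<Rightarrow> 'a" and a :: "nat \<Rightarrow> 'b"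
  assumes mL: "m < L" and i_in: "\<And>n. i n \<in> V n" and a_in: "\<And>n. a n \<in> G.nb n (i n)"
begin

text \<open>The noise level 1 / (n + 1) is positive for every n, which makes the law atomless, and
  tends to 0, which makes the noise negligible.\<close>

sublocale C: coupling "V n" \<delta> "G.u n (Suc m) (i n) (a n)" "G.lf n (Suc m) (i n) (a n)" "1 / real (Suc n)" "nu r f \<delta> (Suc m)" for n
proof
  show "G.pg n (G.u n (Suc m) (i n) (a n))" using mL i_in by (intro G.pg_u) auto
  show "0 < nu r f \<delta> (Suc m)" by (rule nupos)
qed simp

lemma expectation_Qerr_lim:
  assumes "0 < \<kappa>"
  shows "\<forall>\<^sub>F n in sequentially. (\<integral>z. G.Qerr n m (i n) (a n) z \<partial>G.P n) \<le> \<kappa>"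
proof -
  obtain B where B: "B \<ge> 0" "\<And>n i b. 2 \<le> d n \<Longrightarrow> i \<in> V n \<Longrightarrow> b \<in> G.nb n i \<Longrightarrow> (\<integral>z. G.Y n m b i z ^ (2 * 2) \<partial>G.P n) \<le> B"
    using moment_Y_bound[OF mL, of 2] by blast
  \<comment> \<open>One third of \<kappa> for each term of \<open>expectation_Qerr\<close>; the two
    terms containing a square root require a quantity below q^2.\<close>
  define q where "q = \<kappa> / 3"
  have q: "0 < q" using assms by (simp add: q_def)
  have q2: "0 < q\<^sup>2" using q by simp
  show ?thesis
    using ev_d V2_limit[OF mL q2] ev_small[OF q2, of "(1 + B)\<^sup>2"] ev_small[OF q, of B]
  proof eventually_elim
    case (elim n)
    have D1: "real (d n) - 1 \<ge> 1" using elim(1) by simp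
    have "(\<integral>z. G.Qerr n m (i n) (a n) z \<partial>G.P n) \<le> sqrt (\<integral>z. (G.V2 n (Suc m) (i n) (a n) z - nu r f \<delta> (Suc m))\<^sup>2 \<partial>G.P n)
        + (1 + B) / sqrt (real (d n) - 1) + B / (real (d n) - 1)"
      by (rule G.expectation_Qerr[OF mL i_in a_in elim(1) B(1)]) (use B(2)[OF elim(1) i_in] in simp)
    also have "sqrt (\<integral>z. (G.V2 n (Suc m) (i n) (a n) z - nu r f \<delta> (Suc m))\<^sup>2 \<partial>G.P n) \<le> sqrt (q\<^sup>2)"
      using elim(2) i_in a_in by (intro real_sqrt_le_mono) blast
    also have "sqrt (q\<^sup>2) = q" using q by simp
    also have "(1 + B) / sqrt (real (d n) - 1) = sqrt ((1 + B)\<^sup>2 / (real (d n) - 1))"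
      using B(1) by (simp add: real_sqrt_divide)
    also have "\<dots> \<le> sqrt (q\<^sup>2)" using elim(3) by (rule real_sqrt_le_mono)
    also have "sqrt (q\<^sup>2) = q" using q by simp
    also have "B / (real (d n) - 1) \<le> q" by (rule elim(4))
    finally show ?case by (simp add: q_def)
  qed
qed

lemma u_close_U:
  assumes \<tau>: "0 < \<tau>" and \<kappa>: "0 < \<kappa>"
  shows "\<forall>\<^sub>F n in sequentially. measure (C.M n) {\<omega> \<in> space (C.M n). \<tau> < \<bar>G.u n (Suc m) (i n) (a n) (fst \<omega>) - C.U n \<omega>\<bar>} \<le> \<kappa>"
proof -
  let ?\<nu> = "nu r f \<delta> (Suc m)"
  \<comment> \<open>Half of the deviation \<tau> is left to the noise. In the transport estimate
    \<epsilon> also bounds the exceptional probability, hence the minimum with \<kappa> / 3.\<close>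
  define \<epsilon> where "\<epsilon> = min (\<tau> / 2) (\<kappa> / 3)"
  have \<epsilon>: "0 < \<epsilon>" "\<epsilon> \<le> \<tau> / 2" "\<epsilon> \<le> \<kappa> / 3" using \<tau> \<kappa> by (auto simp: \<epsilon>_def)
  obtain \<eta> where \<eta>: "0 < \<eta>" and tr: "\<And>M. real_distribution M \<Longrightarrow> (\<And>x. measure M {x} = 0) \<Longrightarrow>
      (\<And>t. cmod (char M t - of_real (exp (- (?\<nu> * t\<^sup>2) / 2))) \<le> (t\<^sup>2 + \<bar>t\<bar> ^ 3 + t ^ 4) * \<eta>) \<Longrightarrow>
      measure M {t. \<epsilon> < \<bar>quant ?\<nu> (cdf M t) - t\<bar>} \<le> \<epsilon>"
    using transport_close[OF nupos \<epsilon>(1), of m] by blast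
  \<comment> \<open>The squared noise level has to be small in two places: in the characteristic
    function error, which is divided by \<eta>, and in Chebyshev's bound at \<tau> / 2.\<close>
  define \<beta> where "\<beta> = min (\<kappa> * \<eta> / 6) (\<kappa> / 3 * (\<tau> / 2)\<^sup>2)"
  have \<beta>: "0 < \<beta>" "\<beta> \<le> \<kappa> * \<eta> / 6" "\<beta> \<le> \<kappa> / 3 * (\<tau> / 2)\<^sup>2"
    using \<tau> \<kappa> \<eta> by (auto simp: \<beta>_def)
  have q: "0 < \<kappa> * \<eta> / 6" using \<kappa> \<eta> by simp
  have "(\<lambda>n. (1 / real (Suc n))\<^sup>2) \<longlonglongrightarrow> 0\<^sup>2"
    by (intro tendsto_power) (simp only: inverse_eq_divide[symmetric] LIMSEQ_inverse_real_of_nat)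
  then have "\<forall>\<^sub>F n in sequentially. (1 / real (Suc n))\<^sup>2 < \<beta>"
    using \<beta>(1) by (intro order_tendstoD(2)) auto
  then show ?thesis
    using ev_d expectation_Qerr_lim[OF q]
  proof eventually_elim
    case (elim n)
    let ?e = "1 / real (Suc n)" and ?u = "G.u n (Suc m) (i n) (a n)" and ?M = "C.M n"
    interpret M: prob_space ?M by (rule C.prob_M)
    have pQ: "G.pg n (G.Qerr n m (i n) (a n))" by (rule G.pg_Qerr[OF mL i_in])
    have pQ': "G.pg n (\<lambda>z. G.Qerr n m (i n) (a n) z + ?e\<^sup>2)" by (rule G.pg_add[OF pQ G.pg_const])
    have mu: "(\<lambda>\<omega>. ?u (fst \<omega>)) \<in> borel_measurable ?M"
      by (rule measurable_compose[OF C.measurable_fst_M C.measurable_u])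
    define S1 where "S1 = {\<omega> \<in> space ?M. \<epsilon> < \<bar>C.U n \<omega> - (?u (fst \<omega>) + ?e * snd \<omega>)\<bar>}"
    define S2 where "S2 = {\<omega> \<in> space ?M. \<tau> / 2 < \<bar>?e * snd \<omega>\<bar>}"
    have S: "S1 \<in> sets ?M" "S2 \<in> sets ?M"
      unfolding S1_def S2_def
      by (intro borel_measurable_less borel_measurable_const borel_measurable_abs borel_measurable_diff
          C.measurable_U C.measurable_shift_M borel_measurable_times C.measurable_snd_M)+
    have "measure ?M S1 \<le> \<epsilon> + (\<integral>z. G.Qerr n m (i n) (a n) z + ?e\<^sup>2 \<partial>G.P n) / \<eta>"
      unfolding S1_def
    proof (rule C.U_close[OF pQ' _ \<epsilon>(1) \<eta> tr])
      fix z assume "z \<in> space (G.P n)"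
      have "0 \<le> G.sg n m b (i n) (a n) z" "0 \<le> G.CE n (G.lf n (Suc m) (i n) (a n)) (\<lambda>z. \<bar>G.Y n m b (i n) z\<bar> ^ 3) z" for b
        unfolding G.sg_def by (rule G.CE_nonneg, simp)+
      then show "0 \<le> G.Qerr n m (i n) (a n) z + ?e\<^sup>2"
        unfolding G.Qerr_def using elim(2)
        by (intro add_nonneg_nonneg divide_nonneg_nonneg sum_nonneg) auto
    next
      fix z t assume z: "z \<in> space (G.P n)"
      show "cmod (char (C.law n z) t - of_real (exp (- (?\<nu> * t\<^sup>2) / 2))) \<le> (t\<^sup>2 + \<bar>t\<bar> ^ 3 + t ^ 4) * (G.Qerr n m (i n) (a n) z + ?e\<^sup>2)"
        by (rule C.char_law_close[OF z G.cond_char_close[OF mL i_in z elim(2) less_imp_le[OF nupos]]])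
    qed assumption+
    also have "(\<integral>z. G.Qerr n m (i n) (a n) z + ?e\<^sup>2 \<partial>G.P n) = (\<integral>z. G.Qerr n m (i n) (a n) z \<partial>G.P n) + ?e\<^sup>2"
      using G.pg_integrable[OF pQ] by (simp add: G.P.prob_space)
    also have "\<dots> / \<eta> \<le> (\<kappa> * \<eta> / 6 + \<kappa> * \<eta> / 6) / \<eta>"
      using elim(1,3) \<beta> \<eta> by (intro divide_right_mono add_mono) auto
    also have "\<dots> = \<kappa> / 3" using \<eta> by simp
    finally have m1: "measure ?M S1 \<le> \<kappa> / 3 + \<kappa> / 3" using \<epsilon>(3) by simp
    have "measure ?M S2 \<le> ?e\<^sup>2 / (\<tau> / 2)\<^sup>2"
      unfolding S2_def using \<tau> by (intro C.noise_tail) simp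
    also have "\<dots> \<le> (\<kappa> / 3 * (\<tau> / 2)\<^sup>2) / (\<tau> / 2)\<^sup>2"
      using elim(1) \<beta> by (intro divide_right_mono) auto
    also have "\<dots> = \<kappa> / 3" using \<tau> by simp
    finally have m2: "measure ?M S2 \<le> \<kappa> / 3" .
    have "measure ?M {\<omega> \<in> space ?M. \<tau> < \<bar>?u (fst \<omega>) - C.U n \<omega>\<bar>} \<le> measure ?M (S1 \<union> S2)"
    proof (rule M.finite_measure_mono)
      show "{\<omega> \<in> space ?M. \<tau> < \<bar>?u (fst \<omega>) - C.U n \<omega>\<bar>} \<subseteq> S1 \<union> S2"
      proof
        have tri: "\<epsilon> < \<bar>y - (x + h)\<bar> \<or> \<tau> / 2 < \<bar>h\<bar>" if "\<tau> < \<bar>x - y\<bar>" for x y h :: real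
          using that \<epsilon>(2) by linarith
        fix \<omega> assume w: "\<omega> \<in> {\<omega> \<in> space ?M. \<tau> < \<bar>?u (fst \<omega>) - C.U n \<omega>\<bar>}"
        then have "\<epsilon> < \<bar>C.U n \<omega> - (?u (fst \<omega>) + ?e * snd \<omega>)\<bar> \<or> \<tau> / 2 < \<bar>?e * snd \<omega>\<bar>"
          by (intro tri) blast
        then show "\<omega> \<in> S1 \<union> S2" using w unfolding S1_def S2_def by blast
      qed
    qed (use S in auto)
    also have "\<dots> \<le> measure ?M S1 + measure ?M S2" by (rule measure_Un_le[OF S])
    finally show ?case using m1 m2 by simp
  qed
qed

lemma Lp_lim:
  assumes p: "0 < p" and \<kappa>: "0 < \<kappa>"
  shows "\<forall>\<^sub>F n in sequentially. (\<integral>\<^sup>+\<omega>. ennreal (\<bar>G.u n (Suc m) (i n) (a n) (fst \<omega>) - C.U n \<omega>\<bar> powr p) \<partial>C.M n) \<le> ennreal \<kappa>"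
proof -
  define k where "k = nat \<lceil>p\<rceil>"
  have k: "p \<le> real k" unfolding k_def by linarith
  obtain B where B: "B \<ge> 0" "\<And>n j c. 2 \<le> d n \<Longrightarrow> j \<in> V n \<Longrightarrow> c \<in> G.nb n j \<Longrightarrow> (\<integral>z. G.u n (Suc m) j c z ^ (2 * k) \<partial>G.P n) \<le> B"
    using moment_u_bound[OF mL, of k] by blast
  define W where "W = 1 + 2 ^ (2 * k) * (B + (\<integral>x. x ^ (2 * k) \<partial>gv (nu r f \<delta> (Suc m))))"
  have "0 \<le> (\<integral>x. x ^ (2 * k) \<partial>gv (nu r f \<delta> (Suc m)))"
    by (rule Bochner_Integration.integral_nonneg) (simp add: zero_le_even_power)
  then have W: "1 \<le> W" unfolding W_def using B(1) by simp
  \<comment> \<open>Makes the moment term equal to \<kappa> / 3. The probability of a deviation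
    beyond \<tau> is divided by \<theta> in \<open>Lp_bound\<close>, so it must be at most
    \<open>\<theta> * \<kappa> / 3\<close>.\<close>
  define \<theta> where "\<theta> = \<kappa> / (3 * W)"
  have \<theta>: "0 < \<theta>" "\<theta> * W = \<kappa> / 3" using \<kappa> W by (auto simp: \<theta>_def)
  define \<tau> where "\<tau> = (\<kappa> / 3) powr (1 / p)"
  have \<tau>: "0 < \<tau>" "\<tau> powr p = \<kappa> / 3" using \<kappa> p by (auto simp: \<tau>_def powr_powr)
  have tk: "0 < \<theta> * \<kappa> / 3" using \<theta>(1) \<kappa> by simp
  show ?thesis
    using ev_d u_close_U[OF \<tau>(1) tk]
  proof eventually_elim
    case (elim n)
    let ?A = "{\<omega> \<in> space (C.M n). \<tau> < \<bar>G.u n (Suc m) (i n) (a n) (fst \<omega>) - C.U n \<omega>\<bar>}"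
    have "(\<integral>\<^sup>+\<omega>. ennreal (\<bar>G.u n (Suc m) (i n) (a n) (fst \<omega>) - C.U n \<omega>\<bar> powr p) \<partial>C.M n)
       \<le> ennreal (\<tau> powr p + \<theta> * (1 + 2 ^ (2 * k) * (B + (\<integral>x. x ^ (2 * k) \<partial>gv (nu r f \<delta> (Suc m))))) + measure (C.M n) ?A / \<theta>)"
      by (rule C.Lp_bound[OF \<tau>(1) \<theta>(1) p k B(2)[OF elim(1) i_in a_in]])
    also have "\<dots> \<le> ennreal (\<kappa> / 3 + \<kappa> / 3 + \<kappa> / 3)"
    proof (intro ennreal_leI add_mono)
      show "\<tau> powr p \<le> \<kappa> / 3" using \<tau> by simp
      show "\<theta> * (1 + 2 ^ (2 * k) * (B + (\<integral>x. x ^ (2 * k) \<partial>gv (nu r f \<delta> (Suc m))))) \<le> \<kappa> / 3"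
        unfolding W_def[symmetric] using \<theta> by simp
      have "measure (C.M n) ?A / \<theta> \<le> (\<theta> * \<kappa> / 3) / \<theta>" using elim(2) \<theta> by (intro divide_right_mono) auto
      then show "measure (C.M n) ?A / \<theta> \<le> \<kappa> / 3" using \<theta>(1) by simp
    qed
    finally show ?case by simp
  qed
qed

end

section \<open>The degenerate case of zero variance\<close>

lemma (in amp) u_eq_0:
  assumes "\<And>S. S \<subseteq> {..<r} \<Longrightarrow> S \<noteq> {} \<Longrightarrow> fourier r f S = 0"
  shows "u l i a z = 0"
proof (cases l)
  case 0
  then show ?thesis by (simp add: u_0)
next
  case (Suc m)
  have "fourier r f S = 0" if "S \<in> Fam r \<iota>" for S \<iota> using assms that by (auto simp: Fam_def)
  then show ?thesis by (simp add: Suc u_Suc Y_def dm_def dp_def)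
qed

lemma nu_eq_0:
  assumes "\<And>S. S \<subseteq> {..<r} \<Longrightarrow> S \<noteq> {} \<Longrightarrow> fourier r f S = 0"
  shows "nu r f \<delta> (Suc m) = 0"
proof -
  have "fourier r f S = 0" if "S \<in> Fam r \<iota>" for S \<iota> using assms that by (auto simp: Fam_def)
  then show ?thesis by (simp add: nu_Suc gS_def)
qed

lemma (in prob_space) indep_set_const:
  assumes A: "A \<subseteq> events"
  shows "indep_set A (sets (vimage_algebra (space M) (\<lambda>_. 0 :: real) borel))"
proof -
  have sv: "sets (vimage_algebra (space M) (\<lambda>_. 0 :: real) borel) = {(\<lambda>_. 0 :: real) -` B \<inter> space M | B. B \<in> sets borel}"
    by (rule sets_vimage_algebra2) simp
  have b: "b = {} \<or> b = space M" if "b \<in> sets (vimage_algebra (space M) (\<lambda>_. 0 :: real) borel)" for b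
    using that unfolding sv by (auto simp: vimage_def split: if_splits)
  show ?thesis
  proof (rule indep_setI[OF A])
    show "sets (vimage_algebra (space M) (\<lambda>_. 0 :: real) borel) \<subseteq> events" using b by blast
    fix a c assume "a \<in> A" "c \<in> sets (vimage_algebra (space M) (\<lambda>_. 0 :: real) borel)"
    then have "a \<in> events" "c = {} \<or> c = space M" using A b by blast+
    then show "prob (a \<inter> c) = prob a * prob c"
      by (auto simp: prob_space sets.Int_space_eq2)
  qed
qed

lemma cond_exp_tail_tendsto:
  fixes g :: "nat \<Rightarrow> 'b \<Rightarrow> real"
  assumes M: "\<And>n. prob_space (M n)" "\<And>n. subalgebra (M n) (F n)" "\<And>n. (\<lambda>\<omega>. ennreal (g n \<omega>)) \<in> borel_measurable (M n)"
    and lim: "\<And>\<kappa>. 0 < \<kappa> \<Longrightarrow> \<forall>\<^sub>F n in sequentially. (\<integral>\<^sup>+\<omega>. ennreal (g n \<omega>) \<partial>M n) \<le> ennreal \<kappa>"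
    and \<epsilon>: "0 < \<epsilon>"
  shows "(\<lambda>n. measure (M n) {\<omega> \<in> space (M n). ennreal \<epsilon> < nn_cond_exp (M n) (F n) (\<lambda>\<omega>. ennreal (g n \<omega>)) \<omega>}) \<longlonglongrightarrow> 0"
proof (rule tendstoI)
  fix \<kappa> :: real assume \<kappa>: "0 < \<kappa>"
  have "0 < \<kappa> * \<epsilon> / 2" using \<kappa> \<epsilon> by simp
  from lim[OF this]
  show "\<forall>\<^sub>F n in sequentially. dist (measure (M n) {\<omega> \<in> space (M n). ennreal \<epsilon> < nn_cond_exp (M n) (F n) (\<lambda>\<omega>. ennreal (g n \<omega>)) \<omega>}) 0 < \<kappa>"
  proof eventually_elim
    case (elim n)
    have "measure (M n) {\<omega> \<in> space (M n). ennreal \<epsilon> < nn_cond_exp (M n) (F n) (\<lambda>\<omega>. ennreal (g n \<omega>)) \<omega>} \<le> (\<kappa> * \<epsilon> / 2) / \<epsilon>"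
      by (rule cond_exp_tail[OF M elim _ \<epsilon>]) (use \<kappa> \<epsilon> in simp)
    also have "\<dots> < \<kappa>" using \<kappa> \<epsilon> by simp
    finally show ?case by (simp add: dist_real_def)
  qed
qed

section \<open>Assembly along the sequence of hypergraphs\<close>

theorem mainTheorem16:
  fixes r :: nat and f :: "(nat \<Rightarrow> real) \<Rightarrow> real" and \<delta> K :: real and l :: nat
    and V :: "nat \<Rightarrow> 'v set" and Fs :: "nat \<Rightarrow> 'f set" and vf :: "nat \<Rightarrow> 'f \<Rightarrow> nat \<Rightarrow> 'v"
    and d :: "nat \<Rightarrow> nat"
    and Fm Ff :: "nat \<Rightarrow> nat \<Rightarrow> (nat \<Rightarrow> real) \<Rightarrow> real"
    and i :: "nat \<Rightarrow> 'v" and a :: "nat \<Rightarrow> 'f"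
  assumes r2: "r \<ge> 2"
    and f_bool: "\<forall>x\<in>pm1 r. f x \<in> {0, 1}"
    and f_deg1: "\<forall>S\<subseteq>{..<r}. card S = 1 \<longrightarrow> fourier r f S = 0"
    and \<delta>pos: "\<delta> > 0" and Kpos: "K > 0"
    and l_range: "1 \<le> l" "l \<le> Lof \<delta>"
    and regular: "\<forall>n. index_regular (V n) (Fs n) (vf n) r (d n)"
    and girth: "\<forall>n. no_short_cycle (Fs n) (vf n) r (4 * Lof \<delta> + 4)"
    and d_lim: "filterlim d at_top sequentially"
    and Fm_meas: "\<forall>n k. k < Lof \<delta> \<longrightarrow> Fm n k \<in> borel_measurable (PiM {..<k} (\<lambda>_. borel))"
    and Fm_bdd: "\<forall>n k. k < Lof \<delta> \<longrightarrow> (\<forall>x\<in>{..<k} \<rightarrow>\<^sub>E UNIV. \<bar>Fm n k x\<bar> \<le> K)"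
    and Ff_meas: "\<forall>n k. k < Lof \<delta> \<longrightarrow> Ff n k \<in> borel_measurable (PiM {..<k} (\<lambda>_. borel))"
    and Ff_bdd: "\<forall>n k. k < Lof \<delta> \<longrightarrow> (\<forall>x\<in>{..<k} \<rightarrow>\<^sub>E UNIV. \<bar>Ff n k x\<bar> \<le> K)"
    and P2: "\<forall>n k. k < Lof \<delta> \<longrightarrow> (\<forall>j\<in>V n. \<forall>b\<in>nbhd (Fs n) (vf n) r j.
        (\<integral>z. (Afull r f (d n) (Fs n) (vf n) (Fm n) (Ff n) z k j)^2 \<partial>gspace (V n) \<delta>)
          = \<delta> / nu r f \<delta> (Suc k) \<and>
        (\<integral>z. (Amsgl r f (d n) (Fs n) (vf n) (Fm n) z k j b)^2 \<partial>gspace (V n) \<delta>)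
          = \<delta> / nu r f \<delta> (Suc k))"
    and i_in: "\<forall>n. i n \<in> V n"
    and a_in: "\<forall>n. a n \<in> nbhd (Fs n) (vf n) r (i n)"
  shows "\<exists>(M :: nat \<Rightarrow> (('v \<Rightarrow> real) \<times> real) measure) (U :: nat \<Rightarrow> ('v \<Rightarrow> real) \<times> real \<Rightarrow> real).
    (\<forall>n. prob_space (M n)
       \<and> sets (M n) = sets (gspace (V n) \<delta> \<Otimes>\<^sub>M lborel)
       \<and> distr (M n) (gspace (V n) \<delta>) fst = gspace (V n) \<delta>
       \<and> U n \<in> borel_measurable (M n)
       \<and> distr (M n) borel (U n) = gauss_var (nu r f \<delta> l)
       \<and> prob_space.indep_set (M n)
           (sets (gen_sigma (M n) (\<lambda>j \<omega>. fst \<omega> j) (var_ball (Fs n) (vf n) r (i n) (l - 1))))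
           (sets (vimage_algebra (space (M n)) (U n) borel)))
    \<and> (\<forall>p>0. \<forall>\<epsilon>>0.
         (\<lambda>n. measure (M n) {\<omega> \<in> space (M n). ennreal \<epsilon> <
            nn_cond_exp (M n) (gen_sigma (M n) (\<lambda>j \<omega>. fst \<omega> j) (var_ball (Fs n) (vf n) r (i n) (l - 1)))
              (\<lambda>\<omega>. ennreal (\<bar>umsg r f (d n) (Fs n) (vf n) (Fm n) (fst \<omega>) l (i n) (a n) - U n \<omega>\<bar> powr p))
              \<omega>})
         \<longlonglongrightarrow> 0)"
proof -
  define m where "m = l - 1"
  have l: "l = Suc m" and mL: "m < Lof \<delta>" using l_range by (auto simp: m_def)
  have amp: "amp (V n) \<delta> r f K (Lof \<delta>) (Fs n) (vf n) (d n) (Fm n)" for n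
    unfolding amp_def gauss_def amp_axioms_def
    using regular[rule_format, of n] girth[rule_format, of n] r2 f_deg1 \<delta>pos Kpos Fm_meas Fm_bdd
    by (simp add: index_regular_def)
  interpret S: ampseq V \<delta> r f K "Lof \<delta>" Fs vf d Fm
    by (simp add: ampseq_def amp d_lim)
  define J where "J n = var_ball (Fs n) (vf n) r (i n) (l - 1)" for n
  have J: "J n \<subseteq> V n" "J n \<inter> leaf (Fs n) (vf n) r (Suc m) (i n) (a n) = {}" for n
  proof -
    show "J n \<subseteq> V n" unfolding J_def
      by (rule var_ball_subset_V) (use S.G.vf_V i_in in auto)
    have "leaf (Fs n) (vf n) r l (i n) (a n) \<inter> var_ball (Fs n) (vf n) r (i n) (l - 1) = {}"
      by (rule leaf_var_ball_disjoint[OF girth[rule_format]]) (use l_range in auto)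
    then show "J n \<inter> leaf (Fs n) (vf n) r (Suc m) (i n) (a n) = {}" unfolding J_def l by blast
  qed
  have uu: "umsg r f (d n) (Fs n) (vf n) (Fm n) z l (i n) (a n) = S.G.u n (Suc m) (i n) (a n) z" for n z
    unfolding S.G.u_def l ..
  have gvv: "gauss_var v = gv v" if "v \<noteq> 0" for v using that by (simp add: gauss_var_def gv_def)
  show ?thesis
  \<comment> \<open>By \<open>f_deg1\<close> a non-empty set with non-zero coefficient has at least
    two elements, which makes every \<nu> positive. Otherwise the increment and \<nu> both vanish,
    and U = 0 serves.\<close>
  proof (cases "\<exists>S\<subseteq>{..<r}. S \<noteq> {} \<and> fourier r f S \<noteq> 0")
    case True
    then obtain S where S: "S \<subseteq> {..<r}" "S \<noteq> {}" "fourier r f S \<noteq> 0" by blast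
    have "finite S" using S(1) finite_subset by blast
    then have "card S \<noteq> 0" "card S \<noteq> 1" using S f_deg1 by auto
    then have "2 \<le> card S" by simp
    then have np: "0 < nu r f \<delta> (Suc k)" for k by (rule nu_pos[OF S(1,3) _ \<delta>pos])
    interpret S: ampseq_pt V \<delta> r f K "Lof \<delta>" Fs vf d Fm m i a
    proof
      show "0 < nu r f \<delta> (Suc k)" for k by (rule np)
      show "(\<integral>z. (S.G.A n k j b z)\<^sup>2 \<partial>gspace (V n) \<delta>) = \<delta> / nu r f \<delta> (Suc k)"
        if "k < Lof \<delta>" "j \<in> V n" "b \<in> nbhd (Fs n) (vf n) r j" for n k j b
        using P2 that unfolding S.G.A_def by blast
    qed (use mL i_in a_in in auto)
    have MP: "S.C.M n = gspace (V n) \<delta> \<Otimes>\<^sub>M std_normal_distribution" for n by (rule S.C.M_def)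
    show ?thesis
      unfolding J_def[symmetric] uu
    proof (intro exI[of _ S.C.M] exI[of _ S.C.U] conjI allI impI)
      fix n
      show "prob_space (S.C.M n)" by (rule S.C.prob_M)
      show "sets (S.C.M n) = sets (gspace (V n) \<delta> \<Otimes>\<^sub>M lborel)" unfolding MP by (rule S.G.sets_PN)
      show "distr (S.C.M n) (gspace (V n) \<delta>) fst = gspace (V n) \<delta>" unfolding MP by (rule S.G.distr_PN_fst)
      show "S.C.U n \<in> borel_measurable (S.C.M n)" by (rule S.C.measurable_U)
      show "distr (S.C.M n) borel (S.C.U n) = gauss_var (nu r f \<delta> l)"
        using S.C.distr_U np[of m] by (simp add: gvv l)
      show "prob_space.indep_set (S.C.M n) (sets (gen_sigma (S.C.M n) (\<lambda>j \<omega>. fst \<omega> j) (J n)))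
           (sets (vimage_algebra (space (S.C.M n)) (S.C.U n) borel))"
        by (rule S.C.indep_U[OF J])
    next
      fix p \<epsilon> :: real assume p: "0 < p" and \<epsilon>: "0 < \<epsilon>"
      show "(\<lambda>n. measure (S.C.M n) {\<omega> \<in> space (S.C.M n). ennreal \<epsilon> <
            nn_cond_exp (S.C.M n) (gen_sigma (S.C.M n) (\<lambda>j \<omega>. fst \<omega> j) (J n))
              (\<lambda>\<omega>. ennreal (\<bar>S.G.u n (Suc m) (i n) (a n) (fst \<omega>) - S.C.U n \<omega>\<bar> powr p)) \<omega>}) \<longlonglongrightarrow> 0"
      proof (rule cond_exp_tail_tendsto[OF S.C.prob_M _ _ S.Lp_lim[OF p] \<epsilon>])
        fix n
        show "subalgebra (S.C.M n) (gen_sigma (S.C.M n) (\<lambda>j \<omega>. fst \<omega> j) (J n))"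
          unfolding MP by (rule S.G.gen_sigma_subalgebra[OF J(1)])
        have [measurable]: "(\<lambda>\<omega>. S.G.u n (Suc m) (i n) (a n) (fst \<omega>)) \<in> borel_measurable (S.C.M n)"
          "S.C.U n \<in> borel_measurable (S.C.M n)"
          by (rule measurable_compose[OF S.C.measurable_fst_M S.C.measurable_u], rule S.C.measurable_U)
        show "(\<lambda>\<omega>. ennreal (\<bar>S.G.u n (Suc m) (i n) (a n) (fst \<omega>) - S.C.U n \<omega>\<bar> powr p)) \<in> borel_measurable (S.C.M n)"
          by measurable
      qed
    qed
  next
    case False
    then have z: "fourier r f S = 0" if "S \<subseteq> {..<r}" "S \<noteq> {}" for S using that by blast
    have u0: "S.G.u n (Suc m) (i n) (a n) z = 0" for n z by (rule S.G.u_eq_0[OF z])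
    have nu0: "nu r f \<delta> l = 0" unfolding l by (rule nu_eq_0[OF z])
    define M where "M n = gspace (V n) \<delta> \<Otimes>\<^sub>M std_normal_distribution" for n
    have pM: "prob_space (M n)" for n unfolding M_def by (rule S.G.prob_PN)
    have sub: "subalgebra (M n) (gen_sigma (M n) (\<lambda>j \<omega>. fst \<omega> j) (J n))" for n
      unfolding M_def by (rule S.G.gen_sigma_subalgebra[OF J(1)])
    show ?thesis
      unfolding J_def[symmetric] uu u0 nu0
    proof (intro exI[of _ M] exI[of _ "\<lambda>n \<omega>. 0"] conjI allI impI)
      fix n
      show "prob_space (M n)" by (rule pM)
      show "sets (M n) = sets (gspace (V n) \<delta> \<Otimes>\<^sub>M lborel)" unfolding M_def by (rule S.G.sets_PN)
      show "distr (M n) (gspace (V n) \<delta>) fst = gspace (V n) \<delta>" unfolding M_def by (rule S.G.distr_PN_fst)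
      show "(\<lambda>\<omega>. 0) \<in> borel_measurable (M n)" by simp
      show "distr (M n) borel (\<lambda>\<omega>. 0) = gauss_var 0"
        using prob_space.distr_const[OF pM[of n], of 0 borel] by (simp add: gauss_var_def)
      show "prob_space.indep_set (M n) (sets (gen_sigma (M n) (\<lambda>j \<omega>. fst \<omega> j) (J n)))
           (sets (vimage_algebra (space (M n)) (\<lambda>\<omega>. 0 :: real) borel))"
        by (rule prob_space.indep_set_const[OF pM]) (use sub[of n] in \<open>simp add: subalgebra_def\<close>)
    next
      fix p \<epsilon> :: real assume p: "0 < p" and \<epsilon>: "0 < \<epsilon>"
      show "(\<lambda>n. measure (M n) {\<omega> \<in> space (M n). ennreal \<epsilon> <
            nn_cond_exp (M n) (gen_sigma (M n) (\<lambda>j \<omega>. fst \<omega> j) (J n)) (\<lambda>\<omega>. ennreal (\<bar>0 - 0\<bar> powr p)) \<omega>}) \<longlonglongrightarrow> 0"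
        by (rule cond_exp_tail_tendsto[OF pM sub _ _ \<epsilon>]) (use p in auto)
    qed
  qed
qed

end
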